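(* Let $p$ and $q$ be odd primes with $p\equiv -1\pmod q$. Consider isomorphism classes of skew braces $(B,+,\circ)$ with $(B,+)\cong\mathcal{G}_F$, and let $\lambda:(B,\circ)\to\mathrm{Aut}(B,+)$ be the homomorphism $\lambda_a(b)=-a+a\circ b$. The number of isomorphism classes with given $|\ker\lambda|$ and given isomorphism type of $(B,\circ)$ is as follows: - $|\ker\lambda|=1$: $p+q-3$ with $(B,\circ)\cong\mathcal{G}_F$, and none with $(B,\circ)\cong\mathbb{Z}_p^2\times\mathbb{Z}_q$; - $|\ker\lambda|=q$: $1$ with $(B,\circ)\cong\mathbb{Z}_p^2\times\mathbb{Z}_q$, and none with $(B,\circ)\cong\mathcal{G}_F$; - $|\ker\lambda|=p^2$: $1$ with $(B,\circ)\cong\mathbb{Z}_p^2\times\mathbb{Z}_q$, and $q-2$ with $(B,\circ)\cong\mathcal{G}_F$; - $|\ker\lambda|=p^2q$: $1$ with $(B,\circ)\cong\mathcal{G}_F$, and none with $(B,\circ)\cong\mathbb{Z}_p^2\times\mathbb{Z}_q$; and there are no other skew braces with additive group isomorphic to $\mathcal{G}_F$.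
   Context: A skew (left) brace is a triple $(B,+,\circ)$ where $(B,+)$ and $(B,\circ)$ are groups (not necessarily abelian) such that $a\circ(b+c)=a\circ b-a+a\circ c$ for all $a,b,c\in B$; isomorphisms are bijections preserving both operations. Let $x^2+\xi x+1$ be an irreducible polynomial over $\mathbb{Z}_p$ whose companion matrix $F=\begin{bmatrix}0&-1\\1&-\xi\end{bmatrix}$ has order $q$. Then $\mathcal{G}_F=\langle\sigma,\tau,\epsilon\mid\sigma^p=\tau^p=\epsilon^q=[\sigma,\tau]=1,\ \epsilon\sigma\epsilon^{-1}=\tau,\ \epsilon\tau\epsilon^{-1}=\sigma^{-1}\tau^{-\xi}\rangle\cong\mathbb{Z}_p^2\rtimes_F\mathbb{Z}_q$, which is the unique non-abelian group of order $p^2q$ up to isomorphism. *)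

theory Defs
  imports
    "HOL-Algebra.Bij"
    "HOL-Algebra.Elementary_Groups"
    "HOL-Algebra.Multiplicative_Group"
    "HOL-Number_Theory.Cong"
    "HOL-Computational_Algebra.Polynomial_Factorial"
    "Jordan_Normal_Form.Matrix"
    "Berlekamp_Zassenhaus.Finite_Field"
begin

section \<open>Skew braces\<close>

text \<open>
  A record of type \<^typ>\<open>'a ring\<close> serves only as a carrier with two operations: \<open>\<oplus>\<close>, \<open>\<ominus>\<close> are addition
  and (left-associated) subtraction in \<open>(B,+)\<close>, which is \<^term>\<open>add_monoid B\<close> and need not be abelian;
  \<open>\<otimes>\<close> is the circle operation, so that \<open>(B,\<circ>)\<close> is \<open>B\<close> itself regarded as a monoid record.
\<close>

locale skew_brace =
  fixes B :: "('a, 'm) ring_scheme" (structure)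
  assumes add_group: "group (add_monoid B)"
    and circ_group: "group B"
    and brace_law:
      "\<lbrakk> a \<in> carrier B; b \<in> carrier B; c \<in> carrier B \<rbrakk> \<Longrightarrow>
        a \<otimes> (b \<oplus> c) = ((a \<otimes> b) \<ominus> a) \<oplus> (a \<otimes> c)"

text \<open>Extensional on the carrier, as the elements of \<^const>\<open>AutoGroup\<close> are.\<close>

definition brace_lambda :: "('a, 'm) ring_scheme \<Rightarrow> 'a \<Rightarrow> 'a \<Rightarrow> 'a" where
  "brace_lambda B a = (\<lambda>b \<in> carrier B. (\<ominus>\<^bsub>B\<^esub> a) \<oplus>\<^bsub>B\<^esub> (a \<otimes>\<^bsub>B\<^esub> b))"

definition ker_lambda :: "('a, 'm) ring_scheme \<Rightarrow> 'a set" where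
  "ker_lambda B = kernel B (AutoGroup (add_monoid B)) (brace_lambda B)"

definition brace_iso :: "('a, 'm) ring_scheme \<Rightarrow> ('b, 'n) ring_scheme \<Rightarrow> ('a \<Rightarrow> 'b) set" where
  "brace_iso A B = iso (add_monoid A) (add_monoid B) \<inter> iso A B"

definition brace_iso_rel :: "('a ring \<times> 'a ring) set" where
  "brace_iso_rel = {(A, B). skew_brace A \<and> skew_brace B \<and> brace_iso A B \<noteq> {}}"

text \<open>
  The isomorphism classes met by a set of skew braces; finiteness is explicit because
  \<^const>\<open>card\<close> is \<open>0\<close> on infinite sets.
\<close>

definition num_iso_classes :: "'a ring set \<Rightarrow> nat \<Rightarrow> bool" where
  "num_iso_classes S n \<longleftrightarrow> finite (S // brace_iso_rel) \<and> card (S // brace_iso_rel) = n"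


section \<open>Groups given by generators and relations\<close>

text \<open>A letter \<open>(g, True)\<close> stands for the generator \<open>g\<close>, and \<open>(g, False)\<close> for its inverse.\<close>

type_synonym 'g gword = "('g \<times> bool) list"

definition gpow :: "'g \<Rightarrow> int \<Rightarrow> 'g gword" where
  "gpow g k = replicate (nat \<bar>k\<bar>) (g, 0 \<le> k)"

inductive pres_eq :: "('g gword \<times> 'g gword) set \<Rightarrow> 'g gword \<Rightarrow> 'g gword \<Rightarrow> bool"
  for R where
  refl: "pres_eq R u u"
| sym: "pres_eq R u v \<Longrightarrow> pres_eq R v u"
| trans: "pres_eq R u v \<Longrightarrow> pres_eq R v w \<Longrightarrow> pres_eq R u w"
| cancel: "pres_eq R (u @ [(g, b), (g, \<not> b)] @ v) (u @ v)"
| relation: "(r, s) \<in> R \<Longrightarrow> pres_eq R (u @ r @ v) (u @ s @ v)"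

definition pres_rel :: "('g gword \<times> 'g gword) set \<Rightarrow> ('g gword \<times> 'g gword) set" where
  "pres_rel R = {(u, v). pres_eq R u v}"

definition presented_group :: "('g gword \<times> 'g gword) set \<Rightarrow> 'g gword set monoid" where
  "presented_group R =
    \<lparr>carrier = UNIV // pres_rel R,
     Group.monoid.mult = \<lambda>X Y. \<Union>u \<in> X. \<Union>v \<in> Y. pres_rel R `` {u @ v},
     one = pres_rel R `` {[]}\<rparr>"

lemma equiv_pres_rel: "equiv UNIV (pres_rel R)"
proof (rule equivI)
  show "refl (pres_rel R)" by (simp add: refl_on_def pres_rel_def pres_eq.refl)
  show "sym (pres_rel R)" unfolding sym_def pres_rel_def by (blast intro: pres_eq.sym)
  show "trans (pres_rel R)" unfolding trans_def pres_rel_def by (blast intro: pres_eq.trans)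
qed simp

lemma pres_eq_context:
  assumes "pres_eq R u v"
  shows "pres_eq R (a @ u @ b) (a @ v @ b)"
  using assms
proof induction
  case (refl u)
  show ?case by (rule pres_eq.refl)
next
  case (sym u v)
  show ?case by (rule pres_eq.sym) (rule sym.IH)
next
  case (trans u v w)
  show ?case by (rule pres_eq.trans) (rule trans.IH)+
next
  case (cancel u g c v)
  show ?case using pres_eq.cancel[of R "a @ u" g c "v @ b"] by simp
next
  case (relation r s u v)
  then show ?case using pres_eq.relation[of r s R "a @ u" "v @ b"] by simp
qed

lemma pres_eq_append:
  assumes "pres_eq R u u'" "pres_eq R v v'"
  shows "pres_eq R (u @ v) (u' @ v')"
proof (rule pres_eq.trans)
  show "pres_eq R (u @ v) (u' @ v)" using pres_eq_context[OF assms(1), of "[]" v] by simp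
  show "pres_eq R (u' @ v) (u' @ v')" using pres_eq_context[OF assms(2), of u' "[]"] by simp
qed

lemma mult_presented_group:
  "pres_rel R `` {u} \<otimes>\<^bsub>presented_group R\<^esub> pres_rel R `` {v} = pres_rel R `` {u @ v}"
proof -
  have "pres_rel R `` {u' @ v'} = pres_rel R `` {u @ v}"
    if "pres_eq R u u'" "pres_eq R v v'" for u' v'
    using pres_eq_append[OF that] equiv_class_eq[OF equiv_pres_rel, of "u @ v" "u' @ v'" R]
    by (simp add: pres_rel_def)
  then have "(\<Union>u' \<in> pres_rel R `` {u}. \<Union>v' \<in> pres_rel R `` {v}. pres_rel R `` {u' @ v'})
      = (\<Union>u' \<in> pres_rel R `` {u}. \<Union>v' \<in> pres_rel R `` {v}. pres_rel R `` {u @ v})"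
    by (intro SUP_cong) (simp_all add: pres_rel_def)
  also have "\<dots> = pres_rel R `` {u @ v}"
    using equiv_class_self[OF equiv_pres_rel, of u R] equiv_class_self[OF equiv_pres_rel, of v R]
    by blast
  finally show ?thesis by (simp add: presented_group_def)
qed

lemma pres_eq_inverse: "pres_eq R (rev (map (\<lambda>(g, b). (g, \<not> b)) u) @ u) []"
proof (induction u)
  case Nil
  show ?case by (simp add: pres_eq.refl)
next
  case (Cons x u)
  obtain g b where x: "x = (g, b)" by force
  have "pres_eq R (rev (map (\<lambda>(g, b). (g, \<not> b)) u) @ [(g, \<not> b), (g, \<not> \<not> b)] @ u)
    (rev (map (\<lambda>(g, b). (g, \<not> b)) u) @ u)"
    by (rule pres_eq.cancel)
  then show ?case using Cons pres_eq.trans by (fastforce simp: x)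
qed

lemma group_presented_group: "group (presented_group R)"
proof (rule groupI)
  have car: "carrier (presented_group R) = range (\<lambda>u. pres_rel R `` {u})"
    by (auto simp: presented_group_def quotient_def)
  have one: "\<one>\<^bsub>presented_group R\<^esub> = pres_rel R `` {[]}"
    by (simp add: presented_group_def)
  show "\<one>\<^bsub>presented_group R\<^esub> \<in> carrier (presented_group R)"
    by (auto simp: car one)
  show "x \<otimes>\<^bsub>presented_group R\<^esub> y \<in> carrier (presented_group R)"
    if "x \<in> carrier (presented_group R)" "y \<in> carrier (presented_group R)" for x y
    using that by (auto simp: car mult_presented_group)
  show "x \<otimes>\<^bsub>presented_group R\<^esub> y \<otimes>\<^bsub>presented_group R\<^esub> z
      = x \<otimes>\<^bsub>presented_group R\<^esub> (y \<otimes>\<^bsub>presented_group R\<^esub> z)"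
    if "x \<in> carrier (presented_group R)" "y \<in> carrier (presented_group R)"
      "z \<in> carrier (presented_group R)" for x y z
    using that by (auto simp: car mult_presented_group)
  fix x assume "x \<in> carrier (presented_group R)"
  then obtain u where u: "x = pres_rel R `` {u}" by (auto simp: car)
  show "\<one>\<^bsub>presented_group R\<^esub> \<otimes>\<^bsub>presented_group R\<^esub> x = x"
    by (simp add: u one mult_presented_group)
  let ?v = "rev (map (\<lambda>(g, b). (g, \<not> b)) u)"
  have "pres_rel R `` {?v @ u} = pres_rel R `` {[]}"
    using pres_eq_inverse[of R u] equiv_class_eq[OF equiv_pres_rel, of "?v @ u" "[]" R]
    by (simp add: pres_rel_def)
  then show "\<exists>y \<in> carrier (presented_group R).
      y \<otimes>\<^bsub>presented_group R\<^esub> x = \<one>\<^bsub>presented_group R\<^esub>"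
    unfolding u one car by (metis mult_presented_group rangeI)
qed


section \<open>The groups of order \<open>p\<^sup>2q\<close>\<close>

datatype gen = Sig | Tau | Eps

text \<open>
  Words are written out literally: the relations are \<open>\<sigma>\<^sup>p = 1\<close>, \<open>\<tau>\<^sup>p = 1\<close>, \<open>\<epsilon>\<^sup>q = 1\<close>,
  \<open>\<sigma>\<tau>\<sigma>\<^sup>-\<^sup>1\<tau>\<^sup>-\<^sup>1 = 1\<close>, \<open>\<epsilon>\<sigma>\<epsilon>\<^sup>-\<^sup>1 = \<tau>\<close>, \<open>\<epsilon>\<tau>\<epsilon>\<^sup>-\<^sup>1 = \<sigma>\<^sup>-\<^sup>1\<tau>\<^sup>-\<^sup>\<xi>\<close>. The exponent \<open>\<xi>\<close> is an element of
  the prime field \<open>\<int>\<^sub>p\<close> (so \<open>p\<close> is the cardinality of the index type); its representative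
  in \<open>{0..<p}\<close> is used.
\<close>

definition GF_relations :: "nat \<Rightarrow> 'f::prime_card mod_ring \<Rightarrow> (gen gword \<times> gen gword) set" where
  "GF_relations q \<xi> =
    {(gpow Sig (int CARD('f)), []),
     (gpow Tau (int CARD('f)), []),
     (gpow Eps (int q), []),
     (gpow Sig 1 @ gpow Tau 1 @ gpow Sig (-1) @ gpow Tau (-1), []),
     (gpow Eps 1 @ gpow Sig 1 @ gpow Eps (-1), gpow Tau 1),
     (gpow Eps 1 @ gpow Tau 1 @ gpow Eps (-1), gpow Sig (-1) @ gpow Tau (- to_int_mod_ring \<xi>))}"

definition GF :: "nat \<Rightarrow> 'f::prime_card mod_ring \<Rightarrow> gen gword set monoid" where
  "GF q \<xi> = presented_group (GF_relations q \<xi>)"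

definition Zp2_Zq :: "nat \<Rightarrow> nat \<Rightarrow> ((int \<times> int) \<times> int) monoid" where
  "Zp2_Zq p q = (integer_mod_group p \<times>\<times> integer_mod_group p) \<times>\<times> integer_mod_group q"

text \<open>The companion matrix of \<open>x\<^sup>2 + \<xi>x + 1\<close>.\<close>

definition F_mat :: "'f::prime_card mod_ring \<Rightarrow> 'f mod_ring mat" where
  "F_mat \<xi> = mat_of_rows_list 2 [[0, -1], [1, -\<xi>]]"

definition mat_order :: "'k::field mat \<Rightarrow> nat" where
  "mat_order A = group.ord (units_of (ring_mat TYPE('k) (dim_row A) ())) A"


text \<open>
  Skew braces on subsets of the type \<open>'a\<close> with additive group isomorphic to \<open>\<G>\<^sub>F\<close>, and those
  among them with \<open>|ker \<lambda>| = k\<close> and \<open>(B,\<circ>)\<close> isomorphic to \<open>M\<close>. If \<open>'a\<close> is infinite, every finite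
  skew brace has an isomorphic copy on a subset of \<open>'a\<close>, so no isomorphism class is lost.
\<close>

definition GF_braces :: "nat \<Rightarrow> 'f::prime_card mod_ring \<Rightarrow> 'a ring set" where
  "GF_braces q \<xi> = {B. skew_brace B \<and> add_monoid B \<cong> GF q \<xi>}"

definition GF_braces_of ::
    "nat \<Rightarrow> 'f::prime_card mod_ring \<Rightarrow> nat \<Rightarrow> 'g monoid \<Rightarrow> 'a ring set" where
  "GF_braces_of q \<xi> k M = {B \<in> GF_braces q \<xi>. card (ker_lambda B) = k \<and> B \<cong> M}"

end

theory Submission
  imports Defs
begin

text \<open>
  Identify \<open>\<int>\<^sub>p\<^sup>2\<close> with the field \<open>K\<close> of \<open>p\<^sup>2\<close> elements so that \<open>F\<close> becomes multiplication by a root of unity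
  \<open>\<zeta>\<close> of order \<open>q\<close>; then the additive group is \<open>K \<rtimes> \<mu>\<close> with \<open>\<mu> = \<langle>\<zeta>\<rangle>\<close>, and its automorphisms are \<open>K\<close>-semilinear
  up to conjugation. Because \<open>p\<^sup>2q\<close> is odd, \<open>\<lambda>\<close> avoids the Frobenius coset, so
  \<open>\<lambda>\<^bsub>(x, z)\<^esub> (y, w) = (z\<^sup>s y + (1 - w) c (x, z), w)\<close> for some \<open>s\<close> and a cocycle \<open>c\<close>. Writing
  \<open>c (x, 1) = \<alpha> x + \<beta> x\<^sup>p\<close>, the homomorphism property forces \<open>\<alpha> + \<alpha>\<^sup>2 = N(\<beta>) z\<^sup>2\<^sup>s\<^sup>+\<^sup>1\<close> for all \<open>z \<noteq> 1\<close> in \<open>\<mu>\<close>.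
  Hence \<open>c (x, 1)\<close> is \<open>0\<close>, or \<open>- x\<close>, or \<open>2 s + 1 = q\<close> and \<open>c (x, 1)\<close> inverts \<open>X \<mapsto> b X\<^sup>p - X\<close> for some \<open>b \<noteq> 0\<close> with
  \<open>N(b) \<noteq> 1\<close>; the values \<open>c (0, z)\<close> are removed by an inner automorphism. The complete isomorphism
  invariants are \<open>s\<close> and, by Hilbert 90, \<open>N(b)\<close>, which takes \<open>p - 2\<close> values in the last family.
\<close>

section \<open>Finite fields with \<open>p\<^sup>2\<close> elements\<close>

text \<open>The cocycle also yields the circle group. For a = (x, z) the identity C(a o b) = C(a) +
  z^s C(b) says that (x, z) |-> (C(x, z), z) is a homomorphism from (B,o) to K \<rtimes> \<mu> with
  z acting as z^s. For each nonzero normal form this map is bijective, so the action has exponent s;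
  for c = 0 the product formula shows exponent s + 1. Hence (B,o) is abelian exactly when q divides
  the exponent. The kernel of \<lambda> is cut out by z^s = 1 and c(x, z) = 0, so it has order p^2
  or p^2 q when c = 0, and 1 or q otherwise. The entry p + q - 3 is (q - 1) + (p - 2): the nonzero s
  with c(x, 1) = - x, and the norms N(b) in the prime field other than 0 and 1 at s = (q - 1)/2. The
  recurring device is to read P d + Q d^p = r together with its Frobenius conjugate as a linear
  system in d and d^p. Its determinant is N(P) - N(Q), which is where the condition N(b) \<noteq> 1
  comes from.\<close>

lemma card_nth_roots_le:
  fixes y :: "'k::field"
  assumes "n > 0"
  shows "finite {x. x ^ n = y}" "card {x. x ^ n = y} \<le> n"
proof -
  define P where "P = monom 1 n - [:y:]"
  have "coeff P n = 1" using assms by (cases n) (auto simp: P_def)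
  then have P: "P \<noteq> 0" by auto
  have "degree P \<le> n" unfolding P_def by (intro degree_diff_le degree_monom_le) auto
  moreover have eq: "{x. x ^ n = y} = {x. poly P x = 0}" by (auto simp: P_def poly_monom)
  ultimately show "finite {x. x ^ n = y}" "card {x. x ^ n = y} \<le> n"
    using poly_roots_finite[OF P] card_poly_roots_bound[OF P] by auto
qed

lemma card_le_card_image_mult:
  assumes "finite A" "\<And>y. y \<in> f ` A \<Longrightarrow> card {x \<in> A. f x = y} \<le> m"
  shows "card A \<le> card (f ` A) * m"
proof -
  have "card A = card (\<Union>y\<in>f ` A. {x \<in> A. f x = y})" by (rule arg_cong[of _ _ card]) auto
  also have "\<dots> \<le> (\<Sum>y\<in>f ` A. card {x \<in> A. f x = y})" by (intro card_UN_le) (use assms in auto)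
  also have "\<dots> \<le> (\<Sum>y\<in>f ` A. m)" by (intro sum_mono assms)
  finally show ?thesis by simp
qed

lemma finite_field_pow_card_minus_1:
  fixes x :: "'k::finite_field"
  assumes "x \<noteq> 0" shows "x ^ (CARD('k) - 1) = 1"
proof -
  have "CARD('k) > 0" by (simp add: card_gt_0_iff)
  then have "x * x ^ (CARD('k) - 1) = x * 1"
    using finite_field_power_card_eq_same[of x] by (metis Suc_pred' mult.right_neutral power_Suc)
  then show ?thesis using assms by simp
qed

text \<open>Each fibre of x |-> x^m on the nonzero elements has at most m members, and the image
  lies among the at most n solutions of y^n = 1. Distributing m n elements over these fibres forces
  equality throughout.\<close>

lemma finite_field_roots_of_unity:
  assumes "CARD('k::finite_field) - 1 = m * n" "m * n > 0"
  shows "(\<lambda>x. x ^ m) ` (UNIV - {0 :: 'k}) = {y. y ^ n = 1}" "card {y :: 'k. y ^ n = 1} = n"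
proof -
  let ?A = "UNIV - {0 :: 'k}" and ?f = "\<lambda>x :: 'k. x ^ m"
  have mn: "m > 0" "n > 0" using assms by auto
  have fin: "finite {y :: 'k. y ^ n = 1}" by simp
  have le: "card {y :: 'k. y ^ n = 1} \<le> n" by (rule card_nth_roots_le) fact
  have sub: "?f ` ?A \<subseteq> {y. y ^ n = 1}"
    using finite_field_pow_card_minus_1[where ?'k = 'k] assms
    by (auto simp: power_mult[symmetric])
  have "n * m = card ?A" using assms by (simp add: card_Diff_subset mult.commute)
  also have "\<dots> \<le> card (?f ` ?A) * m"
  proof (rule card_le_card_image_mult)
    fix y
    have "card {x \<in> ?A. ?f x = y} \<le> card {x. x ^ m = y}"
      by (rule card_mono) auto
    also have "\<dots> \<le> m" by (rule card_nth_roots_le) fact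
    finally show "card {x \<in> ?A. ?f x = y} \<le> m" .
  qed simp
  finally have "n \<le> card (?f ` ?A)" using mn by simp
  with le card_mono[OF fin sub] card_subset_eq[OF fin sub]
  show "?f ` ?A = {y. y ^ n = 1}" "card {y :: 'k. y ^ n = 1} = n" by auto
qed

text \<open>
  \<open>\<zeta>\<close> plays the role of the companion matrix \<open>F\<close>, and the group \<open>\<mu>\<close> of \<open>q\<close>-th roots of unity that of the
  cyclic factor \<open>\<int>\<^sub>q\<close>. As \<open>q\<close> divides \<open>p + 1\<close>, the Frobenius map inverts \<open>\<mu>\<close>.
\<close>

locale quadratic_field =
  fixes p q :: nat and \<zeta> :: "'k::finite_field"
  assumes p: "prime p" "odd p" and q: "prime q" "odd q" and q_dvd: "q dvd p + 1"
    and card_K: "CARD('k) = p\<^sup>2"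
    and zeta_pow_q: "\<zeta> ^ q = 1" and zeta_ne_1: "\<zeta> \<noteq> 1"
begin

definition \<mu> :: "'k set" where "\<mu> = {z. z ^ q = 1}"

lemma q_ge_3: "q \<ge> 3"
proof -
  have "q \<noteq> 2" using q(2) by auto
  with prime_ge_2_nat[OF q(1)] show ?thesis by linarith
qed

lemma p_ge_3: "p \<ge> 3"
proof -
  have "p \<noteq> 2" using p(2) by auto
  with prime_ge_2_nat[OF p(1)] show ?thesis by linarith
qed

lemma char_K: "CHAR('k) = p"
proof -
  have "CHAR('k) dvd p\<^sup>2" using CHAR_dvd_CARD[where ?'a = 'k] card_K by simp
  moreover have "CHAR('k) > 0" using finite_imp_CHAR_pos[where ?'a = 'k] by simp
  then have "prime CHAR('k)" by (rule prime_CHAR_semidom)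
  ultimately have "CHAR('k) dvd p" using prime_dvd_power by blast
  with \<open>prime CHAR('k)\<close> p(1) show ?thesis using primes_dvd_imp_eq by blast
qed

lemma frob_add: "(x + y :: 'k) ^ p = x ^ p + y ^ p"
  by (rule freshmans_dream) (simp_all add: char_K p)

lemma frob_minus: "(- x :: 'k) ^ p = - (x ^ p)"
  using p(2) by simp

lemma frob_diff: "(x - y :: 'k) ^ p = x ^ p - y ^ p"
  using frob_add[of x "- y"] by (simp add: frob_minus)

lemma frob_frob: "((x :: 'k) ^ p) ^ p = x"
  using finite_field_power_card_eq_same[of x] card_K by (simp add: power_mult[symmetric] power2_eq_square)

lemmas frob_simps = frob_add frob_diff frob_minus power_mult_distrib frob_frob

lemma card_minus_1: "CARD('k) - 1 = (p - 1) * (p + 1)" "(p - 1) * (p + 1) > 0"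
proof -
  have "(p - 1) * (p + 1) = p * p - 1" by (cases p) (auto simp: algebra_simps)
  moreover have "3 * 3 \<le> p * p" using p_ge_3 by (intro mult_le_mono)
  ultimately show "CARD('k) - 1 = (p - 1) * (p + 1)" "(p - 1) * (p + 1) > 0"
    by (simp_all add: card_K power2_eq_square)
qed

lemmas card_minus_1' = card_minus_1[unfolded mult.commute[of "p - 1"]]

text \<open>x^(p+1) is the norm to the prime field and u^(p-1) = u^p / u, so this is the root count
  for m = p - 1, n = p + 1. Exchanging the two exponents gives \<open>norm_surj\<close>.\<close>

lemma hilbert90:
  assumes "(b :: 'k) ^ (p + 1) = 1"
  shows "\<exists>u. u \<noteq> 0 \<and> u ^ (p - 1) = b"
proof -
  have "b \<in> (\<lambda>x. x ^ (p - 1)) ` (UNIV - {0})"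
    unfolding finite_field_roots_of_unity(1)[OF card_minus_1] using assms by simp
  then show ?thesis by auto
qed

lemma norm_surj:
  assumes "(n :: 'k) ^ p = n"
  shows "\<exists>b. b ^ (p + 1) = n"
proof (cases "n = 0")
  case True
  then show ?thesis by (intro exI[of _ 0]) simp
next
  case False
  have "n * n ^ (p - 1) = n * 1" using assms p_ge_3 by (cases p) auto
  with False have "n ^ (p - 1) = 1" by simp
  then have "n \<in> (\<lambda>x. x ^ (p + 1)) ` (UNIV - {0})"
    unfolding finite_field_roots_of_unity(1)[OF card_minus_1'] by simp
  then show ?thesis by auto
qed

lemma card_fixed: "card {x :: 'k. x ^ p = x} = p"
proof -
  have "{x :: 'k. x ^ p = x} = insert 0 {x. x ^ (p - 1) = 1}"
    using p_ge_3 by (cases p) auto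
  moreover have "card {x :: 'k. x ^ (p - 1) = 1} = p - 1"
    by (rule finite_field_roots_of_unity(2)[OF card_minus_1'])
  moreover have "(0 :: 'k) ^ (p - 1) \<noteq> 1" using p_ge_3 by (simp add: power_0_left)
  ultimately show ?thesis using p_ge_3 by simp
qed

lemma card_mu: "card \<mu> = q"
proof -
  obtain m where m: "p + 1 = q * m" using q_dvd by blast
  have eq: "(p - 1) * (p + 1) = (p - 1) * m * q" unfolding m by (simp only: mult_ac)
  have "CARD('k) - 1 = (p - 1) * m * q" "(p - 1) * m * q > 0" using card_minus_1 unfolding eq by auto
  then show ?thesis unfolding \<mu>_def by (rule finite_field_roots_of_unity(2))
qed

lemma one_mu [simp]: "1 \<in> \<mu>" by (simp add: \<mu>_def)
lemma mult_mu [simp]: "z \<in> \<mu> \<Longrightarrow> w \<in> \<mu> \<Longrightarrow> z * w \<in> \<mu>" by (simp add: \<mu>_def power_mult_distrib)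
lemma inverse_mu [simp]: "z \<in> \<mu> \<Longrightarrow> inverse z \<in> \<mu>" by (simp add: \<mu>_def power_inverse)
lemma power_mu [simp]: "z \<in> \<mu> \<Longrightarrow> z ^ n \<in> \<mu>"
  by (simp add: \<mu>_def power_mult[symmetric] mult.commute[of n]) (simp add: power_mult)
lemma mu_nonzero: "z \<in> \<mu> \<Longrightarrow> z \<noteq> 0" using q_ge_3 by (auto simp: \<mu>_def power_0_left)
lemma zeta_mu [simp]: "\<zeta> \<in> \<mu>" by (simp add: \<mu>_def zeta_pow_q)

lemma frob_mu: "z \<in> \<mu> \<Longrightarrow> z ^ p = inverse z"
proof -
  assume z: "z \<in> \<mu>"
  obtain m where m: "p + 1 = q * m" using q_dvd by blast
  have "z * z ^ p = z ^ (q * m)" using m by (metis Suc_eq_plus1 power_Suc)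
  also have "\<dots> = 1" using z by (simp add: \<mu>_def power_mult)
  finally show ?thesis by (metis inverse_unique)
qed

lemma mu_pow_eq_1:
  assumes "z \<in> \<mu>" "z ^ n = 1" "\<not> q dvd n"
  shows "z = 1"
proof -
  have "coprime q n" using assms(3) q(1) by (simp add: prime_imp_coprime)
  then obtain a b where "n * a = q * b + 1"
    using q_ge_3 by (metis bezout_nat coprime_iff_gcd_eq_1 gcd.commute assms(3) dvd_0_right)
  then have "z ^ (q * b + 1) = (z ^ n) ^ a" by (simp add: power_mult[symmetric])
  with assms show ?thesis by (simp add: \<mu>_def power_mult)
qed

lemma zeta_pow_inj: "inj_on (\<lambda>i. \<zeta> ^ i) {..<q}"
proof -
  have "i = j" if "i \<le> j" "j < q" "\<zeta> ^ i = \<zeta> ^ j" for i j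
  proof -
    obtain k where k: "j = i + k" using \<open>i \<le> j\<close> le_Suc_ex by blast
    have "\<zeta> ^ i * \<zeta> ^ k = \<zeta> ^ i * 1" using that(3) unfolding k power_add by simp
    moreover have "\<zeta> ^ i \<noteq> 0" using mu_nonzero[OF zeta_mu] by simp
    ultimately have "\<zeta> ^ k = 1" using mult_left_cancel by blast
    then have "q dvd k" using mu_pow_eq_1[OF zeta_mu] zeta_ne_1 by blast
    with \<open>j < q\<close> show "i = j" unfolding k using nat_dvd_not_less[of k q] by linarith
  qed
  then show ?thesis unfolding inj_on_def by (metis lessThan_iff nat_le_linear)
qed

lemma mu_eq: "\<mu> = (\<lambda>i. \<zeta> ^ i) ` {..<q}"
  using card_image[OF zeta_pow_inj] card_mu
  by (intro card_subset_eq[symmetric]) auto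

lemma mu_zeta_powE:
  assumes "z \<in> \<mu>" obtains i where "i < q" "z = \<zeta> ^ i"
  using assms mu_eq by auto

lemma zeta_sq_ne_1: "\<zeta> * \<zeta> \<noteq> 1"
proof -
  have "\<not> q dvd 2" using q_ge_3 dvd_imp_le[of q 2] by linarith
  then show ?thesis using mu_pow_eq_1[OF zeta_mu, of 2] zeta_ne_1 by (auto simp: power2_eq_square)
qed

text \<open>Frobenius inverts \<zeta>, so this places \<zeta> outside the prime field. It makes 1,
  \<zeta> a basis of K and separates linear maps from Frobenius-type maps.\<close>

lemma zeta_ne_inverse: "inverse \<zeta> \<noteq> \<zeta>"
  using zeta_sq_ne_1 mu_nonzero[OF zeta_mu] by (metis left_inverse)

section \<open>Coordinates over the prime field and additive maps of K\<close>

lemma of_int_frob: "(of_int n :: 'k) ^ p = of_int n"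
proof -
  have nat: "(of_nat n :: 'k) ^ p = of_nat n" for n
    by (induction n) (use p_ge_3 in \<open>simp_all add: frob_simps\<close>)
  show ?thesis by (cases n rule: int_cases2) (simp_all add: nat frob_minus)
qed

lemma of_int_eq_0: "(of_int n :: 'k) = 0 \<longleftrightarrow> int p dvd n"
  using of_int_eq_0_iff_char_dvd[where ?'a = 'k] char_K by simp

definition coord :: "int \<times> int \<Rightarrow> 'k" where
  "coord = (\<lambda>(a, b). of_int a + of_int b * \<zeta>)"

lemma coord_eq_0:
  assumes "of_int a + of_int b * \<zeta> = 0"
  shows "(of_int a :: 'k) = 0" "(of_int b :: 'k) = 0"
proof -
  show b: "(of_int b :: 'k) = 0"
  proof (rule ccontr)
    assume "(of_int b :: 'k) \<noteq> 0"
    then have "\<zeta> = of_int (- a) / of_int b" using assms by (simp add: field_simps eq_neg_iff_add_eq_0 add.commute)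
    then have "\<zeta> ^ p = \<zeta>" by (simp add: power_divide of_int_frob frob_minus)
    then show False using frob_mu[OF zeta_mu] zeta_ne_inverse by simp
  qed
  show "(of_int a :: 'k) = 0" using assms b by simp
qed

lemma bij_coord: "bij_betw coord ({0..<int p} \<times> {0..<int p}) UNIV"
proof -
  have inj: "inj_on coord ({0..<int p} \<times> {0..<int p})"
  proof (rule inj_onI, clarify)
    fix a b a' b' assume ab: "a \<in> {0..<int p}" "b \<in> {0..<int p}" "a' \<in> {0..<int p}" "b' \<in> {0..<int p}"
      and eq: "coord (a, b) = coord (a', b')"
    have "of_int (a - a') + of_int (b - b') * \<zeta> = 0" using eq by (simp add: coord_def algebra_simps)
    from coord_eq_0[OF this] have "int p dvd a - a'" "int p dvd b - b'" by (simp_all only: of_int_eq_0)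
    then have "a mod int p = a' mod int p" "b mod int p = b' mod int p" by (simp_all add: mod_eq_dvd_iff)
    with ab show "a = a' \<and> b = b'" by simp
  qed
  then have "card (coord ` ({0..<int p} \<times> {0..<int p})) = CARD('k)"
    by (simp add: card_image card_cartesian_product card_K power2_eq_square)
  then have "coord ` ({0..<int p} \<times> {0..<int p}) = UNIV" by (intro card_subset_eq) auto
  with inj show ?thesis by (simp add: bij_betw_def)
qed

lemma coordE: obtains a b where "0 \<le> a" "a < int p" "0 \<le> b" "b < int p" "x = of_int a + of_int b * \<zeta>"
proof -
  have "x \<in> coord ` ({0..<int p} \<times> {0..<int p})" using bij_coord by (simp add: bij_betw_def)
  then show ?thesis using that by (auto simp: coord_def)
qed

lemma additive_of_int:
  fixes f :: "'k \<Rightarrow> 'k"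
  assumes "\<And>x y. f (x + y) = f x + f y"
  shows "f (of_int n * x) = of_int n * f x"
proof -
  interpret Modules.additive f by standard (rule assms)
  have nat: "f (of_nat n * x) = of_nat n * f x" for n
    by (induction n) (simp_all add: zero add algebra_simps)
  show ?thesis by (cases n rule: int_cases2) (simp_all add: nat minus)
qed

text \<open>An additive map is linear over the prime field, hence fixed by its values at 1 and
  \<zeta>. Matching these two values is a 2 x 2 system for a and b with determinant \<zeta>^(-1) -
  \<zeta>, which is nonzero.\<close>

lemma additive_form:
  fixes f :: "'k \<Rightarrow> 'k"
  assumes add: "\<And>x y. f (x + y) = f x + f y"
  obtains a b where "\<And>x. f x = a * x + b * x ^ p"
proof -
  define D where "D = inverse \<zeta> - \<zeta>"
  have D: "D \<noteq> 0" using zeta_ne_inverse by (simp add: D_def)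
  define b where "b = (f \<zeta> - \<zeta> * f 1) / D"
  define a where "a = f 1 - b"
  have f1: "f 1 = a + b" by (simp add: a_def)
  have "b * D = f \<zeta> - \<zeta> * f 1" using D by (simp add: b_def)
  then have fz: "f \<zeta> = a * \<zeta> + b * inverse \<zeta>" by (simp add: a_def D_def algebra_simps)
  have "f x = a * x + b * x ^ p" for x
  proof -
    obtain m n where x: "x = of_int m + of_int n * \<zeta>" by (rule coordE)
    have "f x = of_int m * f 1 + of_int n * f \<zeta>"
      using additive_of_int[of f, OF add] add x by (metis mult.right_neutral)
    then show ?thesis
      by (simp add: x f1 fz frob_simps of_int_frob frob_mu algebra_simps)
  qed
  then show ?thesis using that by blast
qed

lemma linear_frob_coeff_eq:
  fixes a b a' b' :: 'k
  assumes "\<And>x. a * x + b * x ^ p = a' * x + b' * x ^ p"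
  shows "a = a'" "b = b'"
proof -
  have 1: "a + b = a' + b'" using assms[of 1] by simp
  have "a * \<zeta> + b * inverse \<zeta> = a' * \<zeta> + b' * inverse \<zeta>" using assms[of \<zeta>] by (simp add: frob_mu)
  moreover have "a = a' + b' - b" using 1 by (simp add: algebra_simps)
  ultimately have "(b - b') * (inverse \<zeta> - \<zeta>) = 0" by (simp add: algebra_simps)
  then show "b = b'" using zeta_ne_inverse by simp
  with 1 show "a = a'" by simp
qed

end

section \<open>Skew braces and their isomorphisms\<close>

sublocale skew_brace \<subseteq> add: group "add_monoid B"
  rewrites "carrier (add_monoid B) = carrier B"
    and "Group.monoid.mult (add_monoid B) = add B"
    and "one (add_monoid B) = zero B"
    and "m_inv (add_monoid B) = a_inv B"
  using add_group by (simp_all add: a_inv_def)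

sublocale skew_brace \<subseteq> circ: group B
  by (rule circ_group)

context skew_brace
begin

lemma one_eq_zero: "\<one> = \<zero>"
proof -
  have "\<one> \<otimes> (\<zero> \<oplus> \<zero>) = ((\<one> \<otimes> \<zero>) \<ominus> \<one>) \<oplus> (\<one> \<otimes> \<zero>)"
    by (rule brace_law) auto
  then have "\<zero> = \<ominus> \<one>" by (simp add: a_minus_def)
  then show ?thesis by (metis add.inv_inv add.inv_one circ.one_closed)
qed

text \<open>The same map as \<open>brace_lambda\<close> but without the restriction to the carrier,
  so that equations can be used for rewriting.\<close>

definition lam :: "'a \<Rightarrow> 'a \<Rightarrow> 'a" where "lam a b = \<ominus> a \<oplus> (a \<otimes> b)"

lemma lam_closed [simp]: "a \<in> carrier B \<Longrightarrow> b \<in> carrier B \<Longrightarrow> lam a b \<in> carrier B"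
  by (simp add: lam_def)

lemma circ_eq_add_lam: "a \<in> carrier B \<Longrightarrow> b \<in> carrier B \<Longrightarrow> a \<otimes> b = a \<oplus> lam a b"
  by (simp add: lam_def flip: add.m_assoc)

lemma lam_add:
  "a \<in> carrier B \<Longrightarrow> b \<in> carrier B \<Longrightarrow> c \<in> carrier B \<Longrightarrow> lam a (b \<oplus> c) = lam a b \<oplus> lam a c"
  by (simp add: lam_def brace_law a_minus_def add.m_assoc)

lemma lam_circ:
  assumes "a \<in> carrier B" "b \<in> carrier B" "c \<in> carrier B"
  shows "lam (a \<otimes> b) c = lam a (lam b c)"
proof -
  have "(a \<otimes> b) \<oplus> lam (a \<otimes> b) c = a \<otimes> (b \<otimes> c)"
    using assms by (simp add: circ.m_assoc flip: circ_eq_add_lam)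
  also have "\<dots> = (a \<otimes> b) \<oplus> lam a (lam b c)"
    using assms by (simp add: circ_eq_add_lam[of b c] circ_eq_add_lam[of a b] circ_eq_add_lam[of a "b \<oplus> lam b c"]
        lam_add add.m_assoc)
  finally show ?thesis using assms by simp
qed

lemma lam_inj: "a \<in> carrier B \<Longrightarrow> inj_on (lam a) (carrier B)"
  by (rule inj_onI) (simp add: lam_def)

lemma ker_lambda_eq: "ker_lambda B = {a \<in> carrier B. \<forall>b \<in> carrier B. a \<otimes> b = a \<oplus> b}"
proof -
  have "brace_lambda B a = (\<lambda>b\<in>carrier B. b) \<longleftrightarrow> (\<forall>b \<in> carrier B. a \<otimes> b = a \<oplus> b)"
    if a: "a \<in> carrier B" for a
  proof -
    have "brace_lambda B a = (\<lambda>b\<in>carrier B. b) \<longleftrightarrow> (\<forall>b \<in> carrier B. lam a b = b)"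
      by (auto simp: brace_lambda_def lam_def restrict_def fun_eq_iff)
    also have "\<dots> \<longleftrightarrow> (\<forall>b \<in> carrier B. a \<otimes> b = a \<oplus> b)"
      using a by (intro ball_cong refl iffI) (metis circ_eq_add_lam, simp add: lam_def flip: add.m_assoc)
    finally show ?thesis .
  qed
  then show ?thesis
    by (auto simp: ker_lambda_def kernel_def AutoGroup_def BijGroup_def)
qed

end

section \<open>Brace isomorphisms, transport of structure and counting of classes\<close>

lemma brace_isoI:
  assumes "bij_betw h (carrier A) (carrier B)"
    and "\<And>x y. x \<in> carrier A \<Longrightarrow> y \<in> carrier A \<Longrightarrow> h (x \<oplus>\<^bsub>A\<^esub> y) = h x \<oplus>\<^bsub>B\<^esub> h y"
    and "\<And>x y. x \<in> carrier A \<Longrightarrow> y \<in> carrier A \<Longrightarrow> h (x \<otimes>\<^bsub>A\<^esub> y) = h x \<otimes>\<^bsub>B\<^esub> h y"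
  shows "h \<in> brace_iso A B"
  using assms by (auto simp: brace_iso_def iso_def hom_def bij_betw_def)

lemma brace_isoD:
  assumes "h \<in> brace_iso A B"
  shows "bij_betw h (carrier A) (carrier B)"
    and "\<And>x y. x \<in> carrier A \<Longrightarrow> y \<in> carrier A \<Longrightarrow> h (x \<oplus>\<^bsub>A\<^esub> y) = h x \<oplus>\<^bsub>B\<^esub> h y"
    and "\<And>x y. x \<in> carrier A \<Longrightarrow> y \<in> carrier A \<Longrightarrow> h (x \<otimes>\<^bsub>A\<^esub> y) = h x \<otimes>\<^bsub>B\<^esub> h y"
    and "h \<in> iso (add_monoid A) (add_monoid B)" "h \<in> iso A B"
  using assms by (auto simp: brace_iso_def iso_def hom_def)

lemma brace_iso_refl: "brace_iso A A \<noteq> {}"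
  using brace_isoI[of id A A] by auto

lemma brace_iso_sym:
  assumes "skew_brace A" "brace_iso A B \<noteq> {}"
  shows "brace_iso B A \<noteq> {}"
proof -
  interpret A: skew_brace A by fact
  obtain h where h: "h \<in> brace_iso A B" using assms by auto
  have "inv_into (carrier (add_monoid A)) h \<in> iso (add_monoid B) (add_monoid A)"
    by (rule group.iso_set_sym[OF A.add_group]) (use h in \<open>simp add: brace_iso_def\<close>)
  moreover have "inv_into (carrier A) h \<in> iso B A"
    by (rule group.iso_set_sym[OF A.circ_group]) (use h in \<open>simp add: brace_iso_def\<close>)
  ultimately show ?thesis by (auto simp: brace_iso_def)
qed

lemma brace_iso_trans:
  assumes "brace_iso A B \<noteq> {}" "brace_iso B C \<noteq> {}"
  shows "brace_iso A C \<noteq> {}"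
proof -
  obtain h k where "h \<in> brace_iso A B" "k \<in> brace_iso B C" using assms by auto
  then have "k \<circ> h \<in> brace_iso A C"
    using iso_set_trans[of h "add_monoid A" "add_monoid B" k "add_monoid C"] iso_set_trans[of h A B k C]
    by (simp add: brace_iso_def)
  then show ?thesis by auto
qed

lemma group_hom_image:
  assumes "group G" and bij: "bij_betw h (carrier G) (carrier H)"
    and hom: "\<And>x y. x \<in> carrier G \<Longrightarrow> y \<in> carrier G \<Longrightarrow> h (x \<otimes>\<^bsub>G\<^esub> y) = h x \<otimes>\<^bsub>H\<^esub> h y"
    and one: "h \<one>\<^bsub>G\<^esub> = \<one>\<^bsub>H\<^esub>"
  shows "group H"
proof -
  interpret group G by fact
  have car: "carrier H = h ` carrier G" using bij by (simp add: bij_betw_def)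
  show ?thesis
  proof (rule groupI)
    fix x y z assume "x \<in> carrier H" "y \<in> carrier H" "z \<in> carrier H"
    then obtain a b c where abc: "x = h a" "y = h b" "z = h c" "a \<in> carrier G" "b \<in> carrier G" "c \<in> carrier G"
      unfolding car by blast
    show "x \<otimes>\<^bsub>H\<^esub> y \<in> carrier H" using abc unfolding car by (simp flip: hom)
    show "x \<otimes>\<^bsub>H\<^esub> y \<otimes>\<^bsub>H\<^esub> z = x \<otimes>\<^bsub>H\<^esub> (y \<otimes>\<^bsub>H\<^esub> z)"
      using abc by (simp add: m_assoc flip: hom)
  next
    show "\<one>\<^bsub>H\<^esub> \<in> carrier H" unfolding car by (simp flip: one)
  next
    fix x assume "x \<in> carrier H"
    then obtain a where a: "x = h a" "a \<in> carrier G" unfolding car by blast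
    then show "\<one>\<^bsub>H\<^esub> \<otimes>\<^bsub>H\<^esub> x = x" by (simp flip: hom one)
    have "h (inv\<^bsub>G\<^esub> a) \<otimes>\<^bsub>H\<^esub> x = \<one>\<^bsub>H\<^esub>" using a by (simp flip: hom one)
    then show "\<exists>y\<in>carrier H. y \<otimes>\<^bsub>H\<^esub> x = \<one>\<^bsub>H\<^esub>" using a car by blast
  qed
qed

text \<open>Used in both directions: to place copies of the models inside the type
  \<open>'a\<close>, and to move an arbitrary brace onto K x \<mu>, where its addition is given by a
  formula.\<close>

definition transport :: "('a \<Rightarrow> 'b) \<Rightarrow> ('a, 'm) ring_scheme \<Rightarrow> 'b ring" where
  "transport h B = \<lparr>carrier = h ` carrier B,
     Group.monoid.mult = \<lambda>x y. h (inv_into (carrier B) h x \<otimes>\<^bsub>B\<^esub> inv_into (carrier B) h y),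
     one = h \<one>\<^bsub>B\<^esub>, zero = h \<zero>\<^bsub>B\<^esub>,
     add = \<lambda>x y. h (inv_into (carrier B) h x \<oplus>\<^bsub>B\<^esub> inv_into (carrier B) h y)\<rparr>"

lemma transport:
  assumes "skew_brace B" "inj_on h (carrier B)"
  shows "skew_brace (transport h B)" "h \<in> brace_iso B (transport h B)"
proof -
  let ?T = "transport h B"
  interpret skew_brace B by fact
  have bij: "bij_betw h (carrier B) (carrier ?T)" using assms(2) by (simp add: bij_betw_def transport_def)
  have car: "carrier ?T = h ` carrier B" by (simp add: transport_def)
  have m: "h (x \<otimes>\<^bsub>B\<^esub> y) = h x \<otimes>\<^bsub>?T\<^esub> h y" "h (x \<oplus>\<^bsub>B\<^esub> y) = h x \<oplus>\<^bsub>?T\<^esub> h y"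
    if "x \<in> carrier B" "y \<in> carrier B" for x y
    using that assms(2) by (simp_all add: transport_def)
  have gT: "group (add_monoid ?T)"
    by (rule group_hom_image[OF add_group, of h])
      (use bij m in \<open>simp_all add: transport_def\<close>)
  have cT: "group ?T"
    by (rule group_hom_image[OF circ_group, of h]) (use bij m in \<open>simp_all add: transport_def\<close>)
  have minus: "h (x \<ominus>\<^bsub>B\<^esub> y) = h x \<ominus>\<^bsub>?T\<^esub> h y" if "x \<in> carrier B" "y \<in> carrier B" for x y
  proof -
    interpret T: group "add_monoid ?T" by (rule gT)
    have "h (x \<ominus>\<^bsub>B\<^esub> y) \<otimes>\<^bsub>add_monoid ?T\<^esub> h y = h x"
      using that by (simp add: a_minus_def add.m_assoc flip: m)
    then have "h (x \<ominus>\<^bsub>B\<^esub> y) = h x \<otimes>\<^bsub>add_monoid ?T\<^esub> inv\<^bsub>add_monoid ?T\<^esub> h y"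
      using that T.inv_solve_right'[of "h (x \<ominus>\<^bsub>B\<^esub> y)" "h x" "h y"] car by (auto simp: a_minus_def)
    then show ?thesis by (simp add: a_minus_def a_inv_def)
  qed
  have closed: "x \<ominus>\<^bsub>B\<^esub> y \<in> carrier B" if "x \<in> carrier B" "y \<in> carrier B" for x y
    using that by (simp add: a_minus_def)
  show "skew_brace ?T"
  proof (intro skew_brace.intro gT cT)
    fix x y z assume "x \<in> carrier ?T" "y \<in> carrier ?T" "z \<in> carrier ?T"
    then obtain a b c where abc: "x = h a" "y = h b" "z = h c" "a \<in> carrier B" "b \<in> carrier B" "c \<in> carrier B"
      unfolding car by blast
    have "h (a \<otimes>\<^bsub>B\<^esub> (b \<oplus>\<^bsub>B\<^esub> c)) = h (((a \<otimes>\<^bsub>B\<^esub> b) \<ominus>\<^bsub>B\<^esub> a) \<oplus>\<^bsub>B\<^esub> (a \<otimes>\<^bsub>B\<^esub> c))" using abc by (simp add: brace_law)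
    then show "x \<otimes>\<^bsub>?T\<^esub> (y \<oplus>\<^bsub>?T\<^esub> z) = ((x \<otimes>\<^bsub>?T\<^esub> y) \<ominus>\<^bsub>?T\<^esub> x) \<oplus>\<^bsub>?T\<^esub> (x \<otimes>\<^bsub>?T\<^esub> z)"
      using abc by (simp add: m minus closed)
  qed
  show "h \<in> brace_iso B ?T" by (rule brace_isoI[OF bij]) (simp_all add: m)
qed

lemma card_ker_lambda_iso:
  assumes "skew_brace A" "skew_brace B" "brace_iso A B \<noteq> {}"
  shows "card (ker_lambda A) = card (ker_lambda B)"
proof -
  interpret A: skew_brace A by fact
  interpret B: skew_brace B by fact
  obtain h where h: "h \<in> brace_iso A B" using assms by auto
  note hD = brace_isoD[OF h]
  have car: "carrier B = h ` carrier A" and inj: "inj_on h (carrier A)" using hD(1) by (auto simp: bij_betw_def)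
  have iff: "h a \<otimes>\<^bsub>B\<^esub> h b = h a \<oplus>\<^bsub>B\<^esub> h b \<longleftrightarrow> a \<otimes>\<^bsub>A\<^esub> b = a \<oplus>\<^bsub>A\<^esub> b"
    if "a \<in> carrier A" "b \<in> carrier A" for a b
    using that inj by (simp add: inj_on_eq_iff flip: hD(2,3))
  have "ker_lambda B = h ` ker_lambda A"
    unfolding A.ker_lambda_eq B.ker_lambda_eq car using iff by auto
  moreover have "inj_on h (ker_lambda A)" using inj by (rule inj_on_subset) (auto simp: A.ker_lambda_eq)
  ultimately show ?thesis by (simp add: card_image)
qed

lemma equiv_brace_iso_rel: "equiv {B. skew_brace B} brace_iso_rel"
proof (rule equivI)
  show "trans brace_iso_rel"
    unfolding trans_def brace_iso_rel_def using brace_iso_trans by blast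
  show "sym brace_iso_rel"
    unfolding sym_def brace_iso_rel_def using brace_iso_sym by blast
qed (auto simp: brace_iso_rel_def refl_on_def brace_iso_refl)

text \<open>An infinite \<open>'a\<close> has room for a copy \<open>C t\<close> of each finite
  model. The classes met by \<open>S\<close> are then exactly the classes of these copies, and
  pairwise non-isomorphic models keep them distinct.\<close>

lemma num_iso_classes_models:
  fixes model :: "'i \<Rightarrow> 'b ring" and S :: "'a ring set"
  assumes "finite J" "infinite (UNIV :: 'a set)"
    and model: "\<And>t. t \<in> J \<Longrightarrow> skew_brace (model t)" "\<And>t. t \<in> J \<Longrightarrow> finite (carrier (model t))"
    and inj: "\<And>t t'. t \<in> J \<Longrightarrow> t' \<in> J \<Longrightarrow> brace_iso (model t) (model t') \<noteq> {} \<Longrightarrow> t = t'"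
    and S: "\<And>B. B \<in> S \<longleftrightarrow> skew_brace B \<and> (\<exists>t \<in> J. brace_iso B (model t) \<noteq> {})"
  shows "num_iso_classes S (card J)"
proof -
  have "\<exists>C :: 'a ring. skew_brace C \<and> brace_iso (model t) C \<noteq> {}" if t: "t \<in> J" for t
  proof -
    obtain X :: "'a set" where X: "finite X" "card X = card (carrier (model t))"
      using infinite_arbitrarily_large[OF assms(2)] by blast
    then obtain h where "bij_betw h (carrier (model t)) X"
      using model(2)[OF t] finite_same_card_bij by metis
    then have "inj_on h (carrier (model t))" by (simp add: bij_betw_def)
    from transport[OF model(1)[OF t] this] show ?thesis by blast
  qed
  then obtain C :: "'i \<Rightarrow> 'a ring"
    where C: "\<And>t. t \<in> J \<Longrightarrow> skew_brace (C t)" "\<And>t. t \<in> J \<Longrightarrow> brace_iso (model t) (C t) \<noteq> {}"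
    by metis
  have C': "brace_iso (C t) (model t) \<noteq> {}" if "t \<in> J" for t
    using brace_iso_sym[OF model(1) C(2)] that by blast
  have "S // brace_iso_rel = (\<lambda>t. brace_iso_rel `` {C t}) ` J"
  proof (intro equalityI subsetI)
    fix X assume "X \<in> S // brace_iso_rel"
    then obtain B where B: "B \<in> S" "X = brace_iso_rel `` {B}" by (auto simp: quotient_def)
    then obtain t where t: "t \<in> J" "brace_iso B (model t) \<noteq> {}" "skew_brace B" using S by blast
    then have "(B, C t) \<in> brace_iso_rel"
      using C brace_iso_trans[OF t(2) C(2)] by (simp add: brace_iso_rel_def)
    then show "X \<in> (\<lambda>t. brace_iso_rel `` {C t}) ` J"
      using B t(1) equiv_class_eq[OF equiv_brace_iso_rel] by blast
  next
    fix X assume "X \<in> (\<lambda>t. brace_iso_rel `` {C t}) ` J"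
    then obtain t where "t \<in> J" "X = brace_iso_rel `` {C t}" by auto
    moreover from this have "C t \<in> S" using S C(1) C' by blast
    ultimately show "X \<in> S // brace_iso_rel" by (auto simp: quotient_def)
  qed
  moreover have "inj_on (\<lambda>t. brace_iso_rel `` {C t}) J"
  proof (rule inj_onI)
    fix t t' assume t: "t \<in> J" "t' \<in> J" and "brace_iso_rel `` {C t} = brace_iso_rel `` {C t'}"
    then have "(C t, C t') \<in> brace_iso_rel"
      using eq_equiv_class[OF _ equiv_brace_iso_rel] C(1) by blast
    then have "brace_iso (C t) (C t') \<noteq> {}" by (simp add: brace_iso_rel_def)
    then have "brace_iso (model t) (model t') \<noteq> {}"
      using C(2)[OF t(1)] C'[OF t(2)] brace_iso_trans by metis
    with t inj show "t = t'" by blast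
  qed
  ultimately show ?thesis using assms(1) by (simp add: num_iso_classes_def card_image)
qed

section \<open>The model braces\<close>

context quadratic_field
begin

text \<open>The norm of K over the prime field, written as a product with the conjugate so that the
  Frobenius rules apply directly.\<close>

definition nrm :: "'k \<Rightarrow> 'k" where "nrm x = x * x ^ p"

lemma zero_frob [simp]: "(0 :: 'k) ^ p = 0" using p_ge_3 by simp

lemma nrm_mult: "nrm (x * y) = nrm x * nrm y" by (simp add: nrm_def power_mult_distrib)
lemma nrm_frob: "nrm (x ^ p) = nrm x" by (simp add: nrm_def frob_frob)
lemma frob_nrm: "nrm x ^ p = nrm x" by (simp add: nrm_def frob_simps)
lemma nrm_0 [simp]: "nrm 0 = 0" by (simp add: nrm_def)
lemma nrm_eq_0 [simp]: "nrm x = 0 \<longleftrightarrow> x = 0" by (auto simp: nrm_def)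
lemma nrm_surj_fixed: "n ^ p = n \<Longrightarrow> \<exists>b. nrm b = n" using norm_surj[of n] by (auto simp: nrm_def)

text \<open>Hilbert 90 in the form in which it is needed: b' a^p = a b is the condition for x |-> a
  x to carry \<open>cM b\<close> to \<open>cM b'\<close>.\<close>

lemma nrm_eqD:
  assumes "nrm b = nrm b'"
  obtains a where "a \<noteq> 0" "b' * a ^ p = a * b"
proof (cases "b = 0")
  case True
  then have "b' = 0" using assms by (metis nrm_0 nrm_eq_0)
  with True that[of 1] show ?thesis by simp
next
  case False
  then have b': "b' \<noteq> 0" using assms by (metis nrm_0 nrm_eq_0)
  have "(b / b') ^ (p + 1) = nrm b / nrm b'" by (simp add: nrm_def power_divide)
  also have "\<dots> = 1" using assms False b' by simp
  finally obtain u where u: "u \<noteq> 0" "u ^ (p - 1) = b / b'" using hilbert90 by blast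
  have "u ^ p = u * (b / b')" using u(2) p_ge_3 by (cases p) auto
  then show ?thesis using that[of u] u(1) b' by (simp add: field_simps)
qed

text \<open>The semidirect product of K by \<mu> in which z acts as multiplication by z^s. Exponent
  1 gives the additive group, exponent 0 the direct product.\<close>

definition semi :: "nat \<Rightarrow> ('k \<times> 'k) monoid" where
  "semi s = \<lparr>carrier = UNIV \<times> \<mu>, Group.monoid.mult = \<lambda>(x, z) (y, w). (x + z ^ s * y, z * w), one = (0, 1)\<rparr>"

lemma semi_simps [simp]:
  "carrier (semi s) = UNIV \<times> \<mu>" "one (semi s) = (0, 1)"
  "Group.monoid.mult (semi s) (x, z) (y, w) = (x + z ^ s * y, z * w)"
  by (simp_all add: semi_def)

lemma group_semi: "group (semi s)"
proof (rule groupI)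
  fix a assume "a \<in> carrier (semi s)"
  then obtain x z where a: "a = (x, z)" "z \<in> \<mu>" by auto
  then have "z \<noteq> 0" by (simp add: mu_nonzero)
  then have "(- (inverse z ^ s * x), inverse z) \<otimes>\<^bsub>semi s\<^esub> a = \<one>\<^bsub>semi s\<^esub>" by (simp add: a)
  moreover have "(- (inverse z ^ s * x), inverse z) \<in> carrier (semi s)" using a by simp
  ultimately show "\<exists>y\<in>carrier (semi s). y \<otimes>\<^bsub>semi s\<^esub> a = \<one>\<^bsub>semi s\<^esub>" by blast
qed (auto simp: algebra_simps power_mult_distrib)

lemma card_semi: "card (carrier (semi s)) = p\<^sup>2 * q"
  by (simp add: card_cartesian_product card_mu card_K)

text \<open>
  The brace with \<open>\<lambda>\<^bsub>(x, z)\<^esub> (y, w) = (z\<^sup>s y + (1 - w) c (x, z), w)\<close>: multiplication by \<open>z\<^sup>s\<close> followed by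
  conjugation with \<open>(c (x, z), 1)\<close>. The additive group is \<open>semi 1\<close>.
\<close>

definition Br :: "nat \<Rightarrow> ('k \<times> 'k \<Rightarrow> 'k) \<Rightarrow> ('k \<times> 'k) ring" where
  "Br s c = \<lparr>carrier = UNIV \<times> \<mu>,
     Group.monoid.mult = \<lambda>(x, z) (y, w). (x + z * (z ^ s * y + (1 - w) * c (x, z)), z * w),
     one = (0, 1), zero = (0, 1), add = \<lambda>(x, z) (y, w). (x + z * y, z * w)\<rparr>"

lemma Br_simps [simp]:
  "carrier (Br s c) = UNIV \<times> \<mu>" "one (Br s c) = (0, 1)" "zero (Br s c) = (0, 1)"
  "Group.monoid.mult (Br s c) (x, z) (y, w) = (x + z * (z ^ s * y + (1 - w) * c (x, z)), z * w)"
  "add (Br s c) (x, z) (y, w) = (x + z * y, z * w)"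
  by (simp_all add: Br_def)

lemma add_monoid_Br: "add_monoid (Br s c) = semi 1"
  by (simp add: Br_def semi_def fun_eq_iff)

text \<open>(y, w) |-> (z^s y + (1 - w) c, w) is an endomorphism of \<open>semi 1\<close> whatever
  the value of c, so the brace law is automatic. The real condition on c is that the circle
  operation be a group, which is the hypothesis.\<close>

lemma skew_brace_Br:
  assumes "group (Br s c)"
  shows "skew_brace (Br s c)"
proof (intro skew_brace.intro assms)
  show "group (add_monoid (Br s c))" unfolding add_monoid_Br by (rule group_semi)
  have minus: "\<ominus>\<^bsub>Br s c\<^esub> (x, z) = (- (inverse z * x), inverse z)" if "z \<in> \<mu>" for x z
    unfolding a_inv_def add_monoid_Br
    by (rule group.inv_equality[OF group_semi]) (use that mu_nonzero[OF that] in auto)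
  fix a b d assume "a \<in> carrier (Br s c)" "b \<in> carrier (Br s c)" "d \<in> carrier (Br s c)"
  then obtain x z y w y' w' where abd: "a = (x, z)" "b = (y, w)" "d = (y', w')" "z \<in> \<mu>" "w \<in> \<mu>" "w' \<in> \<mu>"
    by auto
  then show "a \<otimes>\<^bsub>Br s c\<^esub> (b \<oplus>\<^bsub>Br s c\<^esub> d) =
      a \<otimes>\<^bsub>Br s c\<^esub> b \<ominus>\<^bsub>Br s c\<^esub> a \<oplus>\<^bsub>Br s c\<^esub> a \<otimes>\<^bsub>Br s c\<^esub> d"
    using mu_nonzero[of z] by (simp add: a_minus_def minus algebra_simps)
qed

definition cT :: "'k \<times> 'k \<Rightarrow> 'k" where "cT = (\<lambda>_. 0)"

text \<open>\<open>cM b (x, z)\<close> is the solution \<open>X\<close> of \<open>x = b X\<^sup>p - z X\<close>, which is unique when \<open>b\<close> does not have norm \<open>1\<close>.\<close>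

definition cM :: "'k \<Rightarrow> 'k \<times> 'k \<Rightarrow> 'k" where
  "cM b = (\<lambda>(x, z). (inverse z * x + b * x ^ p) / (nrm b - 1))"

text \<open>With x = b X^p - z X, Frobenius gives x^p = b^p X - z^(-1) X^p. Eliminating X^p leaves
  z^(-1) x + b x^p = (N(b) - 1) X.\<close>

lemma cM_solution:
  assumes "nrm b \<noteq> 1" "z \<in> \<mu>"
  shows "cM b (b * X ^ p - z * X, z) = X"
proof -
  have "inverse z * (b * X ^ p - z * X) + b * (b * X ^ p - z * X) ^ p = (nrm b - 1) * X"
    using mu_nonzero[OF assms(2)] by (simp add: nrm_def frob_simps frob_mu[OF assms(2)] algebra_simps)
  then show ?thesis using assms(1) by (simp add: cM_def)
qed

lemma cM_eq:
  assumes "nrm b \<noteq> 1" "z \<in> \<mu>"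
  shows "b * cM b (x, z) ^ p - z * cM b (x, z) = x"
proof -
  have "(nrm b - 1) ^ p = nrm b - 1" by (simp add: frob_diff frob_nrm)
  then have "b * cM b (x, z) ^ p - z * cM b (x, z) =
    (b * (inverse z * x + b * x ^ p) ^ p - z * (inverse z * x + b * x ^ p)) / (nrm b - 1)"
    by (simp add: cM_def power_divide diff_divide_distrib)
  also have "b * (inverse z * x + b * x ^ p) ^ p - z * (inverse z * x + b * x ^ p) = (nrm b - 1) * x"
    using mu_nonzero[OF assms(2)]
    by (simp add: nrm_def frob_simps power_inverse frob_mu[OF assms(2)] algebra_simps)
  finally show ?thesis using assms(1) by simp
qed

lemma cM_unique:
  assumes "nrm b \<noteq> 1" "z \<in> \<mu>" "b * X ^ p - z * X = x"
  shows "cM b (x, z) = X"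
  using cM_solution[OF assms(1,2)] assms(3) by blast

text \<open>Here z^(2s+1) = 1, so z^s is the square root of z^(-1) in \<mu>.\<close>

lemma half_pow:
  assumes "2 * s + 1 = q" "z \<in> \<mu>"
  shows "z ^ s = inverse z ^ s * inverse z" "inverse z ^ s = z ^ s * z"
proof -
  have "z ^ s * z ^ s * z = 1" using assms by (simp add: \<mu>_def mult_2 power_add[symmetric] flip: power_Suc2)
  with mu_nonzero[OF assms(2)] show "z ^ s = inverse z ^ s * inverse z" "inverse z ^ s = z ^ s * z"
    by (simp_all add: field_simps)
qed

definition admissible :: "nat \<Rightarrow> 'k \<Rightarrow> bool" where
  "admissible s b \<longleftrightarrow> nrm b \<noteq> 1 \<and> (b = 0 \<or> 2 * s + 1 = q)"

text \<open>The inverse of (x, z) |-> (c(x, z), z), which the cocycle identity makes a homomorphism.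
  In the coordinate X = c(x, z) the circle operation becomes that of \<open>semi s\<close>.\<close>

lemma semi_iso_BrM:
  assumes "admissible s b"
  shows "(\<lambda>(X, z). (b * X ^ p - z * X, z)) \<in> iso (semi s) (Br s (cM b))"
proof -
  let ?h = "\<lambda>(X, z). (b * X ^ p - z * X, z)"
  have b: "nrm b \<noteq> 1" using assms by (simp add: admissible_def)
  have "bij_betw ?h (UNIV \<times> \<mu>) (UNIV \<times> \<mu>)"
    by (rule bij_betw_byWitness[where f' = "\<lambda>(x, z). (cM b (x, z), z)"])
      (auto simp: cM_solution[OF b] cM_eq[OF b])
  moreover have "?h (a \<otimes>\<^bsub>semi s\<^esub> a') = ?h a \<otimes>\<^bsub>Br s (cM b)\<^esub> ?h a'"
    if car: "a \<in> UNIV \<times> \<mu>" "a' \<in> UNIV \<times> \<mu>" for a a'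
  proof -
    from car obtain X z Y w where a: "a = (X, z)" "a' = (Y, w)" "z \<in> \<mu>" "w \<in> \<mu>" by auto
    \<comment> \<open>Frobenius turns z^s into z^(-s), so compatibility needs b z^(-s) = b z^(s+1).
      This is the point where \<open>admissible\<close> enters.\<close>
    have "b = 0 \<or> inverse z ^ s = z ^ s * z" using assms half_pow(2) a(3) by (auto simp: admissible_def)
    moreover have "(z ^ s) ^ p = inverse z ^ s" by (metis frob_mu[OF a(3)] power_commutes power_mult mult.commute)
    ultimately have "b * (z ^ s) ^ p = b * z * z ^ s" by auto
    then have "b * (X + z ^ s * Y) ^ p = b * X ^ p + b * z * z ^ s * Y ^ p"
      by (simp add: frob_add power_mult_distrib distrib_left flip: mult.assoc)
    then have "b * (X + z ^ s * Y) ^ p - z * w * (X + z ^ s * Y) =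
        b * X ^ p - z * X + z * (z ^ s * (b * Y ^ p - w * Y) + (1 - w) * X)"
      by (simp add: algebra_simps)
    then show ?thesis using a(3,4) by (simp add: a(1,2) cM_solution[OF b])
  qed
  ultimately show ?thesis by (auto simp: iso_def hom_def bij_betw_def)
qed

lemma semi_eq_BrT: "Group.monoid.mult (Br s cT) = Group.monoid.mult (semi (Suc s))"
  by (simp add: Br_def semi_def cT_def fun_eq_iff mult.assoc)

lemma semi_iso_BrT: "id \<in> iso (semi (Suc s)) (Br s cT)"
  by (simp add: iso_def hom_def semi_eq_BrT)

lemma group_Br: "group (Br s cT)" "admissible s b \<Longrightarrow> group (Br s (cM b))"
proof -
  show "group (Br s cT)"
    by (rule group_hom_image[OF group_semi, of id "Suc s"]) (simp_all add: semi_eq_BrT)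
  assume ad: "admissible s b"
  let ?h = "\<lambda>(X, z). (b * X ^ p - z * X, z)"
  show "group (Br s (cM b))"
  proof (rule group_hom_image[OF group_semi, of ?h s])
    show "bij_betw ?h (carrier (semi s)) (carrier (Br s (cM b)))"
      using semi_iso_BrM[OF ad] by (simp only: iso_def mem_Collect_eq)
    show "?h (x \<otimes>\<^bsub>semi s\<^esub> y) = ?h x \<otimes>\<^bsub>Br s (cM b)\<^esub> ?h y"
      if "x \<in> carrier (semi s)" "y \<in> carrier (semi s)" for x y
      using semi_iso_BrM[OF ad] that by (simp only: iso_def hom_def mem_Collect_eq)
    show "?h \<one>\<^bsub>semi s\<^esub> = \<one>\<^bsub>Br s (cM b)\<^esub>" using p_ge_3 by (simp add: power_0_left)
  qed
qed

lemma skew_brace_models: "skew_brace (Br s cT)" "admissible s b \<Longrightarrow> skew_brace (Br s (cM b))"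
  using group_Br skew_brace_Br by blast+

section \<open>The kernel of \<lambda> in the models\<close>

lemma ker_Br:
  assumes "skew_brace (Br s c)"
  shows "ker_lambda (Br s c) = {(x, z). z \<in> \<mu> \<and> z ^ s = 1 \<and> c (x, z) = 0}"
proof -
  interpret skew_brace "Br s c" by fact
  have "(\<forall>b \<in> UNIV \<times> \<mu>. (x, z) \<otimes>\<^bsub>Br s c\<^esub> b = (x, z) \<oplus>\<^bsub>Br s c\<^esub> b) \<longleftrightarrow> z ^ s = 1 \<and> c (x, z) = 0" (is "?L = ?R")
    if z: "z \<in> \<mu>" for x z
  proof
    assume L: ?L
    \<comment> \<open>At (1, 1) the factor 1 - w vanishes and z^s is isolated; afterwards (0,
      \<zeta>) isolates the value of c.\<close>
    have "z ^ s = 1" using bspec[OF L, of "(1, 1)"] mu_nonzero[OF z] by simp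
    moreover have "c (x, z) = 0"
      using bspec[OF L, of "(0, \<zeta>)"] mu_nonzero[OF z] zeta_ne_1 by simp
    ultimately show ?R by simp
  qed auto
  then show ?thesis by (auto simp: ker_lambda_eq)
qed

lemma mu_pow_1_iff:
  assumes "z \<in> \<mu>" "0 < s" "s < q"
  shows "z ^ s = 1 \<longleftrightarrow> z = 1"
  using mu_pow_eq_1[of z s] assms nat_dvd_not_less by auto

lemma card_ker_T:
  assumes "s < q"
  shows "card (ker_lambda (Br s cT)) = (if s = 0 then p\<^sup>2 * q else p\<^sup>2)"
proof (cases "s = 0")
  case True
  then have "ker_lambda (Br s cT) = UNIV \<times> \<mu>"
    unfolding ker_Br[OF skew_brace_models(1)] by (auto simp: cT_def)
  then show ?thesis using True by (simp add: card_cartesian_product card_mu card_K)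
next
  case False
  then have "ker_lambda (Br s cT) = UNIV \<times> {1}"
    unfolding ker_Br[OF skew_brace_models(1)] using mu_pow_1_iff assms by (auto simp: cT_def)
  then show ?thesis using False by (simp add: card_cartesian_product card_K)
qed

lemma card_ker_M:
  assumes "admissible s b" "s < q"
  shows "card (ker_lambda (Br s (cM b))) = (if s = 0 then q else 1)"
proof -
  have b: "nrm b \<noteq> 1" using assms by (simp add: admissible_def)
  have c0: "cM b (x, z) = 0 \<longleftrightarrow> x = 0" if "z \<in> \<mu>" for x z
    using cM_eq[OF b that, of x] p_ge_3 by (auto simp: power_0_left cM_def)
  have ker: "ker_lambda (Br s (cM b)) = {0} \<times> {z \<in> \<mu>. z ^ s = 1}"
    unfolding ker_Br[OF skew_brace_models(2)[OF assms(1)]] using c0 by auto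
  show ?thesis
  proof (cases "s = 0")
    case True
    then show ?thesis unfolding ker by (simp add: card_cartesian_product card_mu)
  next
    case False
    then have "{z \<in> \<mu>. z ^ s = 1} = {1}" using mu_pow_1_iff assms(2) by auto
    then show ?thesis using False by (simp add: ker card_cartesian_product)
  qed
qed

section \<open>Automorphisms of the additive group\<close>

text \<open>The subgroup K x {1} is preserved, and f acts on it additively as x |-> a x + b x^p.
  Compatibility with the action of \<zeta> sends \<zeta> to \<zeta> if a \<noteq> 0 and to
  \<zeta>^(-1) if b \<noteq> 0, so exactly one of a, b survives. The images of (0, z) contribute
  only an inner part.\<close>

lemma semi_end_form:
  fixes f :: "'k \<times> 'k \<Rightarrow> 'k \<times> 'k"
  assumes closed: "\<And>x z. z \<in> \<mu> \<Longrightarrow> snd (f (x, z)) \<in> \<mu>"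
    and inj: "inj_on f (UNIV \<times> \<mu>)"
    and hom: "\<And>x z y w. z \<in> \<mu> \<Longrightarrow> w \<in> \<mu> \<Longrightarrow>
      f (x + z * y, z * w) = (fst (f (x, z)) + snd (f (x, z)) * fst (f (y, w)), snd (f (x, z)) * snd (f (y, w)))"
  obtains (linear) a d where "a \<noteq> 0" "\<And>x z. z \<in> \<mu> \<Longrightarrow> f (x, z) = (a * x + (1 - z) * d, z)"
  | (frobenius) a d where "a \<noteq> 0"
      "\<And>x z. z \<in> \<mu> \<Longrightarrow> f (x, z) = (a * x ^ p + (1 - inverse z) * d, inverse z)"
proof -
  define h where "h x = snd (f (x, 1))" for x
  have h_mu: "h x \<in> \<mu>" for x by (simp add: h_def closed)
  have h_add: "h (x + y) = h x * h y" for x y using hom[of 1 1 x y] by (simp add: h_def)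
  have h0: "h 0 = 1" using h_add[of 0 0] mu_nonzero[OF h_mu[of 0]] by simp
  have h_nat: "h (of_nat n * x) = h x ^ n" for n x
    by (induction n) (simp_all add: h0 h_add algebra_simps)
  have "(of_nat p :: 'k) = 0" using char_K of_nat_CHAR[where ?'a = 'k] by simp
  \<comment> \<open>h is a character of K, which has exponent p, with values in \<mu>. As Frobenius
    inverts \<mu>, h(x)^p = 1 already means h(x) = 1.\<close>
  then have "h x ^ p = 1" for x using h_nat[of p x] h0 by simp
  then have h1: "h x = 1" for x using frob_mu[OF h_mu] by simp
  define g where "g x = fst (f (x, 1))" for x
  have fg: "f (x, 1) = (g x, 1)" for x using h1[of x] by (simp add: g_def h_def prod_eq_iff)
  have g_add: "g (x + y) = g x + g y" for x y using hom[of 1 1 x y] by (simp add: fg)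
  define e where "e z = fst (f (0, z))" for z
  define w where "w z = snd (f (0, z))" for z
  have w_mu: "w z \<in> \<mu>" if "z \<in> \<mu>" for z using that by (simp add: w_def closed)
  have f: "f (x, z) = (g x + e z, w z)" if "z \<in> \<mu>" for x z
    using hom[of 1 z x 0] that by (simp add: fg e_def w_def)
  have gw: "g (z * x) = w z * g x" if "z \<in> \<mu>" for x z
    using hom[of z 1 0 x] that f[of z "z * x"] by (simp add: fg e_def w_def)
  obtain a b where g: "\<And>x. g x = a * x + b * x ^ p" using additive_form[of g] g_add by metis
  have coeff: "a * z = w z * a" "b * inverse z = w z * b" if z: "z \<in> \<mu>" for z
  proof -
    have "a * z * x + b * inverse z * x ^ p = w z * a * x + w z * b * x ^ p" for x
      using gw[OF z, of x] by (simp add: g power_mult_distrib frob_mu[OF z] algebra_simps)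
    from linear_frob_coeff_eq[OF this] show "a * z = w z * a" "b * inverse z = w z * b" by auto
  qed
  have e: "\<exists>d. \<forall>z \<in> \<mu>. e z = (1 - w z) * d" if "w \<zeta> \<noteq> 1"
  proof (intro exI ballI)
    fix z assume z: "z \<in> \<mu>"
    \<comment> \<open>(0, z) and (0, \<zeta>) commute; evaluating f on both orders of the product
      expresses e z through e \<zeta>.\<close>
    have "e z + w z * e \<zeta> = e \<zeta> + w \<zeta> * e z"
      using hom[of z \<zeta> 0 0] hom[of \<zeta> z 0 0] z by (simp add: e_def w_def mult.commute)
    then have "e z * (1 - w \<zeta>) = (1 - w z) * e \<zeta>" by (simp add: algebra_simps)
    then show "e z = (1 - w z) * (e \<zeta> / (1 - w \<zeta>))" using that by (simp add: field_simps)
  qed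
  have w: "\<And>z. z \<in> \<mu> \<Longrightarrow> w z = z" if "a \<noteq> 0" using coeff(1) that by auto
  have w': "\<And>z. z \<in> \<mu> \<Longrightarrow> w z = inverse z" if "b \<noteq> 0" using coeff(2) that by auto
  have "a \<noteq> 0 \<or> b \<noteq> 0"
  proof (rule ccontr)
    assume "\<not> ?thesis"
    then have "f (1, 1) = f (0, 1)" by (simp add: fg g)
    with inj show False by (simp add: inj_on_eq_iff)
  qed
  then consider "a \<noteq> 0" "b = 0" | "a = 0" "b \<noteq> 0" using w w' zeta_ne_inverse zeta_mu by metis
  then show thesis
  proof cases
    case 1
    with e w zeta_ne_1 obtain d where "\<forall>z \<in> \<mu>. e z = (1 - w z) * d" by auto
    then show thesis using linear[of a d] 1 f w by (simp add: g)
  next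
    case 2
    with e w' zeta_ne_1 obtain d where "\<forall>z \<in> \<mu>. e z = (1 - w z) * d" by auto
    then show thesis using frobenius[of b d] 2 f w' by (simp add: g)
  qed
qed

section \<open>Isomorphisms between models\<close>

lemma Br_iso_form:
  assumes "\<phi> \<in> brace_iso (Br s c) (Br s' c')"
  obtains (linear) a d where "a \<noteq> 0" "\<And>x z. z \<in> \<mu> \<Longrightarrow> \<phi> (x, z) = (a * x + (1 - z) * d, z)"
  | (frobenius) a d where "a \<noteq> 0"
      "\<And>x z. z \<in> \<mu> \<Longrightarrow> \<phi> (x, z) = (a * x ^ p + (1 - inverse z) * d, inverse z)"
proof (rule semi_end_form[of \<phi>])
  note D = brace_isoD[OF assms]
  have car: "\<phi> (x, z) \<in> UNIV \<times> \<mu>" if "z \<in> \<mu>" for x z using D(1) that by (auto simp: bij_betw_def)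
  then show "snd (\<phi> (x, z)) \<in> \<mu>" if "z \<in> \<mu>" for x z using that by (metis mem_Times_iff)
  show "inj_on \<phi> (UNIV \<times> \<mu>)" using D(1) by (simp add: bij_betw_def)
  show "\<phi> (x + z * y, z * w) = (fst (\<phi> (x, z)) + snd (\<phi> (x, z)) * fst (\<phi> (y, w)), snd (\<phi> (x, z)) * snd (\<phi> (y, w)))"
    if "z \<in> \<mu>" "w \<in> \<mu>" for x z y w
    using D(2)[of "(x, z)" "(y, w)"] that by (cases "\<phi> (x, z)"; cases "\<phi> (y, w)") simp
qed (use that in blast)+

text \<open>Right multiplication by (1, 1) suppresses the cocycle, since 1 - w = 0, so (0, \<zeta>)
  o (1, 1) exposes \<zeta>^s alone. A Frobenius-type isomorphism inverts both sides of the
  comparison.\<close>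

lemma Br_iso_exponent:
  assumes "brace_iso (Br s c) (Br s' c') \<noteq> {}" "s < q" "s' < q"
  shows "s = s'"
proof -
  obtain \<phi> where \<phi>: "\<phi> \<in> brace_iso (Br s c) (Br s' c')" using assms(1) by auto
  have m: "\<phi> (\<zeta> * \<zeta> ^ s, \<zeta>) = \<phi> (0, \<zeta>) \<otimes>\<^bsub>Br s' c'\<^esub> \<phi> (1, 1)"
    using brace_isoD(3)[OF \<phi>, of "(0, \<zeta>)" "(1, 1)"] by simp
  have z0: "\<zeta> \<noteq> 0" by (rule mu_nonzero) simp
  from \<phi> have "\<zeta> ^ s = \<zeta> ^ s'"
  proof (cases rule: Br_iso_form)
    case (linear a d)
    then show ?thesis using m z0 by simp
  next
    case (frobenius a d)
    have "(\<zeta> * \<zeta> ^ s) ^ p = inverse \<zeta> * inverse \<zeta> ^ s"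
      using frob_mu[of "\<zeta> * \<zeta> ^ s"] by (simp add: power_inverse)
    then have "inverse \<zeta> ^ s = inverse \<zeta> ^ s'" using frobenius m z0 by (simp add: mult.left_commute[of _ a] mult.commute[of _ a])
    then show ?thesis by (simp add: power_inverse)
  qed
  then show ?thesis using zeta_pow_inj assms(2,3) by (simp add: inj_on_eq_iff)
qed

text \<open>The image of (x, 1) o (0, \<zeta>) compares the values of \<open>cM b\<close> and
  \<open>cM b'\<close> over z = 1. The outcome is b' a^p = a b, or b' a^p = a b^p in the Frobenius
  case, and taking norms removes a.\<close>

lemma BrM_iso_nrm:
  assumes "brace_iso (Br s (cM b)) (Br s' (cM b')) \<noteq> {}" "nrm b \<noteq> 1" "nrm b' \<noteq> 1"
  shows "nrm b = nrm b'"
proof -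
  obtain \<phi> where \<phi>: "\<phi> \<in> brace_iso (Br s (cM b)) (Br s' (cM b'))" using assms(1) by auto
  \<comment> \<open>The argument at which \<open>cM b (x, 1)\<close> equals 1.\<close>
  define x where "x = b - 1"
  have c: "cM b (x, 1) = 1" by (rule cM_unique[OF assms(2)]) (simp_all add: x_def)
  have m: "\<phi> (x + (1 - \<zeta>), \<zeta>) = \<phi> (x, 1) \<otimes>\<^bsub>Br s' (cM b')\<^esub> \<phi> (0, \<zeta>)"
    using brace_isoD(3)[OF \<phi>, of "(x, 1)" "(0, \<zeta>)"] by (simp add: c)
  from \<phi> show ?thesis
  proof (cases rule: Br_iso_form)
    case (linear a d)
    then have "(1 - \<zeta>) * cM b' (a * x, 1) = (1 - \<zeta>) * a" using m by (simp add: algebra_simps)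
    then have "cM b' (a * x, 1) = a" using zeta_ne_1 by simp
    then have "b' * a ^ p = a * b" using cM_eq[OF assms(3), of 1 "a * x"] by (simp add: x_def algebra_simps)
    then have "nrm b' * nrm (a ^ p) = nrm a * nrm b" by (simp flip: nrm_mult)
    then show ?thesis using linear(1) by (simp add: nrm_frob)
  next
    case (frobenius a d)
    have i1: "inverse \<zeta> \<noteq> 1" using zeta_ne_1 by simp
    have "(1 - inverse \<zeta>) * cM b' (a * x ^ p, 1) = (1 - inverse \<zeta>) * a"
      using m frobenius by (simp add: frob_simps frob_mu algebra_simps)
    then have "cM b' (a * x ^ p, 1) = a" using i1 by simp
    then have "b' * a ^ p = a * b ^ p"
      using cM_eq[OF assms(3), of 1 "a * x ^ p"] by (simp add: x_def frob_simps algebra_simps)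
    then have "nrm b' * nrm (a ^ p) = nrm a * nrm (b ^ p)" by (simp flip: nrm_mult)
    then show ?thesis using frobenius(1) by (simp add: nrm_frob)
  qed
qed

lemma BrM_iso:
  assumes "nrm b = nrm b'" "nrm b \<noteq> 1"
  shows "brace_iso (Br s (cM b)) (Br s (cM b')) \<noteq> {}"
proof -
  obtain a where a: "a \<noteq> 0" "b' * a ^ p = a * b" using nrm_eqD[OF assms(1)] .
  have c: "cM b' (a * x, z) = a * cM b (x, z)" if "z \<in> \<mu>" for x z
  proof (rule cM_unique)
    have "b' * (a * cM b (x, z)) ^ p = b' * a ^ p * cM b (x, z) ^ p" by (simp add: power_mult_distrib)
    also have "\<dots> = a * (b * cM b (x, z) ^ p)" by (simp add: a mult_ac)
    finally have "b' * (a * cM b (x, z)) ^ p - z * (a * cM b (x, z)) = a * (b * cM b (x, z) ^ p - z * cM b (x, z))"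
      by (simp add: algebra_simps)
    then show "b' * (a * cM b (x, z)) ^ p - z * (a * cM b (x, z)) = a * x"
      by (simp add: cM_eq[OF assms(2) that])
  qed (use assms that in auto)
  let ?h = "\<lambda>(x, z :: 'k). (a * x, z)"
  have "?h \<in> brace_iso (Br s (cM b)) (Br s (cM b'))"
  proof (rule brace_isoI)
    show "bij_betw ?h (carrier (Br s (cM b))) (carrier (Br s (cM b')))"
      by (rule bij_betw_byWitness[where f' = "\<lambda>(x, z). (x / a, z)"]) (use a in auto)
  qed (auto simp: c, simp_all add: algebra_simps)
  then show ?thesis by blast
qed

end

section \<open>Normal forms of the cocycle\<close>

context quadratic_field
begin

lemma of_nat_q_nonzero: "(of_nat q :: 'k) \<noteq> 0"
proof
  assume "(of_nat q :: 'k) = 0"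
  then have "p dvd q" using of_nat_eq_0_iff_char_dvd[where ?'a = 'k] char_K by simp
  then have "p = q" using p(1) q(1) primes_dvd_imp_eq by blast
  then have "q dvd 1" using q_dvd by (metis dvd_add_right_iff dvd_refl)
  then show False using q_ge_3 by simp
qed

lemma mult_char_zeta_pow:
  fixes \<chi> :: "'k \<Rightarrow> 'k"
  assumes "\<And>z w. z \<in> \<mu> \<Longrightarrow> w \<in> \<mu> \<Longrightarrow> \<chi> (z * w) = \<chi> z * \<chi> w" "\<chi> \<zeta> \<noteq> 0"
  shows "\<chi> (\<zeta> ^ n) = \<chi> \<zeta> ^ n"
proof (induction n)
  case 0
  have "\<chi> \<zeta> = \<chi> \<zeta> * \<chi> 1" using assms(1)[of \<zeta> 1] by simp
  then show ?case using assms(2) by simp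
qed (simp add: assms)

text \<open>
  Commutativity of \<open>\<mu>\<close> does the work of the vanishing of the first cohomology group: exchanging \<open>z\<close> and
  \<open>w = \<zeta>\<close> in the cocycle identity determines \<open>k\<close> from \<open>k \<zeta>\<close>.
\<close>

lemma twisted_character:
  fixes \<chi> \<eta> k :: "'k \<Rightarrow> 'k"
  assumes \<chi>: "\<And>z w. z \<in> \<mu> \<Longrightarrow> w \<in> \<mu> \<Longrightarrow> \<chi> (z * w) = \<chi> z * \<chi> w" "\<And>z. z \<in> \<mu> \<Longrightarrow> \<chi> z \<noteq> 0"
    and \<eta>: "\<And>z w. z \<in> \<mu> \<Longrightarrow> w \<in> \<mu> \<Longrightarrow> \<eta> (z * w) = \<eta> z * \<eta> w" "\<And>z. z \<in> \<mu> \<Longrightarrow> \<eta> z \<noteq> 0"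
    and k: "\<And>z w. z \<in> \<mu> \<Longrightarrow> w \<in> \<mu> \<Longrightarrow> k (z * w) = \<chi> w * k z + \<eta> z * k w"
  shows "\<exists>d. \<forall>z \<in> \<mu>. k z = (\<chi> z - \<eta> z) * d"
proof (cases "\<chi> \<zeta> = \<eta> \<zeta>")
  case False
  have "k z = (\<chi> z - \<eta> z) * (k \<zeta> / (\<chi> \<zeta> - \<eta> \<zeta>))" if z: "z \<in> \<mu>" for z
  proof -
    have "\<chi> \<zeta> * k z + \<eta> z * k \<zeta> = \<chi> z * k \<zeta> + \<eta> \<zeta> * k z"
      using k[of z \<zeta>] k[of \<zeta> z] z by (simp add: mult.commute)
    then have "(\<chi> \<zeta> - \<eta> \<zeta>) * k z = (\<chi> z - \<eta> z) * k \<zeta>" by (simp add: algebra_simps)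
    with False show ?thesis by (simp add: field_simps)
  qed
  then show ?thesis by blast
next
  case True
  have eq: "\<chi> z = \<eta> z" if "z \<in> \<mu>" for z
    using that True mult_char_zeta_pow[of \<chi>] mult_char_zeta_pow[of \<eta>] \<chi> \<eta> by (metis mu_zeta_powE zeta_mu)
  have "k z = 0" if z: "z \<in> \<mu>" for z
  proof -
    \<comment> \<open>When the two characters coincide, k / \<chi> is a homomorphism from \<mu> to
      the additive group of K. It is killed by q, which is invertible in K.\<close>
    define e where "e w = k w / \<chi> w" for w
    have e: "e (w * v) = e w + e v" if "w \<in> \<mu>" "v \<in> \<mu>" for v w
      using that \<chi>(2)[of w] \<chi>(2)[of v] by (simp add: e_def k \<chi>(1) eq[symmetric] field_simps)
    have e1: "e 1 = 0" using e[of 1 1] by (metis mult_1_left add_0_right add_left_cancel one_mu)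
    have "e (z ^ n) = of_nat n * e z" for n
      by (induction n) (use z in \<open>simp_all add: e1 e algebra_simps\<close>)
    from this[of q] have "of_nat q * e z = 0" using z by (simp add: \<mu>_def e1)
    then show "k z = 0" using of_nat_q_nonzero \<chi>(2)[OF z] by (simp add: e_def)
  qed
  then show ?thesis by (intro exI[of _ 0]) simp
qed

text \<open>Cramer's rule for the equation and its Frobenius conjugate P^p d^p + Q^p d = r^p;
  \<open>D\<close> is the determinant.\<close>

lemma linear_frob_solve:
  assumes "nrm P \<noteq> nrm Q"
  obtains d where "P * d + Q * d ^ p = r"
proof -
  define D where "D = nrm P - nrm Q"
  have D: "D \<noteq> 0" "D ^ p = D" using assms by (simp_all add: D_def frob_diff frob_nrm)
  define d where "d = (P ^ p * r - Q * r ^ p) / D"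
  have "d ^ p = (P * r ^ p - Q ^ p * r) / D" by (simp add: d_def power_divide frob_simps D(2))
  then have "P * d + Q * d ^ p = (P * (P ^ p * r - Q * r ^ p) + Q * (P * r ^ p - Q ^ p * r)) / D"
    by (simp add: d_def add_divide_distrib)
  also have "P * (P ^ p * r - Q * r ^ p) + Q * (P * r ^ p - Q ^ p * r) = D * r"
    by (simp add: D_def nrm_def algebra_simps)
  finally show ?thesis using that D by simp
qed

lemma linear_frob_zero:
  assumes "nrm P \<noteq> nrm Q" "P * x = Q * x ^ p"
  shows "x = 0"
proof (rule ccontr)
  assume "x \<noteq> 0"
  have "nrm P * nrm x = nrm Q * nrm (x ^ p)" using assms(2) by (simp flip: nrm_mult)
  then show False using assms(1) \<open>x \<noteq> 0\<close> by (simp add: nrm_frob)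
qed

text \<open>The norm difference needed in the next lemma, with T for t^(-1) and \<alpha> +
  \<alpha>^2 for N(\<beta>). Keeping T and t independent makes it a polynomial identity with the
  extra factor \<open>1 + \<alpha> * (1 - T * t)\<close>, which becomes 1 once T t = 1.\<close>

lemma half_norm_identity:
  fixes T t \<alpha> :: "'r::comm_ring_1"
  assumes "T * t = 1"
  shows "(1 - T - \<alpha> * (T * T - 1)) * (1 - t - \<alpha> * (t * t - 1)) -
    (\<alpha> + \<alpha> * \<alpha>) * ((1 - T * T) * (1 - t * t)) = (1 - T) * (1 - t)"
proof -
  have "(1 - T - \<alpha> * (T * T - 1)) * (1 - t - \<alpha> * (t * t - 1)) -
    (\<alpha> + \<alpha> * \<alpha>) * ((1 - T * T) * (1 - t * t)) = (1 - T) * (1 - t) * (1 + \<alpha> * (1 - T * t))"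
    by (simp add: algebra_simps)
  then show ?thesis using assms by simp
qed

text \<open>
  The case \<open>c (x, 1) = \<alpha> x + \<beta> x\<^sup>p\<close> with \<open>\<beta> \<noteq> 0\<close>. Both the existence of \<open>d\<close> with the right value at \<open>\<zeta>\<close> and
  its validity on all of \<open>\<mu>\<close> come down to two norms being different; their difference is
  \<open>(1 - t\<^sup>-\<^sup>1) (1 - t)\<close> for \<open>t = \<zeta>\<^sup>s\<^sup>+\<^sup>1\<close>.
\<close>

lemma cocycle_normal_form_half:
  fixes k :: "'k \<Rightarrow> 'k"
  assumes s: "2 * s + 1 = q" and al: "\<alpha> ^ p = \<alpha>" "\<alpha> + \<alpha> * \<alpha> = nrm \<beta>"
    and k: "\<And>z w. z \<in> \<mu> \<Longrightarrow> w \<in> \<mu> \<Longrightarrow>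
      k (z * w) + \<alpha> * inverse w * (1 - w) * k z + \<beta> * (inverse z * (1 - inverse w) * k z ^ p) = k z + z ^ s * k w"
  shows "\<exists>d. \<forall>z \<in> \<mu>. k z = \<beta> * (1 - inverse z) * d ^ p - (1 - z ^ s - \<alpha> * (inverse z - 1)) * d"
proof -
  define A where "A z = 1 - z ^ s - \<alpha> * (inverse z - 1)" for z
  \<comment> \<open>Comparing the values of k (z w) and k (w z) eliminates the product and leaves a
    relation between k z and k w alone.\<close>
  have sym: "A w * k z - \<beta> * inverse z * (1 - inverse w) * k z ^ p =
    A z * k w - \<beta> * inverse w * (1 - inverse z) * k w ^ p" if z: "z \<in> \<mu>" and w: "w \<in> \<mu>" for z w
  proof -
    have "inverse z * (1 - z) = inverse z - 1" "inverse w * (1 - w) = inverse w - 1"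
      using mu_nonzero[OF z] mu_nonzero[OF w] by (simp_all add: algebra_simps)
    then have e: "k (z * w) + \<alpha> * (inverse w - 1) * k z + \<beta> * (inverse z * (1 - inverse w) * k z ^ p) = k z + z ^ s * k w"
      "k (z * w) + \<alpha> * (inverse z - 1) * k w + \<beta> * (inverse w * (1 - inverse z) * k w ^ p) = k w + w ^ s * k z"
      using k[OF z w] k[OF w z] by (simp_all add: mult.assoc mult.commute[of w z])
    have "k z + z ^ s * k w - \<alpha> * (inverse w - 1) * k z - \<beta> * (inverse z * (1 - inverse w) * k z ^ p) =
        k w + w ^ s * k z - \<alpha> * (inverse z - 1) * k w - \<beta> * (inverse w * (1 - inverse z) * k w ^ p)"
      unfolding e[symmetric] by simp
    then show ?thesis unfolding A_def by (simp add: algebra_simps)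
  qed
  have frob_A: "A z ^ p = 1 - z ^ s * z - \<alpha> * (z - 1)" if z: "z \<in> \<mu>" for z
  proof -
    have "(z ^ s) ^ p = z ^ s * z"
      using frob_mu[of "z ^ s"] half_pow(2)[OF s z] z by (simp add: power_inverse)
    moreover have "inverse z ^ p = z" using frob_mu[of "inverse z"] z by simp
    ultimately show ?thesis by (simp add: A_def frob_simps al(1))
  qed
  have nrm: "nrm (- A \<zeta>) \<noteq> nrm (\<beta> * (1 - inverse \<zeta>))"
  proof -
    \<comment> \<open>t is a square root of \<zeta>; in terms of it \<zeta>^s, \<zeta> and their
      inverses are all powers of t.\<close>
    define t where "t = \<zeta> ^ s * \<zeta>"
    have "\<zeta> ^ s * \<zeta> ^ s * \<zeta> = 1" using s zeta_pow_q by (simp add: mult_2 flip: power_add power_Suc2)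
    then have st: "\<zeta> ^ s * t = 1" unfolding t_def by (simp only: mult.assoc)
    have "t * t = (\<zeta> ^ s * t) * \<zeta>" unfolding t_def by (simp only: mult_ac)
    then have tt: "t * t = \<zeta>" using st by simp
    have t0: "t \<noteq> 0" using st by auto
    have s_eq: "\<zeta> ^ s = inverse t" using st t0 by (simp add: field_simps)
    have i_eq: "inverse \<zeta> = inverse t * inverse t" using tt by (metis inverse_mult_distrib)
    have t1: "t \<noteq> 1" using tt zeta_ne_1 by auto
    have "nrm (A \<zeta>) = (1 - inverse t - \<alpha> * (inverse t * inverse t - 1)) * (1 - t - \<alpha> * (t * t - 1))"
    proof -
      have "A \<zeta> ^ p = 1 - t - \<alpha> * (t * t - 1)" unfolding frob_A[OF zeta_mu] t_def[symmetric] tt ..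
      moreover have "A \<zeta> = 1 - inverse t - \<alpha> * (inverse t * inverse t - 1)" unfolding A_def s_eq i_eq ..
      ultimately show ?thesis by (simp only: nrm_def)
    qed
    moreover have "nrm (1 - inverse \<zeta>) = (1 - inverse t * inverse t) * (1 - t * t)"
    proof -
      have "inverse \<zeta> ^ p = \<zeta>" using frob_mu[of "inverse \<zeta>"] by simp
      then have "nrm (1 - inverse \<zeta>) = (1 - inverse \<zeta>) * (1 - \<zeta>)" by (simp add: nrm_def frob_diff)
      then show ?thesis unfolding i_eq tt .
    qed
    moreover have "nrm (- A \<zeta>) = nrm (A \<zeta>)" by (simp add: nrm_def frob_minus)
    moreover have "inverse t * t = 1" using t0 by simp
    ultimately have "nrm (- A \<zeta>) - nrm (\<beta> * (1 - inverse \<zeta>)) = (1 - inverse t) * (1 - t)"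
      unfolding nrm_mult al(2)[symmetric] using half_norm_identity[of "inverse t" t \<alpha>] by simp
    then show ?thesis using t1 by auto
  qed
  obtain d where d: "- A \<zeta> * d + \<beta> * (1 - inverse \<zeta>) * d ^ p = k \<zeta>"
    using linear_frob_solve[OF nrm] by metis
  \<comment> \<open>The candidate coboundary of d. By the choice of d it agrees with k at
    \<zeta>.\<close>
  define e where "e z = \<beta> * (1 - inverse z) * d ^ p - A z * d" for z
  have e_sym: "A w * e z - \<beta> * inverse z * (1 - inverse w) * e z ^ p =
    A z * e w - \<beta> * inverse w * (1 - inverse z) * e w ^ p" if z: "z \<in> \<mu>" and w: "w \<in> \<mu>" for z w
  proof -
    have e_frob: "inverse z * e z ^ p = \<beta> ^ p * (inverse z - 1) * d - (inverse z - z ^ s - \<alpha> * (1 - inverse z)) * d ^ p"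
      if z: "z \<in> \<mu>" for z
    proof -
      have "e z ^ p = \<beta> ^ p * (1 - z) * d - A z ^ p * d ^ p"
        using frob_mu[of "inverse z"] z by (simp add: e_def frob_simps)
      then have "inverse z * e z ^ p = \<beta> ^ p * (inverse z - inverse z * z) * d -
          (inverse z - z ^ s * (inverse z * z) - \<alpha> * (inverse z * z - inverse z)) * d ^ p"
        by (simp only: frob_A[OF z]) (simp add: algebra_simps)
      then show ?thesis using mu_nonzero[OF z] by simp
    qed
    have "A w * e z - \<beta> * (1 - inverse w) * (inverse z * e z ^ p) =
      A z * e w - \<beta> * (1 - inverse z) * (inverse w * e w ^ p)"
      unfolding e_frob[OF z] e_frob[OF w] unfolding e_def A_def by (simp add: algebra_simps)
    then show ?thesis by (simp add: algebra_simps)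
  qed
  have "k z = e z" if z: "z \<in> \<mu>" for z
  proof -
    have e_zeta: "k \<zeta> = e \<zeta>" using d by (simp add: e_def)
    \<comment> \<open>Subtracting the symmetric relations of k and e at w = \<zeta> makes k z - e z
      a solution of a homogeneous semilinear equation. Since N(z^(-1)) = 1, the same norm inequality
      rules out nonzero solutions for every z.\<close>
    have "A \<zeta> * (k z - e z) = \<beta> * inverse z * (1 - inverse \<zeta>) * (k z - e z) ^ p"
    proof -
      have diff: "a - b = x - y" if "a - x = b - y" for a b x y :: 'k
        using that by (simp add: algebra_simps)
      show ?thesis unfolding frob_diff right_diff_distrib[of "A \<zeta>"] right_diff_distrib[of _ "k z ^ p"]
        by (rule diff, rule HOL.trans[OF sym[OF z zeta_mu]], unfold e_zeta, rule e_sym[OF z zeta_mu, symmetric])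
    qed
    moreover have "nrm (A \<zeta>) \<noteq> nrm (\<beta> * inverse z * (1 - inverse \<zeta>))"
    proof -
      have "nrm (inverse z) = 1"
        using frob_mu[of "inverse z"] z mu_nonzero[OF z] by (simp add: nrm_def)
      moreover have "nrm (- A \<zeta>) = nrm (A \<zeta>)" by (simp add: nrm_def frob_minus)
      ultimately show ?thesis using nrm by (simp add: nrm_mult)
    qed
    ultimately have "k z - e z = 0" by (rule linear_frob_zero[rotated])
    then show ?thesis by simp
  qed
  then show ?thesis unfolding e_def A_def by blast
qed

text \<open>C is rebuilt from its restrictions \<theta> to z = 1 and k to x = 0. Products (x, 1) o
  (0, z) constrain \<theta>, products (0, z) o (0, w) constrain k, and k then turns out to be a
  coboundary. The shift by d is the effect on C of conjugation by (d, 1).\<close>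

lemma cocycle_normal_form:
  fixes C :: "'k \<times> 'k \<Rightarrow> 'k"
  assumes s: "s < q"
    and C: "\<And>x z y w. z \<in> \<mu> \<Longrightarrow> w \<in> \<mu> \<Longrightarrow>
      C (x + z * (z ^ s * y + (1 - w) * C (x, z)), z * w) = C (x, z) + z ^ s * C (y, w)"
  shows "\<exists>c d. (c = cT \<or> (\<exists>b. admissible s b \<and> c = cM b)) \<and>
    (\<forall>x. \<forall>z \<in> \<mu>. C (x, z) + (1 - z ^ s) * d = c (x + (1 - z) * d, z))"
proof -
  define \<theta> where "\<theta> x = C (x, 1)" for x
  have "\<theta> (x + y) = \<theta> x + \<theta> y" for x y using C[of 1 1 x y] by (simp add: \<theta>_def)
  then obtain \<alpha> \<beta> where th: "\<And>x. \<theta> x = \<alpha> * x + \<beta> * x ^ p" using additive_form[of \<theta>] by metis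
  define k where "k z = C (0, z)" for z
  \<comment> \<open>Obtained from (0, z) o (y, 1) = (x, z). Here y = z^(-1-s) x, so y^p = z^(1+s)
    x^p, and the further factor z^s gives the exponent 2 s + 1.\<close>
  have CF: "C (x, z) = k z + \<alpha> * inverse z * x + \<beta> * (z ^ (2 * s + 1) * x ^ p)" if z: "z \<in> \<mu>" for x z
  proof -
    define y where "y = inverse z * inverse z ^ s * x"
    have x: "x = z * (z ^ s * y)" using mu_nonzero[OF z] by (simp add: y_def field_simps)
    have "C (x, z) = k z + z ^ s * \<theta> y" unfolding x using C[of z 1 0 y] z by (simp add: k_def \<theta>_def)
    moreover have "z ^ s * y = inverse z * x" using mu_nonzero[OF z] by (simp add: y_def field_simps)
    moreover have "y ^ p = z * z ^ s * x ^ p"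
      using frob_mu[of "inverse z * inverse z ^ s"] z by (simp add: y_def power_mult_distrib[of _ x] power_inverse)
    moreover have "z ^ (2 * s + 1) = z ^ s * (z * z ^ s)" by (simp only: mult_2 power_add power_one_right) (simp only: mult_ac)
    moreover have "z ^ s * \<theta> y = \<alpha> * (z ^ s * y) + \<beta> * (z ^ s * y ^ p)" by (simp add: th algebra_simps)
    ultimately show ?thesis by (simp only: mult.assoc add.assoc)
  qed
  \<comment> \<open>C at (x, 1) o (0, z), computed by the cocycle identity and by \<open>CF\<close>,
    gives two expressions in x and x^p whose coefficients must agree.\<close>
  have coeff: "\<alpha> * inverse z * (1 + (1 - z) * \<alpha>) + \<beta> * (z ^ (2 * s + 1) * ((1 - inverse z) * \<beta> ^ p)) = \<alpha>"
    "\<alpha> * inverse z * ((1 - z) * \<beta>) + \<beta> * (z ^ (2 * s + 1) * (1 + (1 - inverse z) * \<alpha> ^ p)) = \<beta>"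
    if z: "z \<in> \<mu>" for z
  proof -
    have "(\<alpha> * inverse z * (1 + (1 - z) * \<alpha>) + \<beta> * (z ^ (2 * s + 1) * ((1 - inverse z) * \<beta> ^ p))) * x +
      (\<alpha> * inverse z * ((1 - z) * \<beta>) + \<beta> * (z ^ (2 * s + 1) * (1 + (1 - inverse z) * \<alpha> ^ p))) * x ^ p =
      \<alpha> * x + \<beta> * x ^ p" for x
    proof -
      define X where "X = x + (1 - z) * \<theta> x"
      have "C (X, z) = \<theta> x + k z" using C[of 1 z x 0] z by (simp add: X_def \<theta>_def k_def)
      then have "\<alpha> * inverse z * X + \<beta> * (z ^ (2 * s + 1) * X ^ p) = \<theta> x" using CF[OF z, of X] by simp
      moreover have "X ^ p = x ^ p + (1 - inverse z) * (\<alpha> ^ p * x ^ p + \<beta> ^ p * x)"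
        by (simp add: X_def th frob_simps frob_mu[OF z])
      ultimately have "\<alpha> * inverse z * X + \<beta> * (z ^ (2 * s + 1) * (x ^ p + (1 - inverse z) * (\<alpha> ^ p * x ^ p + \<beta> ^ p * x))) = \<theta> x"
        by simp
      then show ?thesis unfolding th X_def by (simp only: distrib_left distrib_right ac_simps mult_1_left)
    qed
    from linear_frob_coeff_eq[OF this]
    show "\<alpha> * inverse z * (1 + (1 - z) * \<alpha>) + \<beta> * (z ^ (2 * s + 1) * ((1 - inverse z) * \<beta> ^ p)) = \<alpha>"
      "\<alpha> * inverse z * ((1 - z) * \<beta>) + \<beta> * (z ^ (2 * s + 1) * (1 + (1 - inverse z) * \<alpha> ^ p)) = \<beta>" .
  qed
  have kk: "k (z * w) + \<alpha> * inverse w * (1 - w) * k z + \<beta> * ((z * w) ^ (2 * s + 1) * (inverse z * (1 - inverse w) * k z ^ p))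
      = k z + z ^ s * k w" if z: "z \<in> \<mu>" and w: "w \<in> \<mu>" for z w
  proof -
    have "C (z * ((1 - w) * k z), z * w) = k z + z ^ s * k w" using C[of z w 0 0] z w by (simp add: k_def)
    moreover have "(z * ((1 - w) * k z)) ^ p = inverse z * (1 - inverse w) * k z ^ p"
      by (simp add: frob_simps frob_mu z w)
    moreover have "\<alpha> * inverse (z * w) * (z * ((1 - w) * k z)) = \<alpha> * inverse w * (1 - w) * k z"
      using mu_nonzero[OF z] by simp
    ultimately show ?thesis using CF[OF mult_mu[OF z w], of "z * ((1 - w) * k z)"] by (simp only:)
  qed
  have quad: "\<alpha> + \<alpha> * \<alpha> = nrm \<beta> * z ^ (2 * s + 1)" if z: "z \<in> \<mu>" "z \<noteq> 1" for z
  proof -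
    have z0: "inverse z * z = 1" using mu_nonzero[OF z(1)] by simp
    have "(1 - inverse z) * (\<alpha> + \<alpha> * \<alpha>) = (1 - inverse z) * (nrm \<beta> * z ^ (2 * s + 1))"
    proof -
      have "\<alpha> * inverse z + \<alpha> * \<alpha> * (inverse z - inverse z * z) + (1 - inverse z) * (nrm \<beta> * z ^ (2 * s + 1)) = \<alpha>"
        using coeff(1)[OF z(1)] unfolding nrm_def by (simp only: algebra_simps mult_1_left)
      then have "(1 - inverse z) * (nrm \<beta> * z ^ (2 * s + 1)) = \<alpha> - \<alpha> * inverse z - \<alpha> * \<alpha> * (inverse z - 1)"
        unfolding z0 by (metis add_diff_cancel_left' diff_diff_add)
      then show ?thesis by (simp only:) (simp add: algebra_simps)
    qed
    then show ?thesis using z by simp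
  qed
  have pow_mult: "(z * w) ^ s = z ^ s * w ^ s" for z w :: 'k by (rule power_mult_distrib)
  show ?thesis
  proof (cases "\<beta> = 0")
    case True
    then have "\<alpha> * (1 + \<alpha>) = 0" using quad[OF zeta_mu zeta_ne_1] by (simp add: algebra_simps)
    \<comment> \<open>\<alpha> = 0 leads to \<open>cT\<close> and \<alpha> = - 1 to
      \<open>cM 0\<close>. In the relation for k the character \<chi> is trivial in the first case
      and inversion in the second; \<eta> is z^s in both.\<close>
    then consider "\<alpha> = 0" | "\<alpha> = - 1" by (auto simp: add_eq_0_iff)
    then show ?thesis
    proof cases
      case 1
      have "\<exists>d. \<forall>z \<in> \<mu>. k z = (1 - z ^ s) * d"
        by (rule twisted_character) (use kk 1 True mu_nonzero in \<open>auto simp: pow_mult\<close>)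
      then obtain d where "\<forall>z \<in> \<mu>. k z = (1 - z ^ s) * d" ..
      then have "\<forall>x. \<forall>z \<in> \<mu>. C (x, z) + (1 - z ^ s) * (- d) = cT (x + (1 - z) * (- d), z)"
        using CF 1 True by (simp add: cT_def)
      then show ?thesis by blast
    next
      case 2
      have "\<exists>d. \<forall>z \<in> \<mu>. k z = (inverse z - z ^ s) * d"
      proof (rule twisted_character)
        fix z w assume z: "z \<in> \<mu>" and w: "w \<in> \<mu>"
        show "k (z * w) = inverse w * k z + z ^ s * k w"
          using kk[OF z w] 2 True mu_nonzero[OF w] by (simp add: algebra_simps)
      qed (use mu_nonzero in \<open>auto simp: pow_mult\<close>)
      then obtain d where d: "\<forall>z \<in> \<mu>. k z = (inverse z - z ^ s) * d" ..
      have "C (x, z) + (1 - z ^ s) * (- d) = cM 0 (x + (1 - z) * (- d), z)" if z: "z \<in> \<mu>" for x z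
      proof -
        have "inverse z * (x + (1 - z) * (- d)) = inverse z * x - (inverse z - 1) * d"
          using mu_nonzero[OF z] by (simp add: algebra_simps)
        then show ?thesis using d z CF[OF z, of x] 2 True by (simp add: cM_def) (simp add: algebra_simps)
      qed
      moreover have "admissible s 0" by (simp add: admissible_def)
      ultimately show ?thesis by blast
    qed
  next
    case False
    have "\<zeta> ^ 2 \<noteq> 1" using zeta_sq_ne_1 by (simp add: power2_eq_square)
    \<comment> \<open>The left side of \<open>quad\<close> does not depend on z. Its instances at
      \<zeta> and \<zeta>^2 force \<zeta>^(2s+1) = 1, and s < q leaves only 2 s + 1 = q.\<close>
    then have "nrm \<beta> * \<zeta> ^ (2 * s + 1) = nrm \<beta> * (\<zeta> ^ 2) ^ (2 * s + 1)"
      using quad[OF zeta_mu zeta_ne_1] quad[OF power_mu[OF zeta_mu], of 2] by metis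
    moreover have "(\<zeta> ^ 2) ^ (2 * s + 1) = \<zeta> ^ (2 * s + 1) * \<zeta> ^ (2 * s + 1)"
      by (simp only: power_mult[symmetric] power_add[symmetric] mult_2[of "2 * s + 1"])
    ultimately have z1: "\<zeta> ^ (2 * s + 1) = 1" using False mu_nonzero[OF zeta_mu] by simp
    then have "q dvd 2 * s + 1" using mu_pow_eq_1[OF zeta_mu] zeta_ne_1 by blast
    then obtain m where m: "2 * s + 1 = q * m" by blast
    then have "q * m < q * 2" using s by linarith
    then have "m < 2" by simp
    moreover have "m \<noteq> 0" using m by (intro notI) simp
    ultimately have "m = 1" by linarith
    then have sq: "2 * s + 1 = q" using m by simp
    then have mu1: "z ^ (2 * s + 1) = 1" if "z \<in> \<mu>" for z using that by (simp add: \<mu>_def)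
    have z0: "inverse \<zeta> * \<zeta> = 1" using mu_nonzero[OF zeta_mu] by simp
    \<comment> \<open>The coefficient of x^p at z = \<zeta> shows that \<alpha> lies in the prime
      field.\<close>
    have "(1 - inverse \<zeta>) * \<beta> * \<alpha> ^ p = (1 - inverse \<zeta>) * \<beta> * \<alpha>"
    proof -
      have "(1 - inverse \<zeta>) * \<beta> * \<alpha> ^ p + \<alpha> * \<beta> * (inverse \<zeta> - inverse \<zeta> * \<zeta>) = 0"
        using coeff(2)[OF zeta_mu] unfolding z1 by (simp add: algebra_simps)
      then have "(1 - inverse \<zeta>) * \<beta> * \<alpha> ^ p = - (\<alpha> * \<beta> * (inverse \<zeta> - 1))"
        unfolding z0 by (simp only: add_eq_0_iff2)
      then show ?thesis by (simp only:) (simp add: algebra_simps)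
    qed
    then have alp: "\<alpha> ^ p = \<alpha>" using False zeta_ne_1 by simp
    have al2: "\<alpha> + \<alpha> * \<alpha> = nrm \<beta>" using quad[OF zeta_mu zeta_ne_1] by (simp only: z1 mult_1_right)
    then have al0: "\<alpha> \<noteq> 0" using False by auto
    \<comment> \<open>The inverse of X |-> b X^p - X is x |-> (x + b x^p) / (N(b) - 1). Matching it
      with \<alpha> x + \<beta> x^p requires \<beta> = b \<alpha> and N(b) - 1 = 1 /
      \<alpha>.\<close>
    define b where "b = \<beta> / \<alpha>"
    have nb: "nrm b = (\<alpha> + 1) / \<alpha>"
    proof -
      have "nrm b = nrm \<beta> / (\<alpha> * \<alpha>)" by (simp add: b_def nrm_def power_divide alp)
      also have "nrm \<beta> = \<alpha> * (\<alpha> + 1)" by (simp add: algebra_simps flip: al2)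
      finally show ?thesis using al0 by simp
    qed
    have nb1: "nrm b \<noteq> 1" using al0 by (simp add: nb)
    then have adm: "admissible s b" using sq by (simp add: admissible_def)
    have "nrm b - 1 = 1 / \<alpha>" using al0 by (simp add: nb field_simps)
    then have cMb: "cM b (x, z) = \<alpha> * (inverse z * x) + \<beta> * x ^ p" for x z
      using al0 by (simp add: cM_def b_def field_simps)
    have "\<exists>d. \<forall>z \<in> \<mu>. k z = \<beta> * (1 - inverse z) * d ^ p - (1 - z ^ s - \<alpha> * (inverse z - 1)) * d"
      by (rule cocycle_normal_form_half[OF sq alp al2]) (use kk mu1 in simp)
    then obtain d where d: "\<And>z. z \<in> \<mu> \<Longrightarrow>
      k z = \<beta> * (1 - inverse z) * d ^ p - (1 - z ^ s - \<alpha> * (inverse z - 1)) * d" by blast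
    have "C (x, z) + (1 - z ^ s) * d = cM b (x + (1 - z) * d, z)" if z: "z \<in> \<mu>" for x z
    proof -
      have "(x + (1 - z) * d) ^ p = x ^ p + (1 - inverse z) * d ^ p"
        by (simp add: frob_simps frob_mu[OF z])
      moreover have "inverse z * (x + (1 - z) * d) = inverse z * x + (inverse z - 1) * d"
        using mu_nonzero[OF z] by (simp add: algebra_simps)
      ultimately show ?thesis unfolding cMb CF[OF z] d[OF z] mu1[OF z]
        by (simp only:) (simp add: algebra_simps)
    qed
    with adm show ?thesis by blast
  qed
qed

end

section \<open>Skew braces on the model group\<close>

locale model_group_brace = quadratic_field p q \<zeta> + skew_brace B
  for p q :: nat and \<zeta> :: "'k::finite_field" and B :: "('k \<times> 'k) ring" (structure) +
  assumes car: "carrier B = UNIV \<times> \<mu>" and zero: "\<zero> = (0, 1)"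
    and add_eq: "\<And>x z y w. z \<in> \<mu> \<Longrightarrow> w \<in> \<mu> \<Longrightarrow> (x, z) \<oplus> (y, w) = (x + z * y, z * w)"
begin

lemma order_eq: "Coset.order B = p\<^sup>2 * q"
  by (simp add: Coset.order_def car card_cartesian_product card_mu card_K)

text \<open>
  Since the order is odd, every \<open>lam a\<close> is a square of some \<open>lam b\<close>; this excludes automorphisms of
  Frobenius type, which invert the second component.
\<close>

lemma circ_square_root:
  assumes "a \<in> carrier B" obtains b where "b \<in> carrier B" "b \<otimes> b = a"
proof -
  have "odd (p\<^sup>2 * q)" using p q by simp
  then obtain m where m: "p\<^sup>2 * q = 2 * m + 1" by (rule oddE)
  have "a [^] (p\<^sup>2 * q) = \<one>" using circ.pow_order_eq_1[OF assms] by (simp add: order_eq)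
  then have "a [^] (Suc (p\<^sup>2 * q)) = a" using assms by simp
  moreover have "Suc (p\<^sup>2 * q) = (m + 1) + (m + 1)" by (simp add: m)
  ultimately have "a [^] (m + 1) \<otimes> a [^] (m + 1) = a"
    using circ.nat_pow_mult[OF assms, of "m + 1" "m + 1"] by metis
  with assms that show ?thesis by blast
qed

lemma lam_linear:
  assumes a: "a \<in> carrier B"
  shows "\<exists>u c. u \<noteq> 0 \<and> (\<forall>x. \<forall>z \<in> \<mu>. lam a (x, z) = (u * x + (1 - z) * c, z))"
proof -
  obtain b where b: "b \<in> carrier B" "b \<otimes> b = a" using a by (rule circ_square_root)
  have lam_a: "lam a (x, z) = lam b (lam b (x, z))" if "z \<in> \<mu>" for x z
    using lam_circ[OF b(1) b(1), of "(x, z)"] b(2) that by (simp add: car)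
  have lam_car: "lam b (x, z) \<in> UNIV \<times> \<mu>" if "z \<in> \<mu>" for x z
    using lam_closed[OF b(1), of "(x, z)"] that by (simp add: car)
  show ?thesis
  proof (rule semi_end_form[of "lam b"])
    show "snd (lam b (x, z)) \<in> \<mu>" if "z \<in> \<mu>" for x z using lam_car[OF that] by (simp add: mem_Times_iff)
    show "inj_on (lam b) (UNIV \<times> \<mu>)" using lam_inj[OF b(1)] by (simp add: car)
    show "lam b (x + z * y, z * w) =
        (fst (lam b (x, z)) + snd (lam b (x, z)) * fst (lam b (y, w)), snd (lam b (x, z)) * snd (lam b (y, w)))"
      if "z \<in> \<mu>" "w \<in> \<mu>" for x z y w
      using lam_add[OF b(1), of "(x, z)" "(y, w)"] lam_car[of z x] lam_car[of w y] that
      by (cases "lam b (x, z)"; cases "lam b (y, w)") (simp add: car add_eq)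
  next
    fix u d assume u: "u \<noteq> 0" and l: "\<And>x z. z \<in> \<mu> \<Longrightarrow> lam b (x, z) = (u * x + (1 - z) * d, z)"
    show ?thesis
      by (rule exI[of _ "u * u"], rule exI[of _ "u * d + d"]) (use u in \<open>auto simp: lam_a l algebra_simps\<close>)
  next
    fix u d assume u: "u \<noteq> 0"
      and l: "\<And>x z. z \<in> \<mu> \<Longrightarrow> lam b (x, z) = (u * x ^ p + (1 - inverse z) * d, inverse z)"
    have "lam a (x, z) = (u * u ^ p * x + (1 - z) * (u * d ^ p + d), z)" if z: "z \<in> \<mu>" for x z
      using z frob_mu[of "inverse z"] by (simp add: lam_a l frob_simps) (simp add: algebra_simps)
    then show ?thesis using u by (intro exI[of _ "u * u ^ p"] exI[of _ "u * d ^ p + d"]) auto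
  qed
qed

text \<open>The linear coefficient is read off at (1, 1), where the factor 1 - z vanishes; the
  translation part at (0, \<zeta>), where the linear term vanishes.\<close>

definition U :: "'k \<times> 'k \<Rightarrow> 'k" where "U a = fst (lam a (1, 1))"
definition C :: "'k \<times> 'k \<Rightarrow> 'k" where "C a = fst (lam a (0, \<zeta>)) / (1 - \<zeta>)"

lemma lam_eq:
  assumes "a \<in> carrier B" "z \<in> \<mu>"
  shows "lam a (x, z) = (U a * x + (1 - z) * C a, z)" "U a \<noteq> 0"
proof -
  obtain u c where uc: "u \<noteq> 0" "\<forall>x. \<forall>z \<in> \<mu>. lam a (x, z) = (u * x + (1 - z) * c, z)"
    using lam_linear[OF assms(1)] by blast
  then have "U a = u" "C a = c" using zeta_ne_1 by (simp_all add: U_def C_def)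
  with uc assms show "lam a (x, z) = (U a * x + (1 - z) * C a, z)" "U a \<noteq> 0" by auto
qed

lemma circ_eq:
  assumes "z \<in> \<mu>" "w \<in> \<mu>"
  shows "(x, z) \<otimes> (y, w) = (x + z * (U (x, z) * y + (1 - w) * C (x, z)), z * w)"
  using assms by (simp add: circ_eq_add_lam car lam_eq add_eq)

lemma circ_cocycle:
  assumes "a \<in> carrier B" "b \<in> carrier B"
  shows "U (a \<otimes> b) = U a * U b" "C (a \<otimes> b) = C a + U a * C b"
proof -
  have ab: "a \<otimes> b \<in> carrier B" using assms by simp
  have "lam (a \<otimes> b) (1, 1) = lam a (lam b (1, 1))" using lam_circ[OF assms] by (simp add: car)
  then show "U (a \<otimes> b) = U a * U b" using assms ab by (simp add: lam_eq)
  have "lam (a \<otimes> b) (0, \<zeta>) = lam a (lam b (0, \<zeta>))" using lam_circ[OF assms] by (simp add: car)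
  then have "(1 - \<zeta>) * C (a \<otimes> b) = (1 - \<zeta>) * (C a + U a * C b)"
    using assms ab by (simp add: lam_eq algebra_simps)
  then show "C (a \<otimes> b) = C a + U a * C b" using zeta_ne_1 by simp
qed

lemma U_one: "U \<one> = 1"
  using circ_cocycle(1)[of \<one> \<one>] lam_eq(2)[of \<one> 1] by simp

lemma U_pow: "a \<in> carrier B \<Longrightarrow> U (a [^] (n :: nat)) = U a ^ n"
  by (induction n) (simp_all add: U_one circ_cocycle mult.commute)

lemma U_frob: "U a ^ p\<^sup>2 = U a"
  by (simp add: power2_eq_square power_mult frob_frob)

text \<open>U(a) is killed by p^2 q, and raising to the power p^2 is the identity on K, so q alone
  suffices.\<close>

lemma U_mu:
  assumes "a \<in> carrier B" shows "U a \<in> \<mu>"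
proof -
  have "a [^] (p\<^sup>2 * q) = \<one>" using circ.pow_order_eq_1[OF assms] by (simp add: order_eq)
  then have "U a ^ (p\<^sup>2 * q) = 1" using U_pow[OF assms] U_one by metis
  then show ?thesis by (simp add: \<mu>_def power_mult U_frob)
qed

text \<open>
  \<open>K \<times> {1}\<close> is a subgroup of order \<open>p\<^sup>2\<close> of the circle group, while \<open>U\<close> takes values of order prime to \<open>p\<close>.
\<close>

lemma U_kernel: "U (x, 1) = 1"
proof -
  let ?H = "UNIV \<times> {1} :: ('k \<times> 'k) set"
  have one: "\<one> = (0, 1)" by (simp add: one_eq_zero zero)
  have sub: "subgroup ?H B"
  proof
    show "?H \<subseteq> carrier B" by (auto simp: car)
    show "a \<otimes> b \<in> ?H" if "a \<in> ?H" "b \<in> ?H" for a b using that by (auto simp: circ_eq)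
    show "\<one> \<in> ?H" by (simp add: one)
    show "inv a \<in> ?H" if a: "a \<in> ?H" for a
    proof -
      obtain y where y: "a = (y, 1)" using a by auto
      then have car_a: "a \<in> carrier B" by (simp add: car)
      then obtain v w where vw: "inv a = (v, w)" "w \<in> \<mu>" using circ.inv_closed[OF car_a] by (auto simp: car)
      have "a \<otimes> inv a = (0, 1)" using car_a by (simp add: one)
      then show ?thesis using vw y by (simp add: circ_eq)
    qed
  qed
  let ?G = "B\<lparr>carrier := ?H\<rparr>"
  interpret H: group ?G using sub by (rule subgroup.subgroup_is_group) (rule circ_group)
  have "(x, 1) [^]\<^bsub>?G\<^esub> Coset.order ?G = \<one>\<^bsub>?G\<^esub>" by (rule H.pow_order_eq_1) simp
  moreover have "Coset.order ?G = p\<^sup>2" by (simp add: Coset.order_def card_cartesian_product card_K)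
  ultimately have "(x, 1) [^] p\<^sup>2 = \<one>" using circ.nat_pow_consistent[of "(x, 1)" "p\<^sup>2" ?H] by simp
  then have "U (x, 1) ^ p\<^sup>2 = 1" using U_pow[of "(x, 1)" "p\<^sup>2"] by (simp add: car U_one)
  then show ?thesis by (simp add: U_frob)
qed

lemma U_snd:
  assumes z: "z \<in> \<mu>" shows "U (x, z) = U (0, z)"
proof -
  have car0: "(0, z) \<in> carrier B" using z by (simp add: car)
  define y where "y = x / (z * U (0, z))"
  have "(0, z) \<otimes> (y, 1) = (x, z)"
    using z mu_nonzero[OF z] lam_eq(2)[OF car0 z] by (simp add: circ_eq y_def)
  then show ?thesis using circ_cocycle(1)[OF car0, of "(y, 1)"] by (simp add: U_kernel car)
qed

lemma U_power:
  obtains s where "s < q" "\<And>x z. z \<in> \<mu> \<Longrightarrow> U (x, z) = z ^ s"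
proof -
  obtain s where s: "s < q" "U (0, \<zeta>) = \<zeta> ^ s" using U_mu[of "(0, \<zeta>)"] by (auto simp: car elim: mu_zeta_powE)
  have mult: "U (0, z * w) = U (0, z) * U (0, w)" if "z \<in> \<mu>" "w \<in> \<mu>" for z w
    using circ_cocycle(1)[of "(0, z)" "(0, w)"] U_snd[OF mult_mu[OF that], of "z * ((1 - w) * C (0, z))"] that
    by (simp add: car circ_eq)
  have "U (0, \<zeta>) \<noteq> 0" using lam_eq(2)[of "(0, \<zeta>)" 1] by (simp add: car)
  then have pow: "U (0, \<zeta> ^ n) = U (0, \<zeta>) ^ n" for n
    using mult_char_zeta_pow[of "\<lambda>z. U (0, z)"] mult by blast
  have "U (x, z) = z ^ s" if z: "z \<in> \<mu>" for x z
  proof -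
    obtain i where "z = \<zeta> ^ i" using mu_zeta_powE[OF z] .
    then show ?thesis using U_snd[OF z, of x] pow s by (simp add: power_mult[symmetric] mult.commute)
  qed
  with s that show ?thesis by blast
qed

lemma classification:
  obtains s where "s < q" "brace_iso B (Br s cT) \<noteq> {}"
  | s b where "s < q" "admissible s b" "brace_iso B (Br s (cM b)) \<noteq> {}"
proof -
  obtain s where s: "s < q" and U: "\<And>x z. z \<in> \<mu> \<Longrightarrow> U (x, z) = z ^ s"
    by (rule U_power) blast
  have coc: "C (x + z * (z ^ s * y + (1 - w) * C (x, z)), z * w) = C (x, z) + z ^ s * C (y, w)"
    if "z \<in> \<mu>" "w \<in> \<mu>" for x z y w
    using circ_cocycle(2)[of "(x, z)" "(y, w)"] that by (simp add: car circ_eq U)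
  obtain c d where c: "c = cT \<or> (\<exists>b. admissible s b \<and> c = cM b)"
    and cd: "\<And>x z. z \<in> \<mu> \<Longrightarrow> C (x, z) + (1 - z ^ s) * d = c (x + (1 - z) * d, z)"
    using cocycle_normal_form[OF s coc] by blast
  \<comment> \<open>Conjugation by (d, 1) in the additive group.\<close>
  let ?h = "\<lambda>(x, z). (x + (1 - z) * d, z)"
  have "?h \<in> brace_iso B (Br s c)"
  proof (rule brace_isoI)
    show "bij_betw ?h (carrier B) (carrier (Br s c))"
      by (rule bij_betw_byWitness[where f' = "\<lambda>(x, z). (x - (1 - z) * d, z)"]) (auto simp: car)
    show "?h (a \<oplus> a') = ?h a \<oplus>\<^bsub>Br s c\<^esub> ?h a'" if "a \<in> carrier B" "a' \<in> carrier B" for a a'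
      using that by (auto simp: car add_eq) (simp add: algebra_simps)
    show "?h (a \<otimes> a') = ?h a \<otimes>\<^bsub>Br s c\<^esub> ?h a'" if aa: "a \<in> carrier B" "a' \<in> carrier B" for a a'
    proof -
      from aa obtain x z y w where a: "a = (x, z)" "a' = (y, w)" "z \<in> \<mu>" "w \<in> \<mu>" by (auto simp: car)
      show ?thesis
        by (simp add: a circ_eq U cd[OF a(3), of x, symmetric]) (simp add: algebra_simps)
    qed
  qed
  then have "brace_iso B (Br s c) \<noteq> {}" by blast
  with c s that show ?thesis by blast
qed

end

section \<open>The groups of order \<open>p\<^sup>2q\<close> as semidirect products\<close>

text \<open>A set containing 1 and closed under left multiplication by the generators exhausts a
  group in which they have finite order; this bounds the order of the presented group. Exponents
  range over all naturals here, and reduction modulo p and q comes later.\<close>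

lemma (in group) normal_form_closed:
  assumes G: "s \<in> carrier G" "t \<in> carrier G" "e \<in> carrier G"
    and st: "t \<otimes> s = s \<otimes> t" and es: "e \<otimes> s = t \<otimes> e"
    and et: "e \<otimes> t = s [^] (i :: nat) \<otimes> t [^] (j :: nat) \<otimes> e"
  defines "N \<equiv> {s [^] a \<otimes> (t [^] b \<otimes> e [^] c) | (a :: nat) (b :: nat) (c :: nat). True}"
  assumes x: "x \<in> N"
  shows "s \<otimes> x \<in> N" "t \<otimes> x \<in> N" "e \<otimes> x \<in> N"
proof -
  obtain a b c :: nat where x: "x = s [^] a \<otimes> (t [^] b \<otimes> e [^] c)" using x unfolding N_def by blast
  have "s \<otimes> x = s [^] Suc a \<otimes> (t [^] b \<otimes> e [^] c)"
    using G by (simp only: x nat_pow_Suc2 m_assoc nat_pow_closed m_closed)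
  then show "s \<otimes> x \<in> N" unfolding N_def by blast
  have comm: "t [^] m \<otimes> s [^] n = s [^] n \<otimes> t [^] m" for m n :: nat
    using G st by (metis group_commutes_pow nat_pow_closed)
  have "t \<otimes> x = (t \<otimes> s [^] a) \<otimes> (t [^] b \<otimes> e [^] c)" using G by (simp add: x m_assoc)
  also have "\<dots> = s [^] a \<otimes> (t [^] Suc b \<otimes> e [^] c)"
    using comm[of 1 a] by (simp only: nat_pow_eone[OF G(2)] nat_pow_Suc2[OF G(2)] m_assoc nat_pow_closed m_closed G)
  finally show "t \<otimes> x \<in> N" unfolding N_def by blast
  have e_s: "e \<otimes> s [^] n = t [^] n \<otimes> e" for n :: nat
  proof (induction n)
    case (Suc n)
    have "e \<otimes> s [^] Suc n = (e \<otimes> s [^] n) \<otimes> s" using G by (simp add: m_assoc)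
    also have "\<dots> = t [^] n \<otimes> (e \<otimes> s)" using G Suc by (simp add: m_assoc)
    finally show ?case using G es by (simp add: m_assoc)
  qed (use G in simp)
  have e_t: "e \<otimes> t [^] n = s [^] (i * n) \<otimes> t [^] (j * n) \<otimes> e" for n :: nat
  proof (induction n)
    case (Suc n)
    have "e \<otimes> t [^] Suc n = (e \<otimes> t [^] n) \<otimes> t" using G by (simp add: m_assoc)
    also have "\<dots> = s [^] (i * n) \<otimes> t [^] (j * n) \<otimes> (e \<otimes> t)" using G Suc by (simp add: m_assoc)
    also have "\<dots> = s [^] (i * n) \<otimes> (t [^] (j * n) \<otimes> s [^] i) \<otimes> t [^] j \<otimes> e" using G et by (simp add: m_assoc)
    also have "\<dots> = (s [^] (i * n) \<otimes> s [^] i) \<otimes> (t [^] (j * n) \<otimes> t [^] j) \<otimes> e" using G comm by (simp add: m_assoc)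
    finally show ?case using G by (simp add: nat_pow_mult add.commute)
  qed (use G in simp)
  have "e \<otimes> x = (e \<otimes> s [^] a) \<otimes> (t [^] b \<otimes> e [^] c)" using G by (simp add: x m_assoc)
  also have "\<dots> = t [^] a \<otimes> (e \<otimes> t [^] b) \<otimes> e [^] c" using G e_s by (simp add: m_assoc)
  also have "\<dots> = (t [^] a \<otimes> s [^] (i * b)) \<otimes> (t [^] (j * b) \<otimes> (e \<otimes> e [^] c))" using G e_t by (simp add: m_assoc)
  also have "\<dots> = s [^] (i * b) \<otimes> ((t [^] a \<otimes> t [^] (j * b)) \<otimes> (e \<otimes> e [^] c))" using G comm by (simp add: m_assoc)
  also have "\<dots> = s [^] (i * b) \<otimes> (t [^] (a + j * b) \<otimes> e [^] Suc c)"
    by (simp only: nat_pow_mult nat_pow_Suc2[OF G(3)] G)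
  finally show "e \<otimes> x \<in> N" unfolding N_def by blast
qed

lemma (in group) pow_mod:
  assumes "x \<in> carrier G" "x [^] (n :: nat) = \<one>"
  shows "x [^] (a :: nat) = x [^] (a mod n)"
proof -
  have "x [^] a = (x [^] n) [^] (a div n) \<otimes> x [^] (a mod n)"
    using assms(1) by (simp add: nat_pow_pow nat_pow_mult)
  then show ?thesis using assms by simp
qed

lemma (in group) inv_eq_pow:
  assumes "x \<in> carrier G" "x [^] (n :: nat) = \<one>" "n > 0"
  shows "inv x = x [^] (n - 1)"
proof (rule inv_equality)
  show "x [^] (n - 1) \<otimes> x = \<one>" using assms by (cases n) simp_all
qed (use assms in auto)

section \<open>Isomorphism types of the semidirect products\<close>

context quadratic_field
begin

lemma semi_iso_1:
  assumes "\<not> q dvd s" shows "semi s \<cong> semi 1"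
proof -
  let ?h = "\<lambda>(x :: 'k, z :: 'k). (x, z ^ s)"
  have inj: "inj_on ?h (UNIV \<times> \<mu>)"
  proof (rule inj_onI, clarsimp)
    fix z w assume z: "z \<in> \<mu>" "w \<in> \<mu>" "z ^ s = w ^ s"
    have "(z * inverse w) ^ s = 1" using z mu_nonzero[of w] by (simp add: power_mult_distrib power_inverse)
    then have "z * inverse w = 1" using mu_pow_eq_1[of "z * inverse w" s] z assms by simp
    then show "z = w" using mu_nonzero[OF z(2)] by (simp add: field_simps)
  qed
  have "?h ` (UNIV \<times> \<mu>) = UNIV \<times> \<mu>"
    by (rule endo_inj_surj) (use inj in auto)
  then have "?h \<in> iso (semi s) (semi 1)"
    using inj by (auto simp: iso_def hom_def bij_betw_def power_mult_distrib)
  then show ?thesis by (rule is_isoI)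
qed

lemma semi_iso_0:
  assumes "q dvd s" shows "semi s \<cong> semi 0"
proof -
  have "z ^ s = 1" if "z \<in> \<mu>" for z using that assms by (auto simp: \<mu>_def power_mult)
  then have "id \<in> iso (semi s) (semi 0)" by (auto simp: iso_def hom_def)
  then show ?thesis by (rule is_isoI)
qed

lemma semi_1_not_iso_0: "\<not> semi 1 \<cong> semi 0"
proof
  assume "semi 1 \<cong> semi 0"
  then obtain h where h: "h \<in> iso (semi 1) (semi 0)" by (auto simp: is_iso_def)
  then have inj: "inj_on h (UNIV \<times> \<mu>)" by (simp add: iso_def bij_betw_def)
  have car: "h a \<in> UNIV \<times> \<mu>" if "a \<in> UNIV \<times> \<mu>" for a using h that by (auto simp: iso_def hom_def)
  have m: "h (a \<otimes>\<^bsub>semi 1\<^esub> b) = h a \<otimes>\<^bsub>semi 0\<^esub> h b" if "a \<in> UNIV \<times> \<mu>" "b \<in> UNIV \<times> \<mu>" for a b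
    using h that hom_mult[of h "semi 1" "semi 0" a b] by (simp add: iso_def del: One_nat_def)
  have "h (0, \<zeta>) \<otimes>\<^bsub>semi 0\<^esub> h (1, 1) = h (1, 1) \<otimes>\<^bsub>semi 0\<^esub> h (0, \<zeta>)"
    by (cases "h (0, \<zeta>)"; cases "h (1, 1)") (simp add: add.commute mult.commute)
  then have "h (\<zeta>, \<zeta>) = h (1, \<zeta>)" using m[of "(0, \<zeta>)" "(1, 1)"] m[of "(1, 1)" "(0, \<zeta>)"] by simp
  then show False using inj zeta_ne_1 by (simp add: inj_on_eq_iff)
qed

lemma Zp2_Zq_iso: "Zp2_Zq p q \<cong> semi 0"
proof -
  let ?h = "\<lambda>(ab, i). (coord ab, \<zeta> ^ nat i)"
  have pq0: "p \<noteq> 0" "q \<noteq> 0" using p_ge_3 q_ge_3 by auto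
  have car: "carrier (Zp2_Zq p q) = ({0..<int p} \<times> {0..<int p}) \<times> {0..<int q}"
    using pq0 by (simp add: Zp2_Zq_def carrier_integer_mod_group)
  have of_int_mod: "(of_int (a mod int p) :: 'k) = of_int a" for a
  proof -
    have "(of_int (a mod int p - a) :: 'k) = 0" unfolding of_int_eq_0 by (simp add: mod_eq_dvd_iff[symmetric])
    then show ?thesis by simp
  qed
  have pow_mod: "\<zeta> ^ nat ((i + j) mod int q) = \<zeta> ^ nat i * \<zeta> ^ nat j" if "0 \<le> i" "0 \<le> j" for i j
  proof -
    have "nat ((i + j) mod int q) = (nat i + nat j) mod q" using that by (simp add: nat_mod_distrib nat_add_distrib)
    moreover have "\<zeta> ^ n = \<zeta> ^ (n mod q)" for n
    proof -
      have "\<zeta> ^ n = \<zeta> ^ (q * (n div q) + n mod q)" by simp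
      also have "\<dots> = \<zeta> ^ (n mod q)" by (simp only: power_add power_mult zeta_pow_q power_one mult_1_left)
      finally show ?thesis .
    qed
    ultimately show ?thesis by (metis power_add)
  qed
  have "bij_betw nat {0..<int q} {..<q}"
    by (rule bij_betw_byWitness[where f' = int]) auto
  moreover have "bij_betw (\<lambda>i. \<zeta> ^ i) {..<q} \<mu>" using zeta_pow_inj mu_eq by (simp add: bij_betw_def)
  ultimately have "bij_betw (\<lambda>i. \<zeta> ^ nat i) {0..<int q} \<mu>"
    using bij_betw_trans[of nat _ _ "\<lambda>i. \<zeta> ^ i"] by (simp add: o_def)
  with bij_coord have "bij_betw (map_prod coord (\<lambda>i. \<zeta> ^ nat i)) (({0..<int p} \<times> {0..<int p}) \<times> {0..<int q}) (UNIV \<times> \<mu>)"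
    by (rule bij_betw_map_prod)
  moreover have "map_prod coord (\<lambda>i. \<zeta> ^ nat i) = ?h" by (simp add: fun_eq_iff)
  ultimately have bij: "bij_betw ?h (carrier (Zp2_Zq p q)) (carrier (semi 0))" by (simp add: car)
  have "?h (x \<otimes>\<^bsub>Zp2_Zq p q\<^esub> y) = ?h x \<otimes>\<^bsub>semi 0\<^esub> ?h y"
    if xy: "x \<in> carrier (Zp2_Zq p q)" "y \<in> carrier (Zp2_Zq p q)" for x y
  proof -
    from xy obtain a b i a' b' i' where "x = ((a, b), i)" "y = ((a', b'), i')" "0 \<le> i" "0 \<le> i'"
      unfolding car by auto
    then show ?thesis by (simp add: Zp2_Zq_def coord_def of_int_mod pow_mod algebra_simps)
  qed
  with bij have "?h \<in> iso (Zp2_Zq p q) (semi 0)" by (auto simp: iso_def hom_def bij_betw_def)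
  then show ?thesis by (rule is_isoI)
qed

end

lemma group_Zp2_Zq: "group (Zp2_Zq p q)"
  by (simp add: Zp2_Zq_def DirProd_group)

text \<open>The prime field of K and the type of \<xi> are different types; the integer
  representative of \<xi>, the one occurring in the relations, links them.\<close>

locale presented_quadratic_field = quadratic_field p q \<zeta>
  for p q :: nat and \<zeta> :: "'k::finite_field" +
  fixes \<xi> :: "'f::prime_card mod_ring"
  assumes card_f: "CARD('f) = p"
    and root: "\<zeta> * \<zeta> + of_int (to_int_mod_ring \<xi>) * \<zeta> + 1 = 0"
begin

text \<open>\<sigma> and \<tau> become the basis 1, \<zeta> of K, and \<epsilon> acts as
  multiplication by \<zeta>. The last relation is then \<zeta>^2 = - 1 - \<xi> \<zeta>.\<close>

definition letter :: "gen \<times> bool \<Rightarrow> 'k \<times> 'k" where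
  "letter = (\<lambda>(g, b). case g of
     Sig \<Rightarrow> (if b then 1 else - 1, 1)
   | Tau \<Rightarrow> (if b then \<zeta> else - \<zeta>, 1)
   | Eps \<Rightarrow> (0, if b then \<zeta> else inverse \<zeta>))"

primrec word :: "gen gword \<Rightarrow> 'k \<times> 'k" where
  "word [] = (0, 1)"
| "word (l # u) = letter l \<otimes>\<^bsub>semi 1\<^esub> word u"

lemma letter_car: "letter l \<in> carrier (semi 1)"
  by (auto simp: letter_def split: prod.splits gen.splits)

lemma word_car: "word u \<in> carrier (semi 1)"
proof (induction u)
  case (Cons l u)
  then show ?case using monoid.m_closed[OF group.is_monoid[OF group_semi], OF letter_car Cons] by simp
qed simp

lemma word_append: "word (u @ v) = word u \<otimes>\<^bsub>semi 1\<^esub> word v"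
proof (induction u)
  case Nil
  show ?case using word_car[of v] by (cases "word v") simp
next
  case (Cons l u)
  show ?case
    by (simp add: Cons monoid.m_assoc[OF group.is_monoid[OF group_semi] letter_car word_car word_car] del: One_nat_def)
qed

lemma word_replicate:
  "word (replicate n (Sig, b)) = (of_nat n * (if b then 1 else - 1), 1)"
  "word (replicate n (Tau, b)) = (of_nat n * (if b then \<zeta> else - \<zeta>), 1)"
  "word (replicate n (Eps, True)) = (0, \<zeta> ^ n)"
  by (induction n) (auto simp: letter_def algebra_simps)

lemma word_relations:
  assumes "(r, s) \<in> GF_relations q \<xi>" shows "word r = word s"
proof -
  have z0: "\<zeta> \<noteq> 0" by (rule mu_nonzero) simp
  have p0: "(of_nat p :: 'k) = 0" using char_K of_nat_CHAR[where ?'a = 'k] by simp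
  have xi: "0 \<le> to_int_mod_ring \<xi>" using range_to_int_mod_ring[where ?'a = 'f] by auto
  have root': "\<zeta> * \<zeta> = - 1 - of_nat (nat (to_int_mod_ring \<xi>)) * \<zeta>"
    using root xi by (simp add: eq_neg_iff_add_eq_0 algebra_simps)
  have tau: "word (gpow Tau (- to_int_mod_ring \<xi>)) = (- (of_nat (nat (to_int_mod_ring \<xi>)) * \<zeta>), 1)"
    using xi by (cases "to_int_mod_ring \<xi> = 0") (auto simp: gpow_def word_replicate)
  show ?thesis
    using assms root' z0 card_f p0 unfolding GF_relations_def
    by (elim insertE emptyE; clarsimp simp: word_append tau)
      (simp_all add: gpow_def word_replicate letter_def zeta_pow_q algebra_simps)
qed

lemma word_pres_eq: "pres_eq (GF_relations q \<xi>) u v \<Longrightarrow> word u = word v"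
proof (induction rule: pres_eq.induct)
  case (cancel u g b v)
  have "letter (g, b) \<otimes>\<^bsub>semi 1\<^esub> (letter (g, \<not> b) \<otimes>\<^bsub>semi 1\<^esub> word v) = word v"
    using mu_nonzero[OF zeta_mu] by (cases g; cases "word v") (auto simp: letter_def)
  then show ?case by (simp add: word_append)
qed (simp_all add: word_append word_relations)

abbreviation cls :: "gen gword \<Rightarrow> gen gword set" where
  "cls u \<equiv> pres_rel (GF_relations q \<xi>) `` {u}"

lemma group_GF: "group (GF q \<xi>)"
  unfolding GF_def by (rule group_presented_group)

lemma GF_carrier: "carrier (GF q \<xi>) = range cls"
  by (auto simp: GF_def presented_group_def quotient_def)

lemma cls_mult: "cls u \<otimes>\<^bsub>GF q \<xi>\<^esub> cls v = cls (u @ v)"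
  unfolding GF_def by (rule mult_presented_group)

lemma GF_one: "\<one>\<^bsub>GF q \<xi>\<^esub> = cls []"
  by (simp add: GF_def presented_group_def)

lemma cls_eq_iff: "cls u = cls v \<longleftrightarrow> pres_eq (GF_relations q \<xi>) u v"
  using eq_equiv_class_iff[OF equiv_pres_rel, of u v "GF_relations q \<xi>"] by (simp add: pres_rel_def)

lemma cls_relation: "(r, s) \<in> GF_relations q \<xi> \<Longrightarrow> cls r = cls s"
  using pres_eq.relation[of r s "GF_relations q \<xi>" "[]" "[]"] by (simp add: cls_eq_iff)

text \<open>The upper bound that turns the surjection onto \<open>semi 1\<close> into an
  isomorphism: the relations bring every word into the form \<sigma>^a \<tau>^b \<epsilon>^c with
  reduced exponents.\<close>

lemma finite_card_GF: "finite (carrier (GF q \<xi>)) \<and> card (carrier (GF q \<xi>)) \<le> p\<^sup>2 * q"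
proof -
  interpret G: group "GF q \<xi>" by (rule group_GF)
  note [simp del] = G.nat_pow_Suc nat_pow_Suc
  define \<gamma> where "\<gamma> g = cls [(g, True)]" for g
  have car [simp]: "cls u \<in> carrier (GF q \<xi>)" for u by (simp add: GF_carrier)
  have gc [simp]: "\<gamma> g \<in> carrier (GF q \<xi>)" for g by (simp add: \<gamma>_def)
  have inv: "cls [(g, False)] = inv\<^bsub>GF q \<xi>\<^esub> \<gamma> g" for g
  proof (rule G.inv_equality[symmetric])
    have "pres_eq (GF_relations q \<xi>) ([] @ [(g, False), (g, \<not> False)] @ []) ([] @ [])" by (rule pres_eq.cancel)
    then show "cls [(g, False)] \<otimes>\<^bsub>GF q \<xi>\<^esub> \<gamma> g = \<one>\<^bsub>GF q \<xi>\<^esub>"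
      by (simp add: \<gamma>_def cls_mult GF_one cls_eq_iff)
  qed auto
  have pow: "cls (replicate n (g, True)) = \<gamma> g [^]\<^bsub>GF q \<xi>\<^esub> n"
    "cls (replicate n (g, False)) = (inv\<^bsub>GF q \<xi>\<^esub> \<gamma> g) [^]\<^bsub>GF q \<xi>\<^esub> n" for n g
  proof (induction n)
    case (Suc n)
    {
      case 1
      have "cls (replicate (Suc n) (g, True)) = \<gamma> g \<otimes>\<^bsub>GF q \<xi>\<^esub> cls (replicate n (g, True))"
        by (simp add: \<gamma>_def cls_mult)
      then show ?case using Suc by (simp add: G.nat_pow_Suc2)
    next
      case 2
      have "cls (replicate (Suc n) (g, False)) = cls [(g, False)] \<otimes>\<^bsub>GF q \<xi>\<^esub> cls (replicate n (g, False))"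
        by (simp add: cls_mult)
      then show ?case using Suc by (simp add: G.nat_pow_Suc2 inv)
    }
  qed (simp_all add: GF_one)
  have p1: "\<gamma> Sig [^]\<^bsub>GF q \<xi>\<^esub> p = \<one>\<^bsub>GF q \<xi>\<^esub>" "\<gamma> Tau [^]\<^bsub>GF q \<xi>\<^esub> p = \<one>\<^bsub>GF q \<xi>\<^esub>"
    "\<gamma> Eps [^]\<^bsub>GF q \<xi>\<^esub> q = \<one>\<^bsub>GF q \<xi>\<^esub>"
    using cls_relation[of "gpow Sig (int p)" "[]"] cls_relation[of "gpow Tau (int p)" "[]"]
      cls_relation[of "gpow Eps (int q)" "[]"]
    by (simp_all add: GF_relations_def gpow_def card_f GF_one flip: pow)
  have st: "\<gamma> Tau \<otimes>\<^bsub>GF q \<xi>\<^esub> \<gamma> Sig = \<gamma> Sig \<otimes>\<^bsub>GF q \<xi>\<^esub> \<gamma> Tau"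
  proof -
    have "cls ([(Sig, True), (Tau, True)] @ [(Sig, False), (Tau, False)]) = \<one>\<^bsub>GF q \<xi>\<^esub>"
      using cls_relation[of "gpow Sig 1 @ gpow Tau 1 @ gpow Sig (-1) @ gpow Tau (-1)" "[]"]
      by (simp add: GF_relations_def gpow_def GF_one)
    moreover have "cls ([(Sig, True), (Tau, True)] @ [(Sig, False), (Tau, False)]) =
      (\<gamma> Sig \<otimes>\<^bsub>GF q \<xi>\<^esub> \<gamma> Tau) \<otimes>\<^bsub>GF q \<xi>\<^esub> inv\<^bsub>GF q \<xi>\<^esub> (\<gamma> Tau \<otimes>\<^bsub>GF q \<xi>\<^esub> \<gamma> Sig)"
      by (simp add: G.inv_mult_group flip: inv) (simp add: \<gamma>_def cls_mult)
    ultimately show ?thesis by (simp add: G.inv_solve_right G.inv_solve_right')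
  qed
  have es: "\<gamma> Eps \<otimes>\<^bsub>GF q \<xi>\<^esub> \<gamma> Sig = \<gamma> Tau \<otimes>\<^bsub>GF q \<xi>\<^esub> \<gamma> Eps"
  proof -
    have "cls [(Eps, True), (Sig, True), (Eps, False)] = \<gamma> Tau"
      using cls_relation[of "gpow Eps 1 @ gpow Sig 1 @ gpow Eps (-1)" "gpow Tau 1"]
      by (simp add: GF_relations_def gpow_def \<gamma>_def)
    moreover have "cls [(Eps, True), (Sig, True), (Eps, False)] = \<gamma> Eps \<otimes>\<^bsub>GF q \<xi>\<^esub> \<gamma> Sig \<otimes>\<^bsub>GF q \<xi>\<^esub> inv\<^bsub>GF q \<xi>\<^esub> \<gamma> Eps"
      unfolding inv[symmetric] unfolding \<gamma>_def by (simp add: cls_mult)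
    ultimately show ?thesis by (simp add: G.inv_solve_right G.inv_solve_right')
  qed
  \<comment> \<open>The negative exponents of the relation are replaced by natural ones through
    x^(-1) = x^(p-1).\<close>
  obtain j :: nat where et: "\<gamma> Eps \<otimes>\<^bsub>GF q \<xi>\<^esub> \<gamma> Tau =
      \<gamma> Sig [^]\<^bsub>GF q \<xi>\<^esub> (p - 1) \<otimes>\<^bsub>GF q \<xi>\<^esub> \<gamma> Tau [^]\<^bsub>GF q \<xi>\<^esub> j \<otimes>\<^bsub>GF q \<xi>\<^esub> \<gamma> Eps"
  proof -
    define n where "n = nat (to_int_mod_ring \<xi>)"
    have "0 \<le> to_int_mod_ring \<xi>" using range_to_int_mod_ring[where ?'a = 'f] by auto
    then have tau: "gpow Tau (- to_int_mod_ring \<xi>) = replicate n (Tau, False)"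
      by (cases "to_int_mod_ring \<xi> = 0") (auto simp: gpow_def n_def)
    have p0: "p > 0" using p_ge_3 by simp
    have "cls [(Eps, True), (Tau, True), (Eps, False)] = cls ((Sig, False) # gpow Tau (- to_int_mod_ring \<xi>))"
      using cls_relation[of "gpow Eps 1 @ gpow Tau 1 @ gpow Eps (-1)" "gpow Sig (-1) @ gpow Tau (- to_int_mod_ring \<xi>)"]
      by (simp add: GF_relations_def) (simp add: gpow_def)
    also have "\<dots> = cls [(Sig, False)] \<otimes>\<^bsub>GF q \<xi>\<^esub> cls (replicate n (Tau, False))" by (simp add: tau cls_mult)
    also have "\<dots> = \<gamma> Sig [^]\<^bsub>GF q \<xi>\<^esub> (p - 1) \<otimes>\<^bsub>GF q \<xi>\<^esub> \<gamma> Tau [^]\<^bsub>GF q \<xi>\<^esub> ((p - 1) * n)"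
      by (simp add: inv pow G.inv_eq_pow[OF gc p1(1) p0] G.inv_eq_pow[OF gc p1(2) p0] G.nat_pow_pow)
    finally have "cls [(Eps, True), (Tau, True), (Eps, False)] = \<dots>" .
    moreover have "cls [(Eps, True), (Tau, True), (Eps, False)] = \<gamma> Eps \<otimes>\<^bsub>GF q \<xi>\<^esub> \<gamma> Tau \<otimes>\<^bsub>GF q \<xi>\<^esub> inv\<^bsub>GF q \<xi>\<^esub> \<gamma> Eps"
      unfolding inv[symmetric] unfolding \<gamma>_def by (simp add: cls_mult)
    ultimately show ?thesis using that[of "(p - 1) * n"] by (simp add: G.inv_solve_right G.inv_solve_right')
  qed
  define N where "N = {\<gamma> Sig [^]\<^bsub>GF q \<xi>\<^esub> a \<otimes>\<^bsub>GF q \<xi>\<^esub> (\<gamma> Tau [^]\<^bsub>GF q \<xi>\<^esub> b \<otimes>\<^bsub>GF q \<xi>\<^esub> \<gamma> Eps [^]\<^bsub>GF q \<xi>\<^esub> c) | (a :: nat) (b :: nat) (c :: nat). True}"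
  have N_car: "x \<in> carrier (GF q \<xi>)" if "x \<in> N" for x using that by (auto simp: N_def)
  have closed: "\<gamma> g \<otimes>\<^bsub>GF q \<xi>\<^esub> x \<in> N" if "x \<in> N" for g x
    using G.normal_form_closed[OF gc gc gc st es et that[unfolded N_def]] unfolding N_def by (cases g) auto
  have closed_pow: "\<gamma> g [^]\<^bsub>GF q \<xi>\<^esub> n \<otimes>\<^bsub>GF q \<xi>\<^esub> x \<in> N" if "x \<in> N" for g x and n :: nat
    by (induction n) (use that N_car closed in \<open>simp_all add: G.nat_pow_Suc2 G.m_assoc\<close>)
  \<comment> \<open>Inverse letters are handled as positive powers of generators, for which closure
    of \<open>N\<close> is known.\<close>
  have fin_ord: "\<exists>n :: nat. n > 0 \<and> \<gamma> g [^]\<^bsub>GF q \<xi>\<^esub> n = \<one>\<^bsub>GF q \<xi>\<^esub>" for g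
    using p1 p_ge_3 q_ge_3 by (cases g) (auto intro: exI[of _ p] exI[of _ q])
  have "cls u \<in> N" for u
  proof (induction u)
    case Nil
    have "cls [] = \<gamma> Sig [^]\<^bsub>GF q \<xi>\<^esub> (0 :: nat) \<otimes>\<^bsub>GF q \<xi>\<^esub> (\<gamma> Tau [^]\<^bsub>GF q \<xi>\<^esub> (0 :: nat) \<otimes>\<^bsub>GF q \<xi>\<^esub> \<gamma> Eps [^]\<^bsub>GF q \<xi>\<^esub> (0 :: nat))"
      by (simp add: GF_one[symmetric])
    then show ?case unfolding N_def by blast
  next
    case (Cons l u)
    obtain g b where l: "l = (g, b)" by force
    obtain n :: nat where n: "n > 0" "\<gamma> g [^]\<^bsub>GF q \<xi>\<^esub> n = \<one>\<^bsub>GF q \<xi>\<^esub>" using fin_ord by blast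
    have "cls (l # u) = cls [l] \<otimes>\<^bsub>GF q \<xi>\<^esub> cls u" by (simp add: cls_mult)
    moreover have "cls [l] = (if b then \<gamma> g else \<gamma> g [^]\<^bsub>GF q \<xi>\<^esub> (n - 1))"
      using G.inv_eq_pow[OF gc n(2,1)] unfolding l by (cases b) (simp_all add: inv \<gamma>_def[symmetric])
    ultimately show ?case using closed[OF Cons] closed_pow[OF Cons] by simp
  qed
  then have "carrier (GF q \<xi>) \<subseteq> N" by (auto simp: GF_carrier)
  also have "N \<subseteq> (\<lambda>(a, b, c). \<gamma> Sig [^]\<^bsub>GF q \<xi>\<^esub> a \<otimes>\<^bsub>GF q \<xi>\<^esub> (\<gamma> Tau [^]\<^bsub>GF q \<xi>\<^esub> b \<otimes>\<^bsub>GF q \<xi>\<^esub> \<gamma> Eps [^]\<^bsub>GF q \<xi>\<^esub> c)) `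
      ({..<p} \<times> {..<p} \<times> {..<q})" (is "_ \<subseteq> ?f ` ?P")
  proof
    fix x assume "x \<in> N"
    then obtain a b c :: nat where "x = ?f (a, b, c)" unfolding N_def by auto
    also have "\<dots> = ?f (a mod p, b mod p, c mod q)"
      by (simp flip: G.pow_mod[OF gc p1(1)] G.pow_mod[OF gc p1(2)] G.pow_mod[OF gc p1(3)])
    finally show "x \<in> ?f ` ?P" using p_ge_3 q_ge_3 by (intro image_eqI) auto
  qed
  finally have sub: "carrier (GF q \<xi>) \<subseteq> ?f ` ?P" .
  have "card (?f ` ?P) \<le> card ?P" by (rule card_image_le) simp
  also have "card ?P = p\<^sup>2 * q" by (simp add: card_cartesian_product power2_eq_square)
  finally show ?thesis using sub finite_subset[OF sub] card_mono[OF _ sub] by force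
qed

text \<open>Evaluation of words respects the relations and reaches all p^2 q elements, while the
  presented group has at most that many.\<close>

lemma GF_iso: "GF q \<xi> \<cong> semi 1"
proof -
  define h where "h X = word (SOME u. cls u = X)" for X
  have h: "h (cls u) = word u" for u
  proof -
    have "cls (SOME v. cls v = cls u) = cls u" by (rule someI) simp
    then show ?thesis unfolding h_def cls_eq_iff by (rule word_pres_eq)
  qed
  have hom: "h \<in> hom (GF q \<xi>) (semi 1)"
  proof (rule homI)
    show "h X \<in> carrier (semi 1)" if "X \<in> carrier (GF q \<xi>)" for X
      unfolding h_def by (rule word_car)
    show "h (X \<otimes>\<^bsub>GF q \<xi>\<^esub> Y) = h X \<otimes>\<^bsub>semi 1\<^esub> h Y" if "X \<in> carrier (GF q \<xi>)" "Y \<in> carrier (GF q \<xi>)" for X Y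
      using that by (auto simp: GF_carrier cls_mult h word_append)
  qed
  have "carrier (semi 1) \<subseteq> h ` carrier (GF q \<xi>)"
  proof
    fix a assume "a \<in> carrier (semi 1)"
    then obtain x z where a: "a = (x, z)" "z \<in> \<mu>" by auto
    obtain m n where mn: "0 \<le> m" "0 \<le> n" "x = of_int m + of_int n * \<zeta>" by (rule coordE)
    obtain i where i: "z = \<zeta> ^ i" using mu_zeta_powE[OF a(2)] .
    have "h (cls (replicate (nat m) (Sig, True) @ replicate (nat n) (Tau, True) @ replicate i (Eps, True))) = a"
      using mn by (simp add: h word_append word_replicate a(1) i)
    then show "a \<in> h ` carrier (GF q \<xi>)" unfolding GF_carrier by blast
  qed
  with hom have surj: "h ` carrier (GF q \<xi>) = carrier (semi 1)" using hom_carrier[OF hom] by blast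
  have fin: "finite (carrier (GF q \<xi>))" and le: "card (carrier (GF q \<xi>)) \<le> p\<^sup>2 * q" using finite_card_GF by auto
  have "card (h ` carrier (GF q \<xi>)) = p\<^sup>2 * q" unfolding surj by (rule card_semi)
  then have "inj_on h (carrier (GF q \<xi>))"
    using fin le card_image_le[OF fin, of h] by (intro eq_card_imp_inj_on) auto
  with surj hom show ?thesis by (auto intro!: is_isoI simp: iso_def bij_betw_def)
qed

end


context presented_quadratic_field
begin

section \<open>Counting\<close>

text \<open>
  An index \<open>(s, None)\<close> stands for the brace with cocycle \<open>cT\<close>, and \<open>(s, Some n)\<close> for the brace with
  cocycle \<open>cM b\<close>, where \<open>b\<close> is any element of norm \<open>n\<close>.
\<close>

definition index :: "(nat \<times> 'k option) set" where
  "index = {(s, None) | s. s < q} \<union>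
    {(s, Some n) | s n. s < q \<and> n ^ p = n \<and> n \<noteq> 1 \<and> (n = 0 \<or> 2 * s + 1 = q)}"

definition model :: "nat \<times> 'k option \<Rightarrow> ('k \<times> 'k) ring" where
  "model t = (case snd t of None \<Rightarrow> Br (fst t) cT | Some n \<Rightarrow> Br (fst t) (cM (SOME b. nrm b = n)))"

definition ker_card :: "nat \<times> 'k option \<Rightarrow> nat" where
  "ker_card t = (case snd t of
     None \<Rightarrow> if fst t = 0 then p\<^sup>2 * q else p\<^sup>2 | Some _ \<Rightarrow> if fst t = 0 then q else 1)"

text \<open>The exponent e for which the circle group is \<open>semi e\<close>; with c = 0 the twist
  by z^s is added to the additive action of z, hence the shift by one.\<close>

definition circ_exponent :: "nat \<times> 'k option \<Rightarrow> nat" where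
  "circ_exponent t = (case snd t of None \<Rightarrow> Suc (fst t) | Some _ \<Rightarrow> fst t)"

lemma index_cases:
  assumes "t \<in> index"
  obtains (T) s where "s < q" "t = (s, None)" "model t = Br s cT"
  | (M) s b where "s < q" "t = (s, Some (nrm b))" "admissible s b" "model t = Br s (cM b)"
proof -
  from assms consider s where "s < q" "t = (s, None)"
    | s n where "s < q" "n ^ p = n" "n \<noteq> 1" "n = 0 \<or> 2 * s + 1 = q" "t = (s, Some n)"
    unfolding index_def by blast
  then show thesis
  proof cases
    case 1
    then show thesis by (intro T) (auto simp: model_def)
  next
    case 2
    define b where "b = (SOME b. nrm b = n)"
    have "nrm b = n" unfolding b_def by (rule someI_ex) (rule nrm_surj_fixed[OF 2(2)])
    then show thesis using 2 by (intro M[of s b]) (auto simp: model_def b_def[symmetric] admissible_def)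
  qed
qed

lemma model_properties:
  assumes "t \<in> index"
  shows "skew_brace (model t)" "finite (carrier (model t))" "add_monoid (model t) = semi 1"
    "card (ker_lambda (model t)) = ker_card t" "model t \<cong> semi (circ_exponent t)"
proof -
  from assms show "skew_brace (model t)"
    by (cases rule: index_cases) (simp_all add: skew_brace_models)
  from assms show "finite (carrier (model t))" by (cases rule: index_cases) simp_all
  from assms show "add_monoid (model t) = semi 1"
    by (cases rule: index_cases) (simp_all only: add_monoid_Br)
  from assms show "card (ker_lambda (model t)) = ker_card t"
    by (cases rule: index_cases) (auto simp: ker_card_def card_ker_T card_ker_M)
  from assms have "semi (circ_exponent t) \<cong> model t"
  proof (cases rule: index_cases)
    case (T s)
    then show ?thesis using is_isoI[OF semi_iso_BrT[of s]] by (simp add: circ_exponent_def)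
  next
    case (M s b)
    then show ?thesis using is_isoI[OF semi_iso_BrM[of s b]] by (simp add: circ_exponent_def)
  qed
  then show "model t \<cong> semi (circ_exponent t)" by (rule group.iso_sym[OF group_semi])
qed

text \<open>By q \<le> p + 1 < p^2 the four kernel orders are distinct, so the kernel order
  identifies the family and whether s = 0.\<close>

lemma p_sq_ne: "p\<^sup>2 \<noteq> q" "p\<^sup>2 \<noteq> 1" "p\<^sup>2 * q \<noteq> p\<^sup>2" "p\<^sup>2 * q \<noteq> q" "p\<^sup>2 * q \<noteq> 1" "q \<noteq> 1"
proof -
  have "q \<le> p + 1" using q_dvd by (rule dvd_imp_le) simp
  also have "p + 1 < 3 * p" using p_ge_3 by simp
  also have "3 * p \<le> p\<^sup>2" using p_ge_3 by (simp add: power2_eq_square)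
  finally show "p\<^sup>2 \<noteq> q" by simp
  show "p\<^sup>2 \<noteq> 1" "p\<^sup>2 * q \<noteq> p\<^sup>2" "p\<^sup>2 * q \<noteq> q" "p\<^sup>2 * q \<noteq> 1" "q \<noteq> 1"
    using p_ge_3 q_ge_3 by auto
qed

lemma circ_exponent_simps [simp]: "circ_exponent (s, None) = Suc s" "circ_exponent (s, Some n) = s"
  by (simp_all add: circ_exponent_def)

lemma ker_card_iff:
  "ker_card (s, None) = Suc 0 \<longleftrightarrow> False" "ker_card (s, None) = q \<longleftrightarrow> False"
  "ker_card (s, None) = p\<^sup>2 \<longleftrightarrow> s \<noteq> 0" "ker_card (s, None) = p\<^sup>2 * q \<longleftrightarrow> s = 0"
  "ker_card (s, Some n) = Suc 0 \<longleftrightarrow> s \<noteq> 0" "ker_card (s, Some n) = q \<longleftrightarrow> s = 0"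
  "ker_card (s, Some n) = p\<^sup>2 \<longleftrightarrow> False" "ker_card (s, Some n) = p\<^sup>2 * q \<longleftrightarrow> False"
  using p_sq_ne unfolding ker_card_def One_nat_def[symmetric] by (metis fst_conv snd_conv option.case)+

text \<open>The kernel order separates the two families. Inside a family the exponent s is an
  invariant, and for \<open>cM\<close> so is the norm.\<close>

lemma model_inj:
  assumes t: "t \<in> index" "t' \<in> index" and iso: "brace_iso (model t) (model t') \<noteq> {}"
  shows "t = t'"
proof -
  have k: "ker_card t = ker_card t'"
    using card_ker_lambda_iso[OF _ _ iso] model_properties t by metis
  from t(1) show ?thesis
  proof (cases rule: index_cases)
    case (T s)
    from t(2) show ?thesis
    proof (cases rule: index_cases)
      case (T s')
      then show ?thesis using \<open>t = (s, None)\<close> Br_iso_exponent iso \<open>model t = _\<close> \<open>s < q\<close> by simp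
    next
      case (M s' b')
      then show ?thesis using k \<open>t = (s, None)\<close> ker_card_iff by metis
    qed
  next
    case (M s b)
    note Mt = M
    from t(2) show ?thesis
    proof (cases rule: index_cases)
      case (T s')
      then show ?thesis using k Mt(2) ker_card_iff by metis
    next
      case (M s' b')
      have i: "brace_iso (Br s (cM b)) (Br s' (cM b')) \<noteq> {}" using iso M Mt by simp
      have "s = s'" using Br_iso_exponent[OF i] M Mt by simp
      moreover have "nrm b = nrm b'" using BrM_iso_nrm[OF i] M Mt by (simp add: admissible_def)
      ultimately show ?thesis using M Mt by simp
    qed
  qed
qed

lemma GF_braces_iff:
  fixes B :: "'a ring"
  shows "B \<in> GF_braces q \<xi> \<longleftrightarrow> skew_brace B \<and> (\<exists>t \<in> index. brace_iso B (model t) \<noteq> {})"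
proof
  assume "B \<in> GF_braces q \<xi>"
  then have B: "skew_brace B" and "add_monoid B \<cong> GF q \<xi>" by (auto simp: GF_braces_def)
  then have "add_monoid B \<cong> semi 1" using iso_trans GF_iso by blast
  then obtain h where h: "h \<in> iso (add_monoid B) (semi 1)" by (auto simp: is_iso_def)
  interpret B: skew_brace B by fact
  have inj: "inj_on h (carrier B)" and img: "h ` carrier B = UNIV \<times> \<mu>"
    using h by (simp_all add: iso_def bij_betw_def)
  have mult: "h (x \<oplus>\<^bsub>B\<^esub> y) = h x \<otimes>\<^bsub>semi 1\<^esub> h y" if "x \<in> carrier B" "y \<in> carrier B" for x y
    using h that hom_mult[of h "add_monoid B" "semi 1" x y] by (simp add: iso_def del: One_nat_def)
  have zero: "h \<zero>\<^bsub>B\<^esub> = (0, 1)"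
    using hom_one[of h "add_monoid B" "semi 1"] h B.add_group group_semi by (simp add: iso_def del: One_nat_def)
  \<comment> \<open>The copy of B on K x \<mu> whose addition is literally that of
    \<open>semi 1\<close>.\<close>
  let ?T = "transport h B"
  have T: "skew_brace ?T" "h \<in> brace_iso B ?T" using transport[OF B inj] by auto
  interpret T: model_group_brace p q \<zeta> ?T
  proof (intro model_group_brace.intro model_group_brace_axioms.intro T(1))
    show "quadratic_field p q \<zeta>" by unfold_locales
    show car: "carrier ?T = UNIV \<times> \<mu>" by (simp add: transport_def img)
    show "\<zero>\<^bsub>?T\<^esub> = (0, 1)" by (simp add: transport_def zero)
    fix x z y w assume zw: "z \<in> \<mu>" "w \<in> \<mu>"
    have "(x, z) \<in> h ` carrier B" "(y, w) \<in> h ` carrier B" using zw by (simp_all add: img)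
    then obtain a b where ab: "a \<in> carrier B" "b \<in> carrier B" "(x, z) = h a" "(y, w) = h b" by blast
    have "(x, z) \<oplus>\<^bsub>?T\<^esub> (y, w) = h (a \<oplus>\<^bsub>B\<^esub> b)" using brace_isoD(2)[OF T(2)] ab by simp
    also have "\<dots> = (x, z) \<otimes>\<^bsub>semi 1\<^esub> (y, w)" using mult ab by simp
    finally show "(x, z) \<oplus>\<^bsub>?T\<^esub> (y, w) = (x + z * y, z * w)" by simp
  qed
  have BT: "brace_iso B ?T \<noteq> {}" using T(2) by blast
  have "\<exists>t \<in> index. brace_iso B (model t) \<noteq> {}"
  proof (rule T.classification)
    fix s assume s: "s < q" and "brace_iso ?T (Br s cT) \<noteq> {}"
    then have "brace_iso B (model (s, None)) \<noteq> {}" using brace_iso_trans[OF BT] by (simp add: model_def)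
    then show ?thesis using s by (auto simp: index_def)
  next
    fix s b assume s: "s < q" and b: "admissible s b" and iso: "brace_iso ?T (Br s (cM b)) \<noteq> {}"
    let ?t = "(s, Some (nrm b))"
    have t: "?t \<in> index" using s b by (auto simp: index_def admissible_def frob_nrm)
    \<comment> \<open>The model uses a chosen element of norm N(b), possibly different from b;
      \<open>BrM_iso\<close> bridges the gap.\<close>
    from t obtain b' where b': "nrm b' = nrm b" "model ?t = Br s (cM b')"
      by (cases rule: index_cases) auto
    have "brace_iso (Br s (cM b)) (model ?t) \<noteq> {}"
      unfolding b'(2) by (rule BrM_iso) (use b b' in \<open>auto simp: admissible_def\<close>)
    then have "brace_iso B (model ?t) \<noteq> {}" using brace_iso_trans[OF BT] brace_iso_trans[OF iso] by blast
    then show ?thesis using t by blast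
  qed
  with B show "skew_brace B \<and> (\<exists>t \<in> index. brace_iso B (model t) \<noteq> {})" by blast
next
  assume "skew_brace B \<and> (\<exists>t \<in> index. brace_iso B (model t) \<noteq> {})"
  then obtain t h where B: "skew_brace B" and t: "t \<in> index" and h: "h \<in> brace_iso B (model t)" by blast
  have "add_monoid B \<cong> semi 1" using is_isoI[OF brace_isoD(4)[OF h]] unfolding model_properties(3)[OF t] .
  moreover have "semi 1 \<cong> GF q \<xi>" by (rule group.iso_sym[OF group_GF GF_iso])
  ultimately show "B \<in> GF_braces q \<xi>" using B iso_trans by (auto simp: GF_braces_def)
qed

lemma brace_circ_iso:
  assumes "skew_brace B" "t \<in> index" "brace_iso B (model t) \<noteq> {}"
  shows "B \<cong> M \<longleftrightarrow> semi (circ_exponent t) \<cong> M"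
proof -
  interpret B: skew_brace B by fact
  have "B \<cong> model t" using assms(3) brace_isoD(5) is_isoI by fastforce
  then have 1: "B \<cong> semi (circ_exponent t)" using model_properties(5)[OF assms(2)] by (rule iso_trans)
  then have "semi (circ_exponent t) \<cong> B" by (rule B.circ.iso_sym)
  with 1 show ?thesis by (meson iso_trans)
qed

lemma num_iso_classes_GF_braces_of:
  assumes "infinite (UNIV :: 'a set)"
  shows "num_iso_classes (GF_braces_of q \<xi> k M :: 'a ring set)
    (card {t \<in> index. ker_card t = k \<and> semi (circ_exponent t) \<cong> M})"
proof (rule num_iso_classes_models[where model = model])
  have "index \<subseteq> {..<q} \<times> UNIV" by (auto simp: index_def)
  then have "finite index" by (rule finite_subset) simp
  then show "finite {t \<in> index. ker_card t = k \<and> semi (circ_exponent t) \<cong> M}" by simp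
  fix B :: "'a ring"
  have inv: "card (ker_lambda B) = ker_card t" "B \<cong> M \<longleftrightarrow> semi (circ_exponent t) \<cong> M"
    if "skew_brace B" "t \<in> index" "brace_iso B (model t) \<noteq> {}" for t
    using card_ker_lambda_iso[OF that(1) model_properties(1)[OF that(2)] that(3)] model_properties(4)[OF that(2)]
      brace_circ_iso[OF that] by simp_all
  show "B \<in> GF_braces_of q \<xi> k M \<longleftrightarrow> skew_brace B \<and>
      (\<exists>t \<in> {t \<in> index. ker_card t = k \<and> semi (circ_exponent t) \<cong> M}. brace_iso B (model t) \<noteq> {})"
  proof (cases "skew_brace B")
    case True
    have "B \<in> GF_braces_of q \<xi> k M \<longleftrightarrow>
        (\<exists>t \<in> index. brace_iso B (model t) \<noteq> {} \<and> card (ker_lambda B) = k \<and> B \<cong> M)"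
      unfolding GF_braces_of_def mem_Collect_eq GF_braces_iff using True by blast
    also have "\<dots> \<longleftrightarrow> (\<exists>t \<in> index. brace_iso B (model t) \<noteq> {} \<and> ker_card t = k \<and> semi (circ_exponent t) \<cong> M)"
      by (intro bex_cong conj_cong refl) (simp_all add: inv[OF True])
    finally show ?thesis using True by blast
  qed (simp add: GF_braces_of_def GF_braces_iff)
qed (use assms model_properties model_inj in auto)

lemma semi_iso_GF_iff: "semi n \<cong> GF q \<xi> \<longleftrightarrow> \<not> q dvd n"
proof -
  have GF: "semi 1 \<cong> GF q \<xi>" by (rule group.iso_sym[OF group_GF GF_iso])
  show ?thesis
  proof
    assume n: "semi n \<cong> GF q \<xi>"
    show "\<not> q dvd n"
    proof
      assume "q dvd n"
      have "semi 1 \<cong> semi n" using group.iso_sym[OF group_semi iso_trans[OF n GF_iso]] .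
      then show False using semi_1_not_iso_0 semi_iso_0[OF \<open>q dvd n\<close>] iso_trans by blast
    qed
  next
    assume "\<not> q dvd n"
    from semi_iso_1[OF this] GF show "semi n \<cong> GF q \<xi>" by (rule iso_trans)
  qed
qed

lemma semi_iso_Zp2_Zq_iff: "semi n \<cong> Zp2_Zq p q \<longleftrightarrow> q dvd n"
proof -
  have Z: "semi 0 \<cong> Zp2_Zq p q" by (rule group.iso_sym[OF group_Zp2_Zq Zp2_Zq_iso])
  show ?thesis
  proof
    assume n: "semi n \<cong> Zp2_Zq p q"
    show "q dvd n"
    proof (rule ccontr)
      assume "\<not> q dvd n"
      have "semi 1 \<cong> semi n" using group.iso_sym[OF group_semi semi_iso_1[OF \<open>\<not> q dvd n\<close>]] .
      then show False using semi_1_not_iso_0 iso_trans[OF n Zp2_Zq_iso] iso_trans by blast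
    qed
  next
    assume "q dvd n"
    from semi_iso_0[OF this] Z show "semi n \<cong> Zp2_Zq p q" by (rule iso_trans)
  qed
qed

lemma dvd_less_q: "s < q \<Longrightarrow> q dvd s \<longleftrightarrow> s = 0" "s < q \<Longrightarrow> q dvd Suc s \<longleftrightarrow> s = q - 1"
proof -
  show "s < q \<Longrightarrow> q dvd s \<longleftrightarrow> s = 0" using nat_dvd_not_less by auto
  assume s: "s < q"
  show "q dvd Suc s \<longleftrightarrow> s = q - 1"
  proof
    assume "q dvd Suc s"
    then have "q \<le> Suc s" by (rule dvd_imp_le) simp
    with s show "s = q - 1" by simp
  qed (use s in simp)
qed

lemma half_eq: "2 * s + 1 = q \<longleftrightarrow> s = (q - 1) div 2"
  using q(2) by (auto elim!: oddE)

text \<open>q - 1 indices have n = 0 and s nonzero; the other p - 2 have s = (q - 1)/2 and n in the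
  prime field without 0 and 1.\<close>

lemma index_count_1_GF: "card {t \<in> index. ker_card t = 1 \<and> \<not> q dvd circ_exponent t} = p + q - 3"
proof -
  define F where "F = {n :: 'k. n ^ p = n} - {0, 1}"
  have "card F = p - 2"
  proof -
    have "card F = card {n :: 'k. n ^ p = n} - card {0, 1 :: 'k}"
      unfolding F_def by (rule card_Diff_subset) auto
    then show ?thesis by (simp add: card_fixed)
  qed
  define h where "h = (q - 1) div 2"
  have h: "2 * s + 1 = q \<longleftrightarrow> s = h" for s by (simp only: half_eq h_def)
  have h0: "0 < h" "h < q" using q_ge_3 by (auto simp: h_def)
  have "{t \<in> index. ker_card t = 1 \<and> \<not> q dvd circ_exponent t} =
    (\<lambda>s. (s, Some 0)) ` {1..<q} \<union> (\<lambda>n. (h, Some n)) ` F"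
    unfolding index_def F_def h using h0 dvd_less_q(1) by (auto simp: ker_card_iff)
  moreover have "card \<dots> = (q - 1) + (p - 2)"
  proof (subst card_Un_disjoint)
    show "(\<lambda>s. (s, Some 0)) ` {1..<q} \<inter> (\<lambda>n. (h, Some n)) ` F = {}" by (auto simp: F_def)
    show "card ((\<lambda>s. (s, Some (0 :: 'k))) ` {1..<q}) + card ((\<lambda>n. (h, Some n)) ` F) = (q - 1) + (p - 2)"
      using \<open>card F = p - 2\<close> by (simp add: card_image inj_on_def)
  qed auto
  ultimately show ?thesis using p_ge_3 q_ge_3 by simp
qed

lemma index_counts:
  "{t \<in> index. ker_card t = 1 \<and> q dvd circ_exponent t} = {}"
  "{t \<in> index. ker_card t = q \<and> q dvd circ_exponent t} = {(0, Some 0)}"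
  "{t \<in> index. ker_card t = q \<and> \<not> q dvd circ_exponent t} = {}"
  "{t \<in> index. ker_card t = p\<^sup>2 \<and> q dvd circ_exponent t} = {(q - 1, None)}"
  "card {t \<in> index. ker_card t = p\<^sup>2 \<and> \<not> q dvd circ_exponent t} = q - 2"
  "{t \<in> index. ker_card t = p\<^sup>2 * q \<and> \<not> q dvd circ_exponent t} = {(0, None)}"
  "{t \<in> index. ker_card t = p\<^sup>2 * q \<and> q dvd circ_exponent t} = {}"
proof -
  have q0: "q > 0" "q - 1 < q" "q - Suc 0 \<noteq> 0" "(q - Suc 0) div 2 \<noteq> 0" using q_ge_3 by auto
  have "\<not> (ker_card t = 1 \<and> q dvd circ_exponent t)" if "t \<in> index" for t
    using that by (cases rule: index_cases) (auto simp: ker_card_iff dvd_less_q)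
  then show "{t \<in> index. ker_card t = 1 \<and> q dvd circ_exponent t} = {}" by blast
  show "{t \<in> index. ker_card t = q \<and> q dvd circ_exponent t} = {(0, Some 0)}"
    unfolding index_def half_eq using q0 by (auto simp: ker_card_iff dvd_less_q)
  show "{t \<in> index. ker_card t = q \<and> \<not> q dvd circ_exponent t} = {}"
    unfolding index_def half_eq using q0 by (auto simp: ker_card_iff dvd_less_q)
  show "{t \<in> index. ker_card t = p\<^sup>2 \<and> q dvd circ_exponent t} = {(q - 1, None)}"
    unfolding index_def half_eq using q0 by (auto simp: ker_card_iff dvd_less_q)
  have "{t \<in> index. ker_card t = p\<^sup>2 \<and> \<not> q dvd circ_exponent t} = (\<lambda>s. (s, None)) ` {1..<q - 1}"
    unfolding index_def half_eq using q0 by (auto simp: ker_card_iff dvd_less_q)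
  then show "card {t \<in> index. ker_card t = p\<^sup>2 \<and> \<not> q dvd circ_exponent t} = q - 2"
    by (simp add: card_image inj_on_def)
  show "{t \<in> index. ker_card t = p\<^sup>2 * q \<and> \<not> q dvd circ_exponent t} = {(0, None)}"
    unfolding index_def half_eq using q0 by (auto simp: ker_card_iff dvd_less_q)
  show "{t \<in> index. ker_card t = p\<^sup>2 * q \<and> q dvd circ_exponent t} = {}"
    unfolding index_def half_eq using q0 by (auto simp: ker_card_iff dvd_less_q)
qed

lemma GF_braces_properties:
  fixes B :: "'a ring"
  assumes "B \<in> GF_braces q \<xi>"
  shows "card (ker_lambda B) \<in> {1, q, p\<^sup>2, p\<^sup>2 * q} \<and> (B \<cong> GF q \<xi> \<or> B \<cong> Zp2_Zq p q)"
proof -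
  obtain t where B: "skew_brace B" and t: "t \<in> index" and iso: "brace_iso B (model t) \<noteq> {}"
    using assms GF_braces_iff by blast
  have "card (ker_lambda B) = ker_card t"
    using card_ker_lambda_iso[OF B model_properties(1)[OF t] iso] model_properties(4)[OF t] by simp
  moreover have "ker_card t \<in> {1, q, p\<^sup>2, p\<^sup>2 * q}" by (auto simp: ker_card_def split: option.split)
  ultimately show ?thesis
    using brace_circ_iso[OF B t iso, of "GF q \<xi>"] brace_circ_iso[OF B t iso, of "Zp2_Zq p q"]
    unfolding semi_iso_GF_iff semi_iso_Zp2_Zq_iff by auto
qed

end

section \<open>A quadratic extension of the prime field\<close>

text \<open>x^2 - x takes the same value at 0 and 1, so on a finite field it misses some v, and t^2
  = t + v is irreducible. Unlike adjoining the root of a nonsquare, this also covers characteristic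
  2, as an instance for all of \<open>prime_card\<close> requires.\<close>

lemma not_all_sq_minus_self: "\<exists>v :: 'f::prime_card mod_ring. \<forall>x. x * x - x \<noteq> v"
proof -
  let ?f = "\<lambda>x :: 'f mod_ring. x * x - x"
  have "?f 0 = ?f 1" by simp
  then have "\<not> inj ?f" using injD[of ?f 0 1] by auto
  then have "\<not> surj ?f" using finite_UNIV_surj_inj[of ?f] by auto
  then show ?thesis by (auto simp: surj_def) metis
qed

definition ext_const :: "'f::prime_card mod_ring" where
  "ext_const = (SOME v. \<forall>x. x * x - x \<noteq> v)"

lemma ext_const: "x * x - x \<noteq> ext_const"
  using someI_ex[OF not_all_sq_minus_self] unfolding ext_const_def by blast

text \<open>\<open>Quad a b\<close> stands for \<open>a + b t\<close>, where \<open>t\<^sup>2 = t + ext_const\<close>.\<close>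

datatype ('f :: prime_card) quad = Quad (qfst: "'f mod_ring") (qsnd: "'f mod_ring")

text \<open>The expression is the norm of a + b t, the conjugate of t being 1 - t. If it vanished
  with b \<noteq> 0, then - a / b would solve x^2 - x = \<open>ext_const\<close>.\<close>

lemma quad_norm_nonzero:
  fixes a b :: "'f::prime_card mod_ring"
  assumes "a \<noteq> 0 \<or> b \<noteq> 0"
  shows "a * a + a * b - ext_const * b * b \<noteq> 0"
proof
  assume eq: "a * a + a * b - ext_const * b * b = 0"
  show False
  proof (cases "b = 0")
    case False
    have "(- a / b) * (- a / b) - (- a / b) = (a * a + a * b) / (b * b)" using False by (simp add: field_simps)
    also have "\<dots> = ext_const" using eq False by (simp add: field_simps)
    finally show False using ext_const by blast
  qed (use eq assms in auto)
qed

text \<open>The conjugate (a + b) - b t divided by the norm.\<close>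

definition quad_inverse :: "'f::prime_card quad \<Rightarrow> 'f quad" where
  "quad_inverse x = (let n = qfst x * qfst x + qfst x * qsnd x - ext_const * qsnd x * qsnd x
    in Quad ((qfst x + qsnd x) / n) (- qsnd x / n))"

instantiation quad :: (prime_card) field
begin

definition "0 = Quad 0 0"
definition "1 = Quad 1 0"
definition "x + y = Quad (qfst x + qfst y) (qsnd x + qsnd y)"
definition "- x = Quad (- qfst x) (- qsnd x)"
definition "x - y = Quad (qfst x - qfst y) (qsnd x - qsnd y)"
definition "x * y = Quad (qfst x * qfst y + ext_const * qsnd x * qsnd y)
  (qfst x * qsnd y + qsnd x * qfst y + qsnd x * qsnd y)"
definition inverse_quad :: "'a quad \<Rightarrow> 'a quad" where "inverse_quad = quad_inverse"
definition divide_quad :: "'a quad \<Rightarrow> 'a quad \<Rightarrow> 'a quad" where "divide_quad x y = x * quad_inverse y"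

instance
proof
  fix x y z :: "'a quad"
  show "x \<noteq> 0 \<Longrightarrow> inverse x * x = 1"
  proof -
    assume "x \<noteq> 0"
    obtain a b where x: "x = Quad a b" by (cases x)
    define n where "n = a * a + a * b - ext_const * b * b"
    have n: "n \<noteq> 0" using quad_norm_nonzero[of a b] \<open>x \<noteq> 0\<close> by (auto simp: n_def x zero_quad_def)
    have "(a + b) * a + ext_const * (- b) * b = n" "(a + b) * b + - b * a + - b * b = 0"
      by (simp_all add: n_def algebra_simps)
    then have "((a + b) * a + ext_const * (- b) * b) / n = 1" "((a + b) * b + - b * a + - b * b) / n = 0"
      using n by simp_all
    then show "inverse x * x = 1"
      by (simp add: x inverse_quad_def quad_inverse_def times_quad_def one_quad_def n_def[symmetric] add_divide_distrib diff_divide_distrib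
          distrib_right)
  qed
qed (simp_all add: zero_quad_def one_quad_def plus_quad_def uminus_quad_def minus_quad_def times_quad_def
    divide_quad_def inverse_quad_def quad_inverse_def algebra_simps)

end

lemma quad_UNIV: "(UNIV :: 'f::prime_card quad set) = case_prod Quad ` UNIV"
  by (auto simp: image_iff) (metis quad.exhaust)

instance quad :: (prime_card) finite_field
  by (rule finite_fieldI) (simp add: quad_UNIV)

lemma card_quad: "CARD('f::prime_card quad) = CARD('f)\<^sup>2"
proof -
  have "inj (case_prod Quad :: 'f mod_ring \<times> 'f mod_ring \<Rightarrow> _)" by (auto simp: inj_def)
  then have "CARD('f quad) = CARD('f mod_ring \<times> 'f mod_ring)" unfolding quad_UNIV by (rule card_image)
  then show ?thesis by (simp add: power2_eq_square)
qed

lemma quad_simps [simp]: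
  "Quad a b + Quad c d = Quad (a + c) (b + d)" "- Quad a b = Quad (- a) (- b)"
  "Quad a b * Quad c d = Quad (a * c + ext_const * b * d) (a * d + b * c + b * d)"
  by (simp_all add: plus_quad_def times_quad_def uminus_quad_def)

lemma of_int_quad: "of_int (to_int_mod_ring a) = Quad a 0"
proof -
  have nat: "of_nat n = Quad (of_nat n) 0" for n
    by (induction n) (simp_all add: zero_quad_def one_quad_def)
  have "of_int n = Quad (of_int n) 0" for n
    by (cases n rule: int_cases2) (simp_all add: nat)
  moreover have "of_int (to_int_mod_ring a) = a" by (simp add: of_int_of_int_mod_ring)
  ultimately show ?thesis by metis
qed

text \<open>Euler's criterion: nonsquares have h-th power - 1 for h half the order of the
  multiplicative group, so the quotient of two of them has h-th power 1 and is a square.\<close>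

lemma nonsquare_quotient:
  fixes D E :: "'f::prime_card mod_ring"
  assumes odd: "odd CARD('f)" and D: "\<And>y. y * y \<noteq> D" and E: "\<And>y. y * y \<noteq> E"
  shows "\<exists>r. r \<noteq> 0 \<and> D = r * r * E"
proof -
  define h where "h = (CARD('f) - 1) div 2"
  have "CARD('f) > 1" using prime_card[where ?'a = 'f] prime_gt_1_nat by blast
  then have h: "CARD('f) - 1 = 2 * h" "h > 0" using odd by (auto simp: h_def elim!: oddE)
  have squares: "y ^ h = 1 \<longleftrightarrow> (\<exists>x. x \<noteq> 0 \<and> x * x = y)" for y :: "'f mod_ring"
  proof -
    have "(\<lambda>x. x ^ 2) ` (UNIV - {0 :: 'f mod_ring}) = {y. y ^ h = 1}"
      by (rule finite_field_roots_of_unity(1)) (use h in simp_all)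
    then have "y ^ h = 1 \<longleftrightarrow> y \<in> (\<lambda>x. x ^ 2) ` (UNIV - {0})" by (simp only: mem_Collect_eq)
    then show ?thesis by (auto simp: power2_eq_square)
  qed
  have minus: "y ^ h = - 1" if "\<And>x. x * x \<noteq> y" for y :: "'f mod_ring"
  proof -
    have "y \<noteq> 0" using that[of 0] by auto
    then have "y ^ h * y ^ h = 1"
      using finite_field_pow_card_minus_1[of y] h(1) by (simp add: mult_2 power_add)
    then have "(y ^ h - 1) * (y ^ h + 1) = 0" by (simp add: algebra_simps)
    moreover have "y ^ h \<noteq> 1" using that squares by blast
    ultimately show ?thesis by (simp add: eq_neg_iff_add_eq_0)
  qed
  have "(D / E) ^ h = 1" using minus[OF D] minus[OF E] by (simp add: power_divide)
  then obtain r where "r \<noteq> 0" "r * r = D / E" using squares by blast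
  moreover have "E \<noteq> 0" using E[of 0] by auto
  ultimately show ?thesis by (intro exI[of _ r]) simp
qed

lemma mod_ring_two_nonzero:
  assumes "odd CARD('f::prime_card)" shows "(2 :: 'f mod_ring) \<noteq> 0"
proof
  assume "(2 :: 'f mod_ring) = 0"
  then have "(1 :: 'f mod_ring) = - 1" by (simp add: eq_neg_iff_add_eq_0)
  then have "CARD('f) dvd 2"
    using of_nat_eq_0_iff_char_dvd[where ?'a = "'f mod_ring", of 2] \<open>2 = 0\<close> by simp
  then have "CARD('f) \<le> 2" by (rule dvd_imp_le) simp
  moreover have "CARD('f) > 1" using prime_card[where ?'a = 'f] prime_gt_1_nat by blast
  ultimately show False using assms by (cases "CARD('f) = 2") auto
qed

lemma irreducible_quadratic_no_root:
  assumes "irreducible [:1, \<xi>, 1 :: 'k::field:]"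
  shows "x * x + \<xi> * x + 1 \<noteq> 0"
proof
  assume "x * x + \<xi> * x + 1 = 0"
  then have "poly [:1, \<xi>, 1:] x = 0" by (simp add: algebra_simps)
  then have "[:- x, 1:] dvd [:1, \<xi>, 1:]" by (simp only: poly_eq_0_iff_dvd)
  then obtain Q where Q: "[:1, \<xi>, 1:] = [:- x, 1:] * Q" by (rule dvdE)
  then have "Q \<noteq> 0" by auto
  then have "degree Q = 1" using arg_cong[OF Q, of degree] by (subst (asm) degree_mult_eq) auto
  moreover have "[:- x, 1:] dvd 1 \<or> Q dvd 1" using assms Q by (rule irreducibleD)
  ultimately show False using \<open>Q \<noteq> 0\<close> by (auto simp: is_unit_iff_degree)
qed

text \<open>The discriminants \<xi>^2 - 4 of x^2 + \<xi> x + 1 and 1 + 4 v of t^2 - t - v, with v =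
  \<open>ext_const\<close>, are both nonsquares. They differ by a square factor r^2, so the two
  quadratics split in the same extension.\<close>

lemma quad_root:
  fixes \<xi> :: "'f::prime_card mod_ring"
  assumes odd: "odd CARD('f)" and irr: "irreducible [:1, \<xi>, 1:]"
  obtains \<zeta> :: "'f quad" where "\<zeta> * \<zeta> + Quad \<xi> 0 * \<zeta> + 1 = 0" "\<zeta> \<noteq> 1"
proof -
  note two = mod_ring_two_nonzero[OF odd]
  then have four: "(2 :: 'f mod_ring) * 2 \<noteq> 0" by (simp only: mult_eq_0_iff) simp
  have D: "y * y \<noteq> \<xi> * \<xi> - 4" for y
  proof
    assume y: "y * y = \<xi> * \<xi> - 4"
    define x where "x = (y - \<xi>) / 2"
    have "2 * x = y - \<xi>" using two by (simp add: x_def)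
    then have y2: "y = 2 * x + \<xi>" by (simp add: algebra_simps)
    have "2 * 2 * (x * x + \<xi> * x + 1) = 0" using y unfolding y2 by (simp add: algebra_simps)
    then have "x * x + \<xi> * x + 1 = 0" using four by (metis mult_eq_0_iff)
    then show False using irreducible_quadratic_no_root[OF irr] by blast
  qed
  have E: "y * y \<noteq> 1 + 4 * ext_const" for y :: "'f mod_ring"
  proof
    assume y: "y * y = 1 + 4 * ext_const"
    define x where "x = (1 + y) / 2"
    have "2 * x = 1 + y" using two by (simp add: x_def)
    then have y2: "y = 2 * x - 1" by (simp add: algebra_simps)
    have "2 * 2 * (x * x - x) = 2 * 2 * ext_const" using y unfolding y2 by (simp add: algebra_simps)
    then have "x * x - x = ext_const" using four by (metis mult_left_cancel)
    then show False using ext_const by blast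
  qed
  obtain r where r: "r \<noteq> 0" "\<xi> * \<xi> - 4 = r * r * (1 + 4 * ext_const)"
    using nonsquare_quotient[OF odd D E] by blast
  \<comment> \<open>The quadratic formula: (- \<xi> + r (2 t - 1)) / 2 = a + r t, as 2 t - 1 is a
    square root of 1 + 4 \<open>ext_const\<close>.\<close>
  define a where "a = (- r - \<xi>) / 2"
  have "2 * a = - r - \<xi>" using two by (simp add: a_def)
  then have xi: "\<xi> = - r - 2 * a" by (simp add: algebra_simps)
  have "2 * 2 * (a * a + ext_const * r * r + \<xi> * a + 1) = 0"
    using r(2) unfolding xi by (simp add: algebra_simps)
  then have c: "a * a + ext_const * r * r + \<xi> * a + 1 = 0" using four by (metis mult_eq_0_iff)
  have "a * r + r * a + r * r + \<xi> * r = 0" unfolding xi by (simp add: algebra_simps)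
  with c have "Quad a r * Quad a r + Quad \<xi> 0 * Quad a r + 1 = 0"
    by (simp add: one_quad_def zero_quad_def)
  moreover have "Quad a r \<noteq> 1" using r(1) by (simp add: one_quad_def)
  ultimately show ?thesis by (rule that)
qed

section \<open>The order of the companion matrix\<close>

text \<open>The row vector (1, \<zeta>) is a left eigenvector of F with eigenvalue \<zeta>, so (1,
  \<zeta>) F^n = \<zeta>^n (1, \<zeta>). The induction carries both entries of this
  equation.\<close>

lemma F_mat_root_pow:
  fixes \<zeta> :: "'f::prime_card quad"
  assumes root: "\<zeta> * \<zeta> + Quad \<xi> 0 * \<zeta> + 1 = 0"
  shows "\<zeta> ^ mat_order (F_mat \<xi>) = 1"
proof -
  let ?A = "F_mat \<xi>" and ?R = "ring_mat TYPE('f mod_ring) 2 ()"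
  let ?U = "units_of ?R"
  have dim: "dim_row ?A = 2" "dim_col ?A = 2" by (simp_all add: F_mat_def mat_of_rows_list_def)
  have A: "?A \<in> carrier_mat 2 2" using dim by auto
  have entries: "?A $$ (0, 0) = 0" "?A $$ (0, Suc 0) = - 1" "?A $$ (Suc 0, 0) = 1" "?A $$ (Suc 0, Suc 0) = - \<xi>"
    by (simp_all add: F_mat_def mat_of_rows_list_def)
  interpret R: semiring ?R by (rule semiring_mat)
  have prod: "(X * Y) $$ (i, j) = X $$ (i, 0) * Y $$ (0, j) + X $$ (i, Suc 0) * Y $$ (Suc 0, j)"
    if "X \<in> carrier_mat 2 2" "Y \<in> carrier_mat 2 2" "i < 2" "j < 2" for X Y :: "'f mod_ring mat" and i j
    using that by (auto simp: scalar_prod_def numeral_2_eq_2)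
  \<comment> \<open>The inverse of F, which puts F into the unit group where
    \<open>mat_order\<close> is taken.\<close>
  define C where "C = mat_of_rows_list 2 [[- \<xi>, 1], [- 1, 0]]"
  have C: "C \<in> carrier_mat 2 2" "C $$ (0, 0) = - \<xi>" "C $$ (0, Suc 0) = 1" "C $$ (Suc 0, 0) = - 1" "C $$ (Suc 0, Suc 0) = 0"
    by (auto simp: C_def mat_of_rows_list_def)
  have less2: "i < 2 \<longleftrightarrow> i = 0 \<or> i = Suc 0" for i :: nat by auto
  have "?A * C = 1\<^sub>m 2" "C * ?A = 1\<^sub>m 2"
    by (rule eq_matI; use A C in \<open>auto simp: less2 prod entries simp del: index_mult_mat(1)\<close>)+
  then have unit: "?A \<in> Units ?R" using A C(1) by (auto simp: Units_def ring_mat_simps)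
  have group: "group ?U" by (rule R.units_group)
  have A_car: "?A \<in> carrier ?U" using unit by (simp add: units_of_def)
  let ?e = "\<lambda>a :: 'f mod_ring. Quad a 0"
  have "?A [^]\<^bsub>?U\<^esub> n \<in> carrier_mat 2 2 \<and>
      ?e ((?A [^]\<^bsub>?U\<^esub> n) $$ (0, 0)) + ?e ((?A [^]\<^bsub>?U\<^esub> n) $$ (1, 0)) * \<zeta> = \<zeta> ^ n \<and>
      ?e ((?A [^]\<^bsub>?U\<^esub> n) $$ (0, 1)) + ?e ((?A [^]\<^bsub>?U\<^esub> n) $$ (1, 1)) * \<zeta> = \<zeta> ^ Suc n" for n :: nat
  proof (induction n)
    case 0
    show ?case by (simp add: units_of_def ring_mat_simps one_quad_def[symmetric] zero_quad_def[symmetric])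
  next
    case (Suc n)
    define M where "M = ?A [^]\<^bsub>?U\<^esub> n"
    have M: "M \<in> carrier_mat 2 2" using Suc M_def by auto
    have step: "?A [^]\<^bsub>?U\<^esub> Suc n = M * ?A" by (simp add: M_def units_of_def ring_mat_simps)
    have sq: "\<zeta> * \<zeta> = - 1 - ?e \<xi> * \<zeta>" using root by (simp add: eq_neg_iff_add_eq_0 algebra_simps)
    have 1: "?e (M $$ (0, 0)) + ?e (M $$ (1, 0)) * \<zeta> = \<zeta> ^ n"
      "?e (M $$ (0, 1)) + ?e (M $$ (1, 1)) * \<zeta> = \<zeta> ^ Suc n" using Suc M_def by auto
    have e: "?e (- x - \<xi> * y) = - ?e x - ?e \<xi> * ?e y" for x y by (simp add: minus_quad_def)
    have one_lt: "(1 :: nat) < 2" by simp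
    have col: "(M * ?A) $$ (i, 1) = - M $$ (i, 0) - \<xi> * M $$ (i, 1)" if "i < 2" for i
      using that M A by (simp add: prod entries mult.commute del: index_mult_mat(1))
    have "?e ((M * ?A) $$ (0, 0)) + ?e ((M * ?A) $$ (1, 0)) * \<zeta> = \<zeta> ^ Suc n"
      using 1(2) M A by (simp add: prod entries del: index_mult_mat(1))
    moreover have "?e ((M * ?A) $$ (0, 1)) + ?e ((M * ?A) $$ (1, 1)) * \<zeta> =
        - (?e (M $$ (0, 0)) + ?e (M $$ (1, 0)) * \<zeta>) - ?e \<xi> * (?e (M $$ (0, 1)) + ?e (M $$ (1, 1)) * \<zeta>)"
      by (simp only: col[OF pos2] col[OF one_lt] e) (simp add: algebra_simps del: quad_simps)
    moreover have "\<dots> = \<zeta> ^ n * (- 1 - ?e \<xi> * \<zeta>)" unfolding 1 by (simp add: algebra_simps)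
    moreover have "\<dots> = \<zeta> ^ Suc (Suc n)" unfolding sq[symmetric] by simp
    moreover have "M * ?A \<in> carrier_mat 2 2" using M A by (rule mult_carrier_mat)
    ultimately show ?case unfolding step by metis
  qed
  note pow = this
  have "mat_order ?A = group.ord ?U ?A" by (simp add: mat_order_def dim)
  then have "?A [^]\<^bsub>?U\<^esub> mat_order ?A = \<one>\<^bsub>?U\<^esub>" using group.pow_ord_eq_1[OF group A_car] by simp
  then have "?A [^]\<^bsub>?U\<^esub> mat_order ?A = 1\<^sub>m 2" by (simp add: units_of_def ring_mat_simps)
  then have "?e 1 + ?e 0 * \<zeta> = \<zeta> ^ mat_order ?A" using pow[of "mat_order ?A"] by simp
  then show ?thesis by (simp add: one_quad_def[symmetric] zero_quad_def[symmetric])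
qed

theorem mainTheorem4:
  fixes p q :: nat
    and \<xi> :: "'f::prime_card mod_ring"
  assumes "prime p" and "odd p"
    and "prime q" and "odd q"
    and "[int p = -1] (mod int q)"
    and "CARD('f) = p"
    and "irreducible [:1, \<xi>, 1:]"
    and "mat_order (F_mat \<xi>) = q"
    and "infinite (UNIV :: 'a set)"
  shows "num_iso_classes (GF_braces_of q \<xi> 1 (GF q \<xi>) :: 'a ring set) (p + q - 3)
       \<and> num_iso_classes (GF_braces_of q \<xi> 1 (Zp2_Zq p q) :: 'a ring set) 0
       \<and> num_iso_classes (GF_braces_of q \<xi> q (Zp2_Zq p q) :: 'a ring set) 1
       \<and> num_iso_classes (GF_braces_of q \<xi> q (GF q \<xi>) :: 'a ring set) 0
       \<and> num_iso_classes (GF_braces_of q \<xi> (p^2) (Zp2_Zq p q) :: 'a ring set) 1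
       \<and> num_iso_classes (GF_braces_of q \<xi> (p^2) (GF q \<xi>) :: 'a ring set) (q - 2)
       \<and> num_iso_classes (GF_braces_of q \<xi> (p^2 * q) (GF q \<xi>) :: 'a ring set) 1
       \<and> num_iso_classes (GF_braces_of q \<xi> (p^2 * q) (Zp2_Zq p q) :: 'a ring set) 0
       \<and> (\<forall>B \<in> GF_braces q \<xi> :: 'a ring set.
            card (ker_lambda B) \<in> {1, q, p^2, p^2 * q} \<and> (B \<cong> GF q \<xi> \<or> B \<cong> Zp2_Zq p q))"
proof -
  obtain \<zeta> :: "'f quad" where root: "\<zeta> * \<zeta> + Quad \<xi> 0 * \<zeta> + 1 = 0" and z1: "\<zeta> \<noteq> 1"
    using quad_root[of \<xi>] assms by blast
  have "int q dvd int p - (- 1)" using assms(5) by (simp only: cong_iff_dvd_diff)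
  also have "int p - (- 1) = int (p + 1)" by simp
  finally have "int q dvd int (p + 1)" .
  then have "q dvd p + 1" by (simp only: int_dvd_int_iff)
  moreover have "\<zeta> ^ q = 1" using F_mat_root_pow[OF root] assms(8) by simp
  ultimately interpret presented_quadratic_field p q \<zeta> \<xi>
    using assms z1 root by unfold_locales (simp_all add: card_quad of_int_quad)
  note num = num_iso_classes_GF_braces_of[OF assms(9)]
  have "\<forall>B \<in> GF_braces q \<xi> :: 'a ring set.
      card (ker_lambda B) \<in> {1, q, p^2, p^2 * q} \<and> (B \<cong> GF q \<xi> \<or> B \<cong> Zp2_Zq p q)"
    by (intro ballI GF_braces_properties)
  then show ?thesis
    using num[of 1 "GF q \<xi>"] num[of 1 "Zp2_Zq p q"] num[of q "Zp2_Zq p q"] num[of q "GF q \<xi>"]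
      num[of "p^2" "Zp2_Zq p q"] num[of "p^2" "GF q \<xi>"] num[of "p^2 * q" "GF q \<xi>"] num[of "p^2 * q" "Zp2_Zq p q"]
    unfolding semi_iso_GF_iff semi_iso_Zp2_Zq_iff index_count_1_GF index_counts
    by simp
qed

end
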